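(* For all split sequents $\Gamma_1;\Gamma_2$ (pairs of finite sets of PDL formulas), the following are equivalent: (1) $\Gamma_1\cup\Gamma_2$ is not satisfiable; (2) there is a closed split PDL-tableau for $\Gamma_1;\Gamma_2$; (3) there is a uniform, closed split PDL-tableau for $\Gamma_1;\Gamma_2$.
   Context: PDL syntax: $\phi ::= \bot \mid p \mid \lnot\phi \mid \phi\land\phi \mid [\alpha]\phi$, $\alpha ::= a \mid \tau? \mid \alpha\cup\beta \mid \alpha;\beta \mid \alpha^\ast$, standard Kripke semantics. $\Box(\delta_1\cdots\delta_n,\phi)=[\delta_1]\cdots[\delta_n]\phi$. Unfoldings: $\mathit{Tests}(a)=\emptyset$, $\mathit{Tests}(\tau?)=\{\tau\}$, $\mathit{Tests}(\alpha\cup\beta)=\mathit{Tests}(\alpha;\beta)=\mathit{Tests}(\alpha)\cup\mathit{Tests}(\beta)$, $\mathit{Tests}(\alpha^\ast)=\mathit{Tests}(\alpha)$; for a set $\ell$ of formulas, $P^\ell(a)=\{a\}$, $P^\ell(\tau?)=\{\varepsilon\}$ if $\tau\in\ell$ else $\emptyset$, $P^\ell(\beta\cup\gamma)=P^\ell(\beta)\cup P^\ell(\gamma)$, $P^\ell(\beta;\gamma)=\{\bar\beta\gamma\mid\bar\beta\in P^\ell(\beta)\setminus\{\varepsilon\}\}\cup\{\bar\gamma\mid\bar\gamma\in P^\ell(\gamma),\varepsilon\in P^\ell(\beta)\}$, $P^\ell(\beta^\ast)=\{\varepsilon\}\cup\{\bar\beta\beta^\ast\mid\bar\beta\in P^\ell(\beta)\setminus\{\varepsilon\}\}$;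 $\mathsf{unfold}_\Box(\alpha,\psi)=\{\{\lnot\tau\mid\tau\in\mathit{Tests}(\alpha)\setminus\ell\}\cup\{\Box(\bar\alpha,\psi)\mid\bar\alpha\in P^\ell(\alpha)\}\mid\ell\subseteq\mathit{Tests}(\alpha)\}$. $H_a=\{(\emptyset,a)\}$, $H_{\tau?}=\{(\{\tau\},\varepsilon)\}$, $H_{\alpha\cup\beta}=H_\alpha\cup H_\beta$, $H_{\alpha;\beta}=\{(X,\bar\delta\beta)\mid(X,\bar\delta)\in H_\alpha,\bar\delta\ne\varepsilon\}\cup\{(X\cup Y,\bar\delta)\mid(X,\varepsilon)\in H_\alpha,(Y,\bar\delta)\in H_\beta\}$, $H_{\alpha^\ast}=\{(\emptyset,\varepsilon)\}\cup\{(X,\bar\delta\alpha^\ast)\mid(X,\bar\delta)\in H_\alpha,\bar\delta\ne\varepsilon\}$; $\mathsf{unfold}_\Diamond(\alpha,\psi)=\{X\cup\{\lnot\Box(\bar\delta,\psi)\}\mid(X,\bar\delta)\in H_\alpha\}$. Loading: marked copies $\underline\alpha$ of programs (semantically identical); a loaded formula is $\lnot[\underline{\alpha_1}]\cdots[\underline{\alpha_n}]\phi$ ($n\ge1$, $\phi$ unmarked); $\xi$ ranges over PDL formulas and $[\underline{\alpha_1}]\cdots[\underline{\alpha_k}]\phi$; $\underline{\mathsf{unfold}}_\Diamond(\alpha,\xi)=\{X\cup\{\lnot[\underline{\delta_1}]\cdots[\underline{\delta_n}]\xi\}\mid(X,\delta_1\cdots\delta_n)\in H_\alpha\}$. A set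 of formulas is loaded if it contains a loaded formula, else free; basic if all its formulas have the form $\bot,\lnot\bot,p,\lnot p,[a]\phi,\lnot[a]\phi$ ($a$ atomic). $\Delta_a=\{\phi\mid[a]\phi\in\Delta\}$. Split rules: a split sequent is a pair $\Gamma_1;\Gamma_2$ of finite sets. For $i\in\{1,2\}$, each rule $R_i$ acts on a principal formula in component $i$ (not in the remaining context $\Delta$ of that component), leaving the other component $\Gamma$ unchanged: $(\lnot)_i$: $\lnot\lnot\phi\mapsto\phi$; $(\land)_i$: $\phi\land\psi\mapsto\phi,\psi$; $(\lnot\land)_i$: two children with $\lnot\phi$ resp. $\lnot\psi$; $(\Box)_i$: $[\alpha]\phi$ ($\alpha$ non-atomic) replaced by $\Sigma$, one child per $\Sigma\in\mathsf{unfold}_\Box(\alpha,\phi)$; $(\Diamond)_i$: $\lnot[\alpha]\phi$ ($\alpha$ non-atomic) replaced by $\Sigma\in\mathsf{unfold}_\Diamond(\alpha,\phi)$; $(\underline\Diamond)_i$: $\lnot[\underline\alpha]\xi$ ($\alpha$ non-atomic) replaced by $\Sigma\in\underline{\mathsf{unfold}}_\Diamond(\alpha,\xi)$; $(L+)_i$: $\lnot[a][\alpha_1]\cdots[\alpha_n]\phi\mapsto\lnot[\underline a][\underline{\alpha_1}]\cdots[\underline{\alpha_n}]\phi$ when $\Delta,\Gamma$ are free and basic and $n\ge0$ is maximal; $(L-)_i$: $\lnot[\underline{\alpha_1}]\cdots[\underline{\alpha_n}]\phi\mapsto\lnot[\alpha_1]\cdots[\alpha_n]\phi$ when $n\ge1$;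 $(L-)_i$ may not be applied to a node produced by $(L+)_i$. Modal rules: $(M)_1$: $\Delta,\lnot[\underline a]\xi;\Gamma\,/\,\Delta_a,\lnot\xi;\Gamma_a$ and $(M)_2$: $\Gamma;\Delta,\lnot[\underline a]\xi\,/\,\Gamma_a;\Delta_a,\lnot\xi$, with $\Delta,\Gamma$ basic. Rules other than $(M)_i$ are local. A split tableau is a rooted tree labelled with split sequents where each interior node and its children form a rule instance. A repeat is a node whose label (both components) equals that of a proper ancestor (nearest: companion); a node is loaded if $\Gamma_1\cup\Gamma_2$ is loaded, free otherwise; a loaded-path repeat is a repeat such that all nodes from its companion to it are loaded. A split PDL-tableau is one where all loaded-path repeats and all free repeats are leaves; it is closed if every leaf is a loaded-path repeat or has a label $\Gamma_1;\Gamma_2$ such that $\Gamma_1\cup\Gamma_2$ contains $\bot$ or some $\phi$ and $\lnot\phi$. It is uniform if: (U1) whenever a node $s$ has a loaded component, a local rule is applied at $s$ to a formula in its unloaded component unless that component is basic; (U2) whenever $s,t$ have the same $i$-th component which is loaded and not basic, and the unloaded components of both $s$ and $t$ are basic, then the same rule is applied at $s$ and $t$ to the same formula in the loaded component. *)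

theory Defs
  imports Main "HOL-Library.Sublist"
begin

datatype ('p, 'a) fml =
    Bot
  | Prop 'p
  | Neg "('p, 'a) fml"
  | And "('p, 'a) fml" "('p, 'a) fml"
  | Box "('p, 'a) prog" "('p, 'a) fml"
and ('p, 'a) prog =
    Atom 'a
  | Test "('p, 'a) fml"
  | Choice "('p, 'a) prog" "('p, 'a) prog"
  | Seq "('p, 'a) prog" "('p, 'a) prog"
  | Star "('p, 'a) prog"

record ('w, 'p, 'a) kripke =
  worlds :: "'w set"
  acc :: "'a \<Rightarrow> ('w \<times> 'w) set"
  val :: "'p \<Rightarrow> 'w set"

definition kripke_model :: "('w, 'p, 'a) kripke \<Rightarrow> bool" where
  "kripke_model M \<longleftrightarrow>
     (\<forall>a. acc M a \<subseteq> worlds M \<times> worlds M) \<and> (\<forall>p. val M p \<subseteq> worlds M)"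

primrec holds :: "('w, 'p, 'a) kripke \<Rightarrow> ('p, 'a) fml \<Rightarrow> 'w \<Rightarrow> bool"
  and rel :: "('w, 'p, 'a) kripke \<Rightarrow> ('p, 'a) prog \<Rightarrow> ('w \<times> 'w) set"
where
  "holds M Bot = (\<lambda>w. False)"
| "holds M (Prop p) = (\<lambda>w. w \<in> val M p)"
| "holds M (Neg \<phi>) = (\<lambda>w. \<not> holds M \<phi> w)"
| "holds M (And \<phi> \<psi>) = (\<lambda>w. holds M \<phi> w \<and> holds M \<psi> w)"
| "holds M (Box \<alpha> \<phi>) = (\<lambda>w. \<forall>v. (w, v) \<in> rel M \<alpha> \<longrightarrow> holds M \<phi> v)"
| "rel M (Atom a) = acc M a"
| "rel M (Test \<tau>) = {(w, w) | w. w \<in> worlds M \<and> holds M \<tau> w}"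
| "rel M (Choice \<alpha> \<beta>) = rel M \<alpha> \<union> rel M \<beta>"
| "rel M (Seq \<alpha> \<beta>) = rel M \<alpha> O rel M \<beta>"
| "rel M (Star \<alpha>) = (rel M \<alpha>)\<^sup>* \<inter> worlds M \<times> worlds M"

text \<open>
  HOL cannot quantify over all types of worlds inside a formula, so the type of worlds is an
  explicit parameter; the models over it are those on an arbitrary subset of that type.
\<close>

definition satisfiable :: "'w itself \<Rightarrow> ('p, 'a) fml set \<Rightarrow> bool" where
  "satisfiable TYPE('w) \<Gamma> \<longleftrightarrow>
     (\<exists>(M :: ('w, 'p, 'a) kripke) w.
        kripke_model M \<and> w \<in> worlds M \<and> (\<forall>\<phi>\<in>\<Gamma>. holds M \<phi> w))"

definition boxes :: "('p, 'a) prog list \<Rightarrow> ('p, 'a) fml \<Rightarrow> ('p, 'a) fml" where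
  "boxes \<delta>s \<phi> = foldr Box \<delta>s \<phi>"

fun tests :: "('p, 'a) prog \<Rightarrow> ('p, 'a) fml set" where
  "tests (Atom a) = {}"
| "tests (Test \<tau>) = {\<tau>}"
| "tests (Choice \<alpha> \<beta>) = tests \<alpha> \<union> tests \<beta>"
| "tests (Seq \<alpha> \<beta>) = tests \<alpha> \<union> tests \<beta>"
| "tests (Star \<alpha>) = tests \<alpha>"

fun Pset :: "('p, 'a) fml set \<Rightarrow> ('p, 'a) prog \<Rightarrow> ('p, 'a) prog list set" where
  "Pset l (Atom a) = {[Atom a]}"
| "Pset l (Test \<tau>) = (if \<tau> \<in> l then {[]} else {})"
| "Pset l (Choice \<beta> \<gamma>) = Pset l \<beta> \<union> Pset l \<gamma>"
| "Pset l (Seq \<beta> \<gamma>) =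
     {bs @ [\<gamma>] | bs. bs \<in> Pset l \<beta> - {[]}} \<union> {cs. cs \<in> Pset l \<gamma> \<and> [] \<in> Pset l \<beta>}"
| "Pset l (Star \<beta>) = {[]} \<union> {bs @ [Star \<beta>] | bs. bs \<in> Pset l \<beta> - {[]}}"

definition unfold_box :: "('p, 'a) prog \<Rightarrow> ('p, 'a) fml \<Rightarrow> ('p, 'a) fml set set" where
  "unfold_box \<alpha> \<psi> =
     {{Neg \<tau> | \<tau>. \<tau> \<in> tests \<alpha> - l} \<union> {boxes as \<psi> | as. as \<in> Pset l \<alpha>} | l. l \<subseteq> tests \<alpha>}"

fun Hset :: "('p, 'a) prog \<Rightarrow> (('p, 'a) fml set \<times> ('p, 'a) prog list) set" where
  "Hset (Atom a) = {({}, [Atom a])}"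
| "Hset (Test \<tau>) = {({\<tau>}, [])}"
| "Hset (Choice \<alpha> \<beta>) = Hset \<alpha> \<union> Hset \<beta>"
| "Hset (Seq \<alpha> \<beta>) =
     {(X, \<delta>s @ [\<beta>]) | X \<delta>s. (X, \<delta>s) \<in> Hset \<alpha> \<and> \<delta>s \<noteq> []} \<union>
     {(X \<union> Y, \<delta>s) | X Y \<delta>s. (X, []) \<in> Hset \<alpha> \<and> (Y, \<delta>s) \<in> Hset \<beta>}"
| "Hset (Star \<alpha>) =
     {({}, [])} \<union> {(X, \<delta>s @ [Star \<alpha>]) | X \<delta>s. (X, \<delta>s) \<in> Hset \<alpha> \<and> \<delta>s \<noteq> []}"

definition unfold_dia :: "('p, 'a) prog \<Rightarrow> ('p, 'a) fml \<Rightarrow> ('p, 'a) fml set set" where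
  "unfold_dia \<alpha> \<psi> = {X \<union> {Neg (boxes \<delta>s \<psi>)} | X \<delta>s. (X, \<delta>s) \<in> Hset \<alpha>}"

text \<open>
  \<open>xi\<close> is the range of the metavariable \<open>\<xi>\<close>: a PDL formula under \<open>k \<ge> 0\<close> marked boxes.
  \<open>NegLd \<alpha> \<xi>\<close> is the loaded formula \<open>\<not>[\<alpha>]\<xi>\<close> with \<open>\<alpha>\<close> marked, so a loaded formula has at
  least one marked box.
\<close>

datatype ('p, 'a) xi =
    Unl "('p, 'a) fml"
  | LdBox "('p, 'a) prog" "('p, 'a) xi"

datatype ('p, 'a) efml =
    Fm "('p, 'a) fml"
  | NegLd "('p, 'a) prog" "('p, 'a) xi"

fun neg_xi :: "('p, 'a) xi \<Rightarrow> ('p, 'a) efml" where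
  "neg_xi (Unl \<phi>) = Fm (Neg \<phi>)"
| "neg_xi (LdBox \<alpha> \<xi>) = NegLd \<alpha> \<xi>"

definition ld_boxes :: "('p, 'a) prog list \<Rightarrow> ('p, 'a) xi \<Rightarrow> ('p, 'a) xi" where
  "ld_boxes \<delta>s \<xi> = foldr LdBox \<delta>s \<xi>"

definition unfold_ld_dia :: "('p, 'a) prog \<Rightarrow> ('p, 'a) xi \<Rightarrow> ('p, 'a) efml set set" where
  "unfold_ld_dia \<alpha> \<xi> = {Fm ` X \<union> {neg_xi (ld_boxes \<delta>s \<xi>)} | X \<delta>s. (X, \<delta>s) \<in> Hset \<alpha>}"

definition loaded :: "('p, 'a) efml set \<Rightarrow> bool" where
  "loaded \<Gamma> \<longleftrightarrow> (\<exists>\<alpha> \<xi>. NegLd \<alpha> \<xi> \<in> \<Gamma>)"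

abbreviation free :: "('p, 'a) efml set \<Rightarrow> bool" where
  "free \<Gamma> \<equiv> \<not> loaded \<Gamma>"

text \<open>Being basic is insensitive to marks: \<open>\<not>[a]\<xi>\<close> is basic whether or not \<open>a\<close> is marked.\<close>

inductive basic_fml :: "('p, 'a) efml \<Rightarrow> bool" where
  "basic_fml (Fm Bot)"
| "basic_fml (Fm (Neg Bot))"
| "basic_fml (Fm (Prop p))"
| "basic_fml (Fm (Neg (Prop p)))"
| "basic_fml (Fm (Box (Atom a) \<phi>))"
| "basic_fml (Fm (Neg (Box (Atom a) \<phi>)))"
| "basic_fml (NegLd (Atom a) \<xi>)"

definition basic :: "('p, 'a) efml set \<Rightarrow> bool" where
  "basic \<Gamma> \<longleftrightarrow> (\<forall>\<chi>\<in>\<Gamma>. basic_fml \<chi>)"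

definition modal_proj :: "'a \<Rightarrow> ('p, 'a) efml set \<Rightarrow> ('p, 'a) efml set" where
  "modal_proj a \<Delta> = {Fm \<phi> | \<phi>. Fm (Box (Atom a) \<phi>) \<in> \<Delta>}"

type_synonym ('p, 'a) sequent = "('p, 'a) efml set \<times> ('p, 'a) efml set"

definition split_sequent :: "('p, 'a) sequent \<Rightarrow> bool" where
  "split_sequent S \<longleftrightarrow> finite (fst S) \<and> finite (snd S)"

datatype side = One | Two

fun other :: "side \<Rightarrow> side" where
  "other One = Two"
| "other Two = One"

fun component :: "side \<Rightarrow> ('p, 'a) sequent \<Rightarrow> ('p, 'a) efml set" where
  "component One S = fst S"
| "component Two S = snd S"

text \<open>\<open>mk_sequent i \<Delta> \<Gamma>\<close> has \<open>\<Delta>\<close> as component \<open>i\<close> and \<open>\<Gamma>\<close> as the other component.\<close>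

fun mk_sequent :: "side \<Rightarrow> ('p, 'a) efml set \<Rightarrow> ('p, 'a) efml set \<Rightarrow> ('p, 'a) sequent" where
  "mk_sequent One \<Delta> \<Gamma> = (\<Delta>, \<Gamma>)"
| "mk_sequent Two \<Delta> \<Gamma> = (\<Gamma>, \<Delta>)"

datatype rname = RNeg | RAnd | RNegAnd | RBox | RDia | RLdDia | RLPlus | RLMinus | RM

definition local_rule :: "rname \<Rightarrow> bool" where
  "local_rule r \<longleftrightarrow> r \<noteq> RM"

definition atomic :: "('p, 'a) prog \<Rightarrow> bool" where
  "atomic \<alpha> \<longleftrightarrow> (\<exists>a. \<alpha> = Atom a)"

text \<open>
  \<open>replacement r \<chi> \<Delta> \<Gamma> \<Sigma>s\<close>: the local rule \<open>r\<close> may be applied to the principal formula \<open>\<chi>\<close> with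
  remaining context \<open>\<Delta>\<close> in its own component and \<open>\<Gamma>\<close> in the other one, and it has one child for
  each entry of \<open>\<Sigma>s\<close>, in which \<open>\<chi>\<close> is replaced by that entry. An unfolding may be listed in any
  order.
\<close>

inductive replacement ::
  "rname \<Rightarrow> ('p, 'a) efml \<Rightarrow> ('p, 'a) efml set \<Rightarrow> ('p, 'a) efml set \<Rightarrow> ('p, 'a) efml set list \<Rightarrow> bool"
where
  neg: "replacement RNeg (Fm (Neg (Neg \<phi>))) \<Delta> \<Gamma> [{Fm \<phi>}]"
| conj: "replacement RAnd (Fm (And \<phi> \<psi>)) \<Delta> \<Gamma> [{Fm \<phi>, Fm \<psi>}]"
| neg_conj: "replacement RNegAnd (Fm (Neg (And \<phi> \<psi>))) \<Delta> \<Gamma> [{Fm (Neg \<phi>)}, {Fm (Neg \<psi>)}]"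
| box: "\<not> atomic \<alpha> \<Longrightarrow> distinct \<Sigma>s \<Longrightarrow> set \<Sigma>s = unfold_box \<alpha> \<phi> \<Longrightarrow>
    replacement RBox (Fm (Box \<alpha> \<phi>)) \<Delta> \<Gamma> (map ((`) Fm) \<Sigma>s)"
| dia: "\<not> atomic \<alpha> \<Longrightarrow> distinct \<Sigma>s \<Longrightarrow> set \<Sigma>s = unfold_dia \<alpha> \<phi> \<Longrightarrow>
    replacement RDia (Fm (Neg (Box \<alpha> \<phi>))) \<Delta> \<Gamma> (map ((`) Fm) \<Sigma>s)"
| ld_dia: "\<not> atomic \<alpha> \<Longrightarrow> distinct \<Sigma>s \<Longrightarrow> set \<Sigma>s = unfold_ld_dia \<alpha> \<xi> \<Longrightarrow>
    replacement RLdDia (NegLd \<alpha> \<xi>) \<Delta> \<Gamma> \<Sigma>s"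
| lplus: "free \<Delta> \<Longrightarrow> basic \<Delta> \<Longrightarrow> free \<Gamma> \<Longrightarrow> basic \<Gamma> \<Longrightarrow> (\<forall>\<beta> \<psi>. \<phi> \<noteq> Box \<beta> \<psi>) \<Longrightarrow>
    replacement RLPlus (Fm (Neg (Box (Atom a) (boxes \<alpha>s \<phi>)))) \<Delta> \<Gamma>
      [{NegLd (Atom a) (ld_boxes \<alpha>s (Unl \<phi>))}]"
| lminus:
    "replacement RLMinus (NegLd \<alpha> (ld_boxes \<alpha>s (Unl \<phi>))) \<Delta> \<Gamma> [{Fm (Neg (Box \<alpha> (boxes \<alpha>s \<phi>)))}]"

type_synonym ('p, 'a) rule_app = "rname \<times> side \<times> ('p, 'a) efml"

inductive rule_inst ::
  "('p, 'a) rule_app \<Rightarrow> ('p, 'a) sequent \<Rightarrow> ('p, 'a) sequent list \<Rightarrow> bool"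
where
  local: "\<chi> \<notin> \<Delta> \<Longrightarrow> replacement r \<chi> \<Delta> \<Gamma> \<Sigma>s \<Longrightarrow>
    rule_inst (r, i, \<chi>) (mk_sequent i (insert \<chi> \<Delta>) \<Gamma>) (map (\<lambda>\<Sigma>. mk_sequent i (\<Delta> \<union> \<Sigma>) \<Gamma>) \<Sigma>s)"
| modal: "NegLd (Atom a) \<xi> \<notin> \<Delta> \<Longrightarrow> basic \<Delta> \<Longrightarrow> basic \<Gamma> \<Longrightarrow>
    rule_inst (RM, i, NegLd (Atom a) \<xi>) (mk_sequent i (insert (NegLd (Atom a) \<xi>) \<Delta>) \<Gamma>)
      [mk_sequent i (insert (neg_xi \<xi>) (modal_proj a \<Delta>)) (modal_proj a \<Gamma>)]"

text \<open>
  Nodes are addresses: the root is the empty list and the children of \<open>s\<close> are the nodes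
  \<open>s @ [k]\<close>. The tree may be infinite. \<open>applied T s\<close> is the rule applied at \<open>s\<close>, with the
  component it acts on and its principal formula; it is meaningful at interior nodes only.
\<close>

record ('p, 'a) tableau =
  nodes :: "nat list set"
  label :: "nat list \<Rightarrow> ('p, 'a) sequent"
  applied :: "nat list \<Rightarrow> ('p, 'a) rule_app"

definition interior :: "('p, 'a) tableau \<Rightarrow> nat list \<Rightarrow> bool" where
  "interior T s \<longleftrightarrow> s \<in> nodes T \<and> (\<exists>k. s @ [k] \<in> nodes T)"

definition leaf :: "('p, 'a) tableau \<Rightarrow> nat list \<Rightarrow> bool" where
  "leaf T s \<longleftrightarrow> s \<in> nodes T \<and> (\<forall>k. s @ [k] \<notin> nodes T)"

definition split_tableau :: "('p, 'a) tableau \<Rightarrow> bool" where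
  "split_tableau T \<longleftrightarrow>
     [] \<in> nodes T \<and>
     (\<forall>s k. s @ [k] \<in> nodes T \<longrightarrow> s \<in> nodes T) \<and>
     (\<forall>s\<in>nodes T. split_sequent (label T s)) \<and>
     (\<forall>s. interior T s \<longrightarrow>
        (\<exists>Ss. rule_inst (applied T s) (label T s) Ss \<and>
              (\<forall>k. s @ [k] \<in> nodes T \<longleftrightarrow> k < length Ss) \<and>
              (\<forall>k<length Ss. label T (s @ [k]) = Ss ! k))) \<and>
     (\<forall>s k i \<chi> \<chi>'. interior T (s @ [k]) \<and> applied T s = (RLPlus, i, \<chi>) \<longrightarrow>
        applied T (s @ [k]) \<noteq> (RLMinus, i, \<chi>'))"

definition loaded_node :: "('p, 'a) tableau \<Rightarrow> nat list \<Rightarrow> bool" where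
  "loaded_node T s \<longleftrightarrow> loaded (fst (label T s) \<union> snd (label T s))"

definition repeat :: "('p, 'a) tableau \<Rightarrow> nat list \<Rightarrow> bool" where
  "repeat T s \<longleftrightarrow> s \<in> nodes T \<and> (\<exists>t. strict_prefix t s \<and> label T t = label T s)"

definition companion :: "('p, 'a) tableau \<Rightarrow> nat list \<Rightarrow> nat list \<Rightarrow> bool" where
  "companion T s c \<longleftrightarrow>
     strict_prefix c s \<and> label T c = label T s \<and>
     (\<forall>t. strict_prefix c t \<and> strict_prefix t s \<longrightarrow> label T t \<noteq> label T s)"

definition loaded_path_repeat :: "('p, 'a) tableau \<Rightarrow> nat list \<Rightarrow> bool" where
  "loaded_path_repeat T s \<longleftrightarrow>
     repeat T s \<and>
     (\<exists>c. companion T s c \<and> (\<forall>t. prefix c t \<and> prefix t s \<longrightarrow> loaded_node T t))"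

definition free_repeat :: "('p, 'a) tableau \<Rightarrow> nat list \<Rightarrow> bool" where
  "free_repeat T s \<longleftrightarrow> repeat T s \<and> \<not> loaded_node T s"

definition split_pdl_tableau :: "('p, 'a) tableau \<Rightarrow> bool" where
  "split_pdl_tableau T \<longleftrightarrow>
     split_tableau T \<and>
     (\<forall>s\<in>nodes T. loaded_path_repeat T s \<or> free_repeat T s \<longrightarrow> leaf T s)"

definition closed_label :: "('p, 'a) sequent \<Rightarrow> bool" where
  "closed_label S \<longleftrightarrow>
     Fm Bot \<in> fst S \<union> snd S \<or>
     (\<exists>\<phi>. Fm \<phi> \<in> fst S \<union> snd S \<and> Fm (Neg \<phi>) \<in> fst S \<union> snd S)"

definition closed_tableau :: "('p, 'a) tableau \<Rightarrow> bool" where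
  "closed_tableau T \<longleftrightarrow>
     (\<forall>s. leaf T s \<longrightarrow> loaded_path_repeat T s \<or> closed_label (label T s))"

text \<open>
  The two uniformity conditions constrain interior nodes: no rule is applied at a leaf.
\<close>

definition uniform1 :: "('p, 'a) tableau \<Rightarrow> bool" where
  "uniform1 T \<longleftrightarrow>
     (\<forall>s i. interior T s \<and> loaded (component i (label T s)) \<and>
        free (component (other i) (label T s)) \<and> \<not> basic (component (other i) (label T s)) \<longrightarrow>
        (\<exists>r \<chi>. local_rule r \<and> applied T s = (r, other i, \<chi>)))"

definition uniform2 :: "('p, 'a) tableau \<Rightarrow> bool" where
  "uniform2 T \<longleftrightarrow>
     (\<forall>s t i. interior T s \<and> interior T t \<and>
        component i (label T s) = component i (label T t) \<and>
        loaded (component i (label T s)) \<and> \<not> basic (component i (label T s)) \<and>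
        free (component (other i) (label T s)) \<and> basic (component (other i) (label T s)) \<and>
        free (component (other i) (label T t)) \<and> basic (component (other i) (label T t)) \<longrightarrow>
        (\<exists>r \<chi>. applied T s = (r, i, \<chi>) \<and> applied T t = (r, i, \<chi>)))"

definition uniform :: "('p, 'a) tableau \<Rightarrow> bool" where
  "uniform T \<longleftrightarrow> uniform1 T \<and> uniform2 T"

definition tableau_for ::
  "('p, 'a) tableau \<Rightarrow> ('p, 'a) fml set \<Rightarrow> ('p, 'a) fml set \<Rightarrow> bool" where
  "tableau_for T \<Gamma>1 \<Gamma>2 \<longleftrightarrow> label T [] = (Fm ` \<Gamma>1, Fm ` \<Gamma>2)"

end

theory Submission
  imports Defs "HOL-Library.Multiset"
begin

text \<open>
  Soundness. Follow a satisfied sequent through a closed tableau. On a loaded path follow a run of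
  the loaded programs that witnesses the loaded formula: the length of the run never grows, and it
  or else the size of the sequent drops at every step, so a loop through a loaded-path repeat can
  be taken only finitely often.

  Completeness. The prover's choices form a game on the finite set of sequents over the
  Fischer-Ladner closure; the prover wins an infinite play iff it is loaded from some point on.
  A winning position of the prover has a positional strategy, ranked by the number of visits to
  free sequents that are still possible, and its unravelling is a closed tableau without free
  repeats. As the only choices are at basic sequents, it is uniform. If the prover does not win,
  then the builder can leave every loaded stretch in finitely many steps, that is, fulfil every
  loaded formula, and the basic sequents won by the builder form a finite model.
\<close>

text \<open>An element of \<open>Pset l\<close> is a residual of \<open>Hset\<close> whose tests lie
  in \<open>l\<close>; hence all three unfoldings execute one machine, \<open>run\<close>, up to the
  next atomic program. Three obstacles shape the rest. Loads: the rules do not limit the number of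
  loaded formulas, but below a free root every sequent carries at most one, and its run is the one
  that is followed. History: the ban on (L-) directly after (L+) is no condition on a sequent. The
  game ignores it; ranks enforce it, because (L-) would restore the free sequent just left, and
  entering a free sequent must lower the rank. Maximality: (L+) marks every leading box, also those
  inside the formula behind the diamond at hand, whereas the truth induction controls only the tests
  in the programs of that diamond. Fulfilment is therefore claimed for initial segments of the
  marked programs. A world may moreover carry a load other than the diamond to be fulfilled; the
  builder survives (L-) followed by (L+) at a basic sequent, and the world so obtained has the same
  formulas up to marks, so the first edge of its run also leaves the original world.\<close>

lemma boxes_simps [simp]:
  "boxes [] \<phi> = \<phi>"
  "boxes (\<alpha> # \<delta>) \<phi> = Box \<alpha> (boxes \<delta> \<phi>)"
  "boxes (\<delta> @ \<gamma>) \<phi> = boxes \<delta> (boxes \<gamma> \<phi>)"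
  by (simp_all add: boxes_def)

lemma ld_boxes_simps [simp]:
  "ld_boxes [] \<xi> = \<xi>"
  "ld_boxes (\<alpha> # \<delta>) \<xi> = LdBox \<alpha> (ld_boxes \<delta> \<xi>)"
  by (simp_all add: ld_boxes_def)

section \<open>Marked formulas as a list of programs over an unmarked core\<close>

primrec xi_progs :: "('p, 'a) xi \<Rightarrow> ('p, 'a) prog list" where
  "xi_progs (Unl \<phi>) = []"
| "xi_progs (LdBox \<alpha> \<xi>) = \<alpha> # xi_progs \<xi>"

primrec xi_core :: "('p, 'a) xi \<Rightarrow> ('p, 'a) fml" where
  "xi_core (Unl \<phi>) = \<phi>"
| "xi_core (LdBox \<alpha> \<xi>) = xi_core \<xi>"

lemma xi_progs_ld_boxes [simp]: "xi_progs (ld_boxes \<delta> \<xi>) = \<delta> @ xi_progs \<xi>"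
  by (induct \<delta>) auto

lemma xi_core_ld_boxes [simp]: "xi_core (ld_boxes \<delta> \<xi>) = xi_core \<xi>"
  by (induct \<delta>) auto

lemma ld_boxes_xi_progs_core [simp]: "ld_boxes (xi_progs \<xi>) (Unl (xi_core \<xi>)) = \<xi>"
  by (induct \<xi>) auto

fun unload :: "('p, 'a) efml \<Rightarrow> ('p, 'a) fml" where
  "unload (Fm \<phi>) = \<phi>"
| "unload (NegLd \<alpha> \<xi>) = Neg (Box \<alpha> (boxes (xi_progs \<xi>) (xi_core \<xi>)))"

lemma unload_neg_xi [simp]: "unload (neg_xi \<xi>) = Neg (boxes (xi_progs \<xi>) (xi_core \<xi>))"
  by (cases \<xi>) auto

fun is_ld :: "('p, 'a) efml \<Rightarrow> bool" where
  "is_ld (Fm \<phi>) = False"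
| "is_ld (NegLd \<alpha> \<xi>) = True"

lemma loaded_iff: "loaded \<Gamma> \<longleftrightarrow> (\<exists>\<chi>\<in>\<Gamma>. is_ld \<chi>)"
  unfolding loaded_def by (metis is_ld.elims(2) is_ld.simps(2))

lemma is_ld_neg_xi [simp]: "is_ld (neg_xi \<xi>) \<longleftrightarrow> xi_progs \<xi> \<noteq> []"
  by (cases \<xi>) auto

section \<open>Unfoldings\<close>

lemma finite_tests [simp]: "finite (tests \<alpha>)"
  by (induct \<alpha> rule: tests.induct) auto

lemma size_tests: "\<tau> \<in> tests \<alpha> \<Longrightarrow> size \<tau> < size \<alpha>"
  by (induct \<alpha> rule: tests.induct) auto

lemma finite_Hset [simp]: "finite (Hset \<alpha>)"
proof (induct \<alpha> rule: tests.induct)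
  case (4 \<alpha> \<beta>)
  have "Hset (Seq \<alpha> \<beta>) \<subseteq> (\<lambda>(X, \<delta>). (X, \<delta> @ [\<beta>])) ` Hset \<alpha> \<union>
      (\<lambda>(h, k). (fst h \<union> fst k, snd k)) ` (Hset \<alpha> \<times> Hset \<beta>)" (is "_ \<subseteq> ?R")
    by (force simp: image_iff)
  moreover have "finite ?R" using 4 by blast
  ultimately show ?case by (rule finite_subset)
next
  case (5 \<alpha>)
  have "Hset (Star \<alpha>) \<subseteq> insert ({}, []) ((\<lambda>(X, \<delta>). (X, \<delta> @ [Star \<alpha>])) ` Hset \<alpha>)"
    by (fastforce simp: image_iff)
  with 5 show ?case by (meson finite_insert finite_imageI finite_subset)
qed auto

lemma Hset_nonempty: "Hset \<alpha> \<noteq> {}"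
proof (induct \<alpha> rule: tests.induct)
  case (4 \<alpha> \<beta>)
  then obtain X \<delta> Y \<gamma> where "(X, \<delta>) \<in> Hset \<alpha>" "(Y, \<gamma>) \<in> Hset \<beta>" by fast
  then show ?case by (cases "\<delta> = []") auto
qed auto

lemma Hset_tests: "(X, \<delta>) \<in> Hset \<alpha> \<Longrightarrow> X \<subseteq> tests \<alpha>"
proof (induct \<alpha> arbitrary: X \<delta> rule: tests.induct)
  case (3 \<alpha> \<beta>)
  then show ?case by fastforce
next
  case (4 \<alpha> \<beta>)
  then show ?case by fastforce
qed auto

lemma Hset_tests_residual: "(X, \<delta>) \<in> Hset \<alpha> \<Longrightarrow> \<gamma> \<in> set \<delta> \<Longrightarrow> tests \<gamma> \<subseteq> tests \<alpha>"
proof (induct \<alpha> arbitrary: X \<delta> rule: tests.induct)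
  case (3 \<alpha> \<beta>)
  then show ?case by fastforce
next
  case (4 \<alpha> \<beta>)
  then show ?case by fastforce
next
  case (5 \<alpha>)
  then show ?case by fastforce
qed auto

text \<open>Residuals are only ever extended on the right, and a sequence moves on to its second
  program only when the first leaves nothing. So a nonempty unfolding is always basic.\<close>

lemma Hset_head: "(X, \<delta>) \<in> Hset \<alpha> \<Longrightarrow> \<delta> \<noteq> [] \<Longrightarrow> \<exists>a \<gamma>. \<delta> = Atom a # \<gamma>"
proof (induct \<alpha> arbitrary: X \<delta> rule: tests.induct)
  case (4 \<alpha> \<beta>)
  then show ?case by fastforce
next
  case (5 \<alpha>)
  then show ?case by fastforce
qed auto

text \<open>Membership of a test in \<open>l\<close> plays the part of executing it. The identity
  lets boxes and diamonds share every later lemma about \<open>Hset\<close>.\<close>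

lemma Pset_eq_Hset: "Pset l \<alpha> = {\<delta>. \<exists>X. X \<subseteq> l \<and> (X, \<delta>) \<in> Hset \<alpha>}"
proof (induct \<alpha> rule: tests.induct)
  case (4 \<alpha> \<beta>)
  have "\<delta> \<in> Pset l (Seq \<alpha> \<beta>) \<longleftrightarrow> (\<exists>X. X \<subseteq> l \<and> (X, \<delta>) \<in> Hset (Seq \<alpha> \<beta>))" for \<delta>
  proof
    assume "\<delta> \<in> Pset l (Seq \<alpha> \<beta>)"
    then consider \<gamma> X where "\<delta> = \<gamma> @ [\<beta>]" "X \<subseteq> l" "(X, \<gamma>) \<in> Hset \<alpha>" "\<gamma> \<noteq> []"
      | X Y where "X \<subseteq> l" "(X, []) \<in> Hset \<alpha>" "Y \<subseteq> l" "(Y, \<delta>) \<in> Hset \<beta>"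
      using 4 by auto
    then show "\<exists>X. X \<subseteq> l \<and> (X, \<delta>) \<in> Hset (Seq \<alpha> \<beta>)"
    proof cases
      case 1
      then show ?thesis by auto
    next
      case 2
      then have "X \<union> Y \<subseteq> l \<and> (X \<union> Y, \<delta>) \<in> Hset (Seq \<alpha> \<beta>)" by auto
      then show ?thesis by blast
    qed
  next
    assume "\<exists>X. X \<subseteq> l \<and> (X, \<delta>) \<in> Hset (Seq \<alpha> \<beta>)"
    then show "\<delta> \<in> Pset l (Seq \<alpha> \<beta>)" using 4 by auto
  qed
  then show ?case by blast
next
  case (5 \<alpha>)
  then show ?case by auto
qed auto

lemma finite_unfold_box: "finite (unfold_box \<alpha> \<phi>)"
proof -
  have "unfold_box \<alpha> \<phi> =
      (\<lambda>l. {Neg \<tau> | \<tau>. \<tau> \<in> tests \<alpha> - l} \<union> {boxes as \<phi> | as. as \<in> Pset l \<alpha>}) ` Pow (tests \<alpha>)"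
    unfolding unfold_box_def by auto
  then show ?thesis by simp
qed

lemma finite_unfold_dia: "finite (unfold_dia \<alpha> \<phi>)"
proof -
  have "unfold_dia \<alpha> \<phi> = (\<lambda>(X, \<delta>). X \<union> {Neg (boxes \<delta> \<phi>)}) ` Hset \<alpha>"
    unfolding unfold_dia_def by force
  then show ?thesis by simp
qed

lemma finite_unfold_ld_dia: "finite (unfold_ld_dia \<alpha> \<xi>)"
proof -
  have "unfold_ld_dia \<alpha> \<xi> = (\<lambda>(X, \<delta>). Fm ` X \<union> {neg_xi (ld_boxes \<delta> \<xi>)}) ` Hset \<alpha>"
    unfolding unfold_ld_dia_def by force
  then show ?thesis by simp
qed

section \<open>Runs of program lists\<close>

text \<open>
  The number counts the rules used. Unfolding a program along \<open>Hset\<close> is the execution of this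
  machine up to the next atomic program, so the count drops both at unfoldings and at modal steps.
\<close>

inductive run :: "('w, 'p, 'a) kripke \<Rightarrow> ('p, 'a) prog list \<Rightarrow> nat \<Rightarrow> 'w \<Rightarrow> 'w \<Rightarrow> bool" for M where
  nil: "run M [] 0 w w"
| atom: "(w, v) \<in> acc M a \<Longrightarrow> run M \<delta> n v u \<Longrightarrow> run M (Atom a # \<delta>) (Suc n) w u"
| test: "holds M \<tau> w \<Longrightarrow> run M \<delta> n w u \<Longrightarrow> run M (Test \<tau> # \<delta>) (Suc n) w u"
| choice1: "run M (\<alpha> # \<delta>) n w u \<Longrightarrow> run M (Choice \<alpha> \<beta> # \<delta>) (Suc n) w u"
| choice2: "run M (\<beta> # \<delta>) n w u \<Longrightarrow> run M (Choice \<alpha> \<beta> # \<delta>) (Suc n) w u"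
| seq: "run M (\<alpha> # \<beta> # \<delta>) n w u \<Longrightarrow> run M (Seq \<alpha> \<beta> # \<delta>) (Suc n) w u"
| star_stop: "run M \<delta> n w u \<Longrightarrow> run M (Star \<alpha> # \<delta>) (Suc n) w u"
| star_step: "run M (\<alpha> # Star \<alpha> # \<delta>) n w u \<Longrightarrow> run M (Star \<alpha> # \<delta>) (Suc n) w u"

inductive_cases run_NilE [elim!]: "run M [] n w u"
inductive_cases run_AtomE: "run M (Atom a # \<delta>) n w u"
inductive_cases run_TestE: "run M (Test \<tau> # \<delta>) n w u"
inductive_cases run_ChoiceE: "run M (Choice \<alpha> \<beta> # \<delta>) n w u"
inductive_cases run_SeqE: "run M (Seq \<alpha> \<beta> # \<delta>) n w u"
inductive_cases run_StarE: "run M (Star \<alpha> # \<delta>) n w u"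

lemma rel_worlds:
  "kripke_model M \<Longrightarrow> (w, v) \<in> rel M \<alpha> \<Longrightarrow> w \<in> worlds M \<and> v \<in> worlds M"
  by (induct \<alpha> arbitrary: w v rule: tests.induct) (auto simp: kripke_model_def)

text \<open>The decreasing count serves the star: after one iteration the same star is at the head
  again, and the induction there is on the count, not on the program.\<close>

lemma run_rel:
  assumes "kripke_model M"
  shows "w \<in> worlds M \<Longrightarrow> run M (\<alpha> # \<delta>) n w u \<Longrightarrow>
    \<exists>v m. m < n \<and> (w, v) \<in> rel M \<alpha> \<and> run M \<delta> m v u"
proof (induct \<alpha> arbitrary: \<delta> n w rule: tests.induct)
  case (1 a)
  then show ?case by (fastforce elim: run_AtomE)
next
  case (2 \<tau>)
  then show ?case by (fastforce elim: run_TestE)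
next
  case (3 \<alpha> \<beta>)
  from 3(4) obtain k where "n = Suc k" "run M (\<alpha> # \<delta>) k w u \<or> run M (\<beta> # \<delta>) k w u"
    by (auto elim: run_ChoiceE)
  then obtain v m where "m < k" "(w, v) \<in> rel M \<alpha> \<union> rel M \<beta>" "run M \<delta> m v u"
    using 3(1)[OF 3(3), of \<delta> k] 3(2)[OF 3(3), of \<delta> k] by blast
  then show ?case using \<open>n = Suc k\<close> by (intro exI[of _ v] exI[of _ m]) simp
next
  case (4 \<alpha> \<beta>)
  from 4(4) obtain k where k: "n = Suc k" "run M (\<alpha> # \<beta> # \<delta>) k w u" by (auto elim: run_SeqE)
  with 4(1)[of w "\<beta> # \<delta>" k] 4(3) obtain v m
    where v: "m < k" "(w, v) \<in> rel M \<alpha>" "run M (\<beta> # \<delta>) m v u" by auto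
  then have "v \<in> worlds M" using rel_worlds[OF assms] by blast
  with 4(2) v obtain v' m' where "m' < m" "(v, v') \<in> rel M \<beta>" "run M \<delta> m' v' u" by blast
  with v k show ?case by (intro exI[of _ v'] exI[of _ m']) auto
next
  case (5 \<alpha>)
  from 5(2,3) show ?case
  proof (induct n arbitrary: w rule: less_induct)
    case (less n)
    from less(3) consider k where "n = Suc k" "run M \<delta> k w u"
      | k where "n = Suc k" "run M (\<alpha> # Star \<alpha> # \<delta>) k w u" by (auto elim: run_StarE)
    then show ?case
    proof cases
      case (1 k)
      then show ?thesis using less(2) by (intro exI[of _ w] exI[of _ k]) auto
    next
      case (2 k)
      with 5(1)[of w "Star \<alpha> # \<delta>" k] less(2) obtain v m
        where v: "m < k" "(w, v) \<in> rel M \<alpha>" "run M (Star \<alpha> # \<delta>) m v u" by auto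
      then have vw: "v \<in> worlds M" using rel_worlds[OF assms] by blast
      with less(1)[of m v] v 2 obtain v' m'
        where "m' < m" "(v, v') \<in> rel M (Star \<alpha>)" "run M \<delta> m' v' u" by auto
      with v 2 less(2) show ?thesis
        by (intro exI[of _ v'] exI[of _ m']) (auto intro: converse_rtrancl_into_rtrancl)
    qed
  qed
qed

lemma rel_run: "(w, v) \<in> rel M \<alpha> \<Longrightarrow> run M \<delta> m v u \<Longrightarrow> \<exists>n. run M (\<alpha> # \<delta>) n w u"
proof (induct \<alpha> arbitrary: \<delta> m w v rule: tests.induct)
  case (4 \<alpha> \<beta>)
  then show ?case by (auto, metis run.seq)
next
  case (5 \<alpha>)
  from 5(2) have "(w, v) \<in> (rel M \<alpha>)\<^sup>*" by simp
  then show ?case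
  proof (induct rule: converse_rtrancl_induct)
    case base
    then show ?case using run.star_stop[OF 5(3)] by blast
  next
    case (step y z)
    then show ?case using 5(1) run.star_step by metis
  qed
qed (auto intro: run.intros, (metis run.choice1 run.choice2)+)

lemma holds_boxes:
  assumes "kripke_model M"
  shows "w \<in> worlds M \<Longrightarrow> holds M (boxes \<delta> \<phi>) w \<longleftrightarrow> (\<forall>n u. run M \<delta> n w u \<longrightarrow> holds M \<phi> u)"
proof (induct \<delta> arbitrary: w)
  case Nil
  then show ?case by (auto intro: run.nil)
next
  case (Cons \<alpha> \<delta>)
  have "(\<exists>v n. (w, v) \<in> rel M \<alpha> \<and> run M \<delta> n v u) \<longleftrightarrow> (\<exists>n. run M (\<alpha> # \<delta>) n w u)" for u
    using run_rel[OF assms Cons(2)] rel_run by metis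
  then show ?case using Cons rel_worlds[OF assms] by (simp) metis
qed

text \<open>An atomic program is its own unfolding, so the count stays; any other head costs the
  machine at least one rule before an atomic program can surface.\<close>

lemma run_unfold:
  "run M (\<alpha> # \<delta>) n w u \<Longrightarrow> \<exists>X \<gamma> m. (X, \<gamma>) \<in> Hset \<alpha> \<and> (\<forall>\<tau>\<in>X. holds M \<tau> w) \<and>
     run M (\<gamma> @ \<delta>) m w u \<and> m \<le> n \<and> (\<not> atomic \<alpha> \<longrightarrow> m < n)"
proof (induct \<alpha> arbitrary: \<delta> n rule: tests.induct)
  case (1 a)
  then show ?case by (intro exI[of _ "{}"] exI[of _ "[Atom a]"] exI[of _ n]) (simp add: atomic_def)
next
  case (2 \<tau>)
  then show ?case by (auto elim!: run_TestE)
next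
  case (3 \<alpha> \<beta>)
  from 3(3) obtain k where "n = Suc k" "run M (\<alpha> # \<delta>) k w u \<or> run M (\<beta> # \<delta>) k w u"
    by (auto elim: run_ChoiceE)
  then obtain X \<gamma> m where "(X, \<gamma>) \<in> Hset \<alpha> \<union> Hset \<beta>" "\<forall>\<tau>\<in>X. holds M \<tau> w"
    "run M (\<gamma> @ \<delta>) m w u" "m \<le> k"
    using 3(1)[of \<delta> k] 3(2)[of \<delta> k] by blast
  then show ?case using \<open>n = Suc k\<close> by (intro exI[of _ X] exI[of _ \<gamma>] exI[of _ m]) simp
next
  case (4 \<alpha> \<beta>)
  from 4(3) obtain k where k: "n = Suc k" "run M (\<alpha> # \<beta> # \<delta>) k w u" by (auto elim: run_SeqE)
  from 4(1)[OF k(2)] obtain X \<gamma> m where X: "(X, \<gamma>) \<in> Hset \<alpha>" "\<forall>\<tau>\<in>X. holds M \<tau> w"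
    "run M (\<gamma> @ \<beta> # \<delta>) m w u" "m \<le> k" by blast
  show ?case
  proof (cases "\<gamma> = []")
    case False
    then show ?thesis using X k by (intro exI[of _ X] exI[of _ "\<gamma> @ [\<beta>]"] exI[of _ m]) auto
  next
    case True
    with X 4(2)[of \<delta> m] obtain Y \<gamma>' m' where "(Y, \<gamma>') \<in> Hset \<beta>" "\<forall>\<tau>\<in>Y. holds M \<tau> w"
      "run M (\<gamma>' @ \<delta>) m' w u" "m' \<le> m" by auto
    then show ?thesis using X k True
      by (intro exI[of _ "X \<union> Y"] exI[of _ \<gamma>'] exI[of _ m']) auto
  qed
next
  case (5 \<alpha>)
  from 5(2) show ?case
  proof (induct n rule: less_induct)
    case (less n)
    from less(2) consider k where "n = Suc k" "run M \<delta> k w u"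
      | k where "n = Suc k" "run M (\<alpha> # Star \<alpha> # \<delta>) k w u" by (auto elim: run_StarE)
    then show ?case
    proof cases
      case (1 k)
      then show ?thesis by (intro exI[of _ "{}"] exI[of _ "[]"] exI[of _ k]) auto
    next
      case (2 k)
      from 5(1)[OF 2(2)] obtain X \<gamma> m where X: "(X, \<gamma>) \<in> Hset \<alpha>" "\<forall>\<tau>\<in>X. holds M \<tau> w"
        "run M (\<gamma> @ Star \<alpha> # \<delta>) m w u" "m \<le> k" by blast
      show ?thesis
      proof (cases "\<gamma> = []")
        case False
        then show ?thesis using X 2 by (intro exI[of _ X] exI[of _ "\<gamma> @ [Star \<alpha>]"] exI[of _ m]) auto
      next
        \<comment> \<open>This iteration executed tests only, so it left the world unchanged and can
          be skipped. That matches \<open>Hset (Star \<alpha>)\<close>, which drops iterations with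
          an empty residual.\<close>
        case True
        then have "run M (Star \<alpha> # \<delta>) m w u" "m < n" using X(3,4) 2(1) by simp_all
        then obtain Y \<gamma>' m' where Y: "(Y, \<gamma>') \<in> Hset (Star \<alpha>)" "\<forall>\<tau>\<in>Y. holds M \<tau> w"
          "run M (\<gamma>' @ \<delta>) m' w u" and "m' \<le> m" using less(1) by blast
        then have "m' < n" using \<open>m < n\<close> by simp
        with Y show ?thesis using less_imp_le by blast
      qed
    qed
  qed
qed

lemma run_fold:
  "(X, \<gamma>) \<in> Hset \<alpha> \<Longrightarrow> \<forall>\<tau>\<in>X. holds M \<tau> w \<Longrightarrow> run M (\<gamma> @ \<delta>) m w u \<Longrightarrow>
     \<exists>n. run M (\<alpha> # \<delta>) n w u"
proof (induct \<alpha> arbitrary: X \<gamma> \<delta> m rule: tests.induct)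
  case (1 a)
  then have "run M (Atom a # \<delta>) m w u" by simp
  then show ?case by blast
next
  case (2 \<tau>)
  then have "run M (Test \<tau> # \<delta>) (Suc m) w u" by (simp add: run.test)
  then show ?case by blast
next
  case (3 \<alpha> \<beta>)
  from 3(3) consider "(X, \<gamma>) \<in> Hset \<alpha>" | "(X, \<gamma>) \<in> Hset \<beta>" by auto
  then show ?case
  proof cases
    case 1
    from 3(1)[OF 1 3(4,5)] show ?thesis by (auto dest: run.choice1)
  next
    case 2
    from 3(2)[OF 2 3(4,5)] show ?thesis by (auto dest: run.choice2)
  qed
next
  case (4 \<alpha> \<beta>)
  from 4(3) consider \<gamma>' where "\<gamma> = \<gamma>' @ [\<beta>]" "(X, \<gamma>') \<in> Hset \<alpha>"
    | Y Z where "X = Y \<union> Z" "(Y, []) \<in> Hset \<alpha>" "(Z, \<gamma>) \<in> Hset \<beta>" by auto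
  then have "\<exists>n. run M (\<alpha> # \<beta> # \<delta>) n w u"
  proof cases
    case 1
    then show ?thesis using 4(1)[of X \<gamma>' "\<beta> # \<delta>" m] 4(4,5) by simp
  next
    case 2
    with 4(2)[of Z \<gamma> \<delta> m] 4(4,5) obtain k where "run M (\<beta> # \<delta>) k w u" by auto
    then show ?thesis using 4(1)[of Y "[]" "\<beta> # \<delta>" k] 2 4(4) by simp
  qed
  then show ?case by (auto dest: run.seq)
next
  case (5 \<alpha>)
  show ?case
  proof (cases "\<gamma> = []")
    case True
    then have "run M (Star \<alpha> # \<delta>) (Suc m) w u" using 5(4) by (simp add: run.star_stop)
    then show ?thesis by blast
  next
    case False
    with 5(2) obtain \<gamma>' where "\<gamma> = \<gamma>' @ [Star \<alpha>]" "(X, \<gamma>') \<in> Hset \<alpha>" by auto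
    then have "\<exists>n. run M (\<alpha> # Star \<alpha> # \<delta>) n w u" using 5(1)[of X \<gamma>' "Star \<alpha> # \<delta>" m] 5(3,4) by simp
    then show ?thesis by (auto dest: run.star_step)
  qed
qed

section \<open>Fischer-Ladner closure\<close>

text \<open>Records what one rule can make of a formula once marks are erased: the unfoldings with
  their tests and, in the last two clauses, the modal rule. Closure under subformulas is not asked
  for.\<close>

inductive fl :: "('p, 'a) fml \<Rightarrow> ('p, 'a) fml \<Rightarrow> bool" where
  "fl (Neg (Neg \<phi>)) \<phi>"
| "fl (And \<phi> \<psi>) \<phi>"
| "fl (And \<phi> \<psi>) \<psi>"
| "fl (Neg (And \<phi> \<psi>)) (Neg \<phi>)"
| "fl (Neg (And \<phi> \<psi>)) (Neg \<psi>)"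
| "\<tau> \<in> tests \<alpha> \<Longrightarrow> fl (Box \<alpha> \<phi>) (Neg \<tau>)"
| "(X, \<delta>) \<in> Hset \<alpha> \<Longrightarrow> fl (Box \<alpha> \<phi>) (boxes \<delta> \<phi>)"
| "\<tau> \<in> tests \<alpha> \<Longrightarrow> fl (Neg (Box \<alpha> \<phi>)) \<tau>"
| "(X, \<delta>) \<in> Hset \<alpha> \<Longrightarrow> fl (Neg (Box \<alpha> \<phi>)) (Neg (boxes \<delta> \<phi>))"
| "fl (Box (Atom a) \<phi>) \<phi>"
| "fl (Neg (Box (Atom a) \<phi>)) (Neg \<phi>)"

text \<open>An upper bound for the lists into which a program develops when heads are unfolded and
  atomic heads are executed, as with partial derivatives of regular expressions.\<close>

fun residuals :: "('p, 'a) prog \<Rightarrow> ('p, 'a) prog list set" where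
  "residuals (Atom a) = {[Atom a], []}"
| "residuals (Test \<tau>) = {[Test \<tau>], []}"
| "residuals (Choice \<alpha> \<beta>) = insert [Choice \<alpha> \<beta>] (residuals \<alpha> \<union> residuals \<beta>)"
| "residuals (Seq \<alpha> \<beta>) = insert [Seq \<alpha> \<beta>] ((\<lambda>\<delta>. \<delta> @ [\<beta>]) ` residuals \<alpha> \<union> residuals \<beta>)"
| "residuals (Star \<alpha>) = {[], [Star \<alpha>]} \<union> (\<lambda>\<delta>. \<delta> @ [Star \<alpha>]) ` residuals \<alpha>"

lemma finite_residuals [simp]: "finite (residuals \<alpha>)"
  by (induct \<alpha> rule: tests.induct) auto

lemma singleton_residuals [simp]: "[\<alpha>] \<in> residuals \<alpha>"
  by (cases \<alpha>) auto

lemma Nil_residuals [simp]: "[] \<in> residuals \<alpha>"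
  by (induct \<alpha> rule: tests.induct) auto

lemma residuals_tests: "\<delta> \<in> residuals \<alpha> \<Longrightarrow> \<gamma> \<in> set \<delta> \<Longrightarrow> tests \<gamma> \<subseteq> tests \<alpha>"
  by (induct \<alpha> arbitrary: \<delta> rule: tests.induct) fastforce+

lemma Hset_residuals: "(X, \<delta>) \<in> Hset \<alpha> \<Longrightarrow> \<delta> \<in> residuals \<alpha>"
  by (induct \<alpha> arbitrary: X \<delta> rule: tests.induct) fastforce+

text \<open>A list from a sequence or a star is a residual of the inner program followed by one
  fixed program. Either the head lies in the inner part and the induction hypothesis applies, or the
  inner part is used up and the fixed program itself is unfolded.\<close>

lemma residuals_step:
  "\<gamma> # \<delta> \<in> residuals \<alpha> \<Longrightarrow> (X, \<epsilon>) \<in> Hset \<gamma> \<Longrightarrow> \<epsilon> @ \<delta> \<in> residuals \<alpha>"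
  and residuals_atom: "Atom a # \<delta> \<in> residuals \<alpha> \<Longrightarrow> \<delta> \<in> residuals \<alpha>"
proof -
  show "\<gamma> # \<delta> \<in> residuals \<alpha> \<Longrightarrow> (X, \<epsilon>) \<in> Hset \<gamma> \<Longrightarrow> \<epsilon> @ \<delta> \<in> residuals \<alpha>"
  proof (induct \<alpha> arbitrary: \<gamma> \<delta> X \<epsilon> rule: tests.induct)
    case (3 \<alpha> \<beta>)
    then show ?case using Hset_residuals[of X \<epsilon> "Choice \<alpha> \<beta>"] by auto
  next
    case (4 \<alpha> \<beta>)
    from 4(3) consider "\<gamma> = Seq \<alpha> \<beta>" "\<delta> = []" | "\<gamma> # \<delta> \<in> residuals \<beta>"
      | \<delta>' where "\<delta> = \<delta>' @ [\<beta>]" "\<gamma> # \<delta>' \<in> residuals \<alpha>" | "\<gamma> = \<beta>" "\<delta> = []"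
      by (auto simp: Cons_eq_append_conv)
    then show ?case
    proof cases
      case 1
      then show ?thesis using Hset_residuals 4(4) by fastforce
    next
      case 2
      then show ?thesis using 4(2)[OF _ 4(4)] by simp
    next
      case 3
      then have "\<epsilon> @ \<delta>' \<in> residuals \<alpha>" using 4(1) 4(4) by blast
      then show ?thesis using 3 by (auto simp: image_iff simp flip: append_assoc)
    next
      case 4
      then show ?thesis using Hset_residuals \<open>(X, \<epsilon>) \<in> Hset \<gamma>\<close> by fastforce
    qed
  next
    case (5 \<alpha>)
    from 5(2) consider "\<gamma> = Star \<alpha>" "\<delta> = []" | \<delta>' where "\<delta> = \<delta>' @ [Star \<alpha>]" "\<gamma> # \<delta>' \<in> residuals \<alpha>"
      by (auto simp: Cons_eq_append_conv)
    then show ?case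
    proof cases
      case 1
      then show ?thesis using Hset_residuals 5(3) by fastforce
    next
      case 2
      then have "\<epsilon> @ \<delta>' \<in> residuals \<alpha>" using 5(1) 5(3) by blast
      then show ?thesis using 2 by (auto simp: image_iff simp flip: append_assoc)
    qed
  qed auto
  show "Atom a # \<delta> \<in> residuals \<alpha> \<Longrightarrow> \<delta> \<in> residuals \<alpha>"
  proof (induct \<alpha> arbitrary: \<delta> rule: tests.induct)
    case (4 \<alpha> \<beta>)
    then show ?case by (auto simp: Cons_eq_append_conv)
  next
    case (5 \<alpha>)
    then show ?case by (auto simp: Cons_eq_append_conv)
  qed auto
qed

text \<open>A bound for the Fischer-Ladner closure given by recursion on syntax, so that finiteness
  is immediate and closure under \<open>fl\<close> is what remains to be shown. Both signs occur
  since unfolding a box produces negated tests.\<close>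

primrec cl :: "('p, 'a) fml \<Rightarrow> ('p, 'a) fml set" and cl_tests :: "('p, 'a) prog \<Rightarrow> ('p, 'a) fml set" where
  "cl Bot = {Bot, Neg Bot}"
| "cl (Prop p) = {Prop p, Neg (Prop p)}"
| "cl (Neg \<phi>) = {Neg \<phi>, Neg (Neg \<phi>)} \<union> cl \<phi>"
| "cl (And \<phi> \<psi>) = {And \<phi> \<psi>, Neg (And \<phi> \<psi>)} \<union> cl \<phi> \<union> cl \<psi>"
| "cl (Box \<alpha> \<phi>) = (\<lambda>\<delta>. boxes \<delta> \<phi>) ` residuals \<alpha> \<union> (\<lambda>\<delta>. Neg (boxes \<delta> \<phi>)) ` residuals \<alpha> \<union>
     cl \<phi> \<union> cl_tests \<alpha>"
| "cl_tests (Atom a) = {}"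
| "cl_tests (Test \<tau>) = cl \<tau>"
| "cl_tests (Choice \<alpha> \<beta>) = cl_tests \<alpha> \<union> cl_tests \<beta>"
| "cl_tests (Seq \<alpha> \<beta>) = cl_tests \<alpha> \<union> cl_tests \<beta>"
| "cl_tests (Star \<alpha>) = cl_tests \<alpha>"

lemma
  fixes \<phi> :: "('p, 'a) fml" and \<alpha> :: "('p, 'a) prog"
  shows finite_cl: "finite (cl \<phi>)" and finite_cl_tests: "finite (cl_tests \<alpha>)"
  by (induct \<phi> and \<alpha> rule: fml.induct prog.induct) auto

lemma boxes_residuals_cl:
  assumes "\<delta> \<in> residuals \<alpha>"
  shows "boxes \<delta> \<phi> \<in> cl (Box \<alpha> \<phi>)" "Neg (boxes \<delta> \<phi>) \<in> cl (Box \<alpha> \<phi>)"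
  using assms by auto

lemma cl_self: "\<phi> \<in> cl \<phi> \<and> Neg \<phi> \<in> cl \<phi>"
proof (cases \<phi>)
  case (Box \<alpha> \<psi>)
  then show ?thesis using boxes_residuals_cl[of "[\<alpha>]" \<alpha> \<psi>] by simp
qed simp_all

lemma cl_tests_tests: "\<tau> \<in> tests \<alpha> \<Longrightarrow> \<tau> \<in> cl_tests \<alpha> \<and> Neg \<tau> \<in> cl_tests \<alpha>"
  by (induct \<alpha> rule: tests.induct) (auto simp: cl_self)

lemma
  fixes \<phi> :: "('p, 'a) fml" and \<alpha> :: "('p, 'a) prog"
  shows cl_closed: "\<psi> \<in> cl \<phi> \<Longrightarrow> fl \<psi> \<chi> \<Longrightarrow> \<chi> \<in> cl \<phi>"
  and cl_tests_closed: "\<psi> \<in> cl_tests \<alpha> \<Longrightarrow> fl \<psi> \<chi> \<Longrightarrow> \<chi> \<in> cl_tests \<alpha>"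
proof (induct \<phi> and \<alpha> arbitrary: \<psi> and \<psi> rule: fml.induct prog.induct)
  case Bot
  then show ?case by (auto elim: fl.cases)
next
  case (Prop p)
  then show ?case by (auto elim: fl.cases)
next
  case (Neg \<phi>)
  from Neg(2) consider "\<psi> = Neg \<phi>" | "\<psi> = Neg (Neg \<phi>)" | "\<psi> \<in> cl \<phi>" by auto
  then show ?case
  proof cases
    case 1
    then show ?thesis using Neg(1)[of \<psi>] Neg(3) cl_self[of \<phi>] by simp
  next
    case 2
    with Neg(3) have "\<chi> = \<phi>" by (auto elim: fl.cases)
    then show ?thesis using cl_self[of \<phi>] by simp
  next
    case 3
    then show ?thesis using Neg(1)[of \<psi>] Neg(3) by simp
  qed
next
  case (And \<phi>1 \<phi>2)
  from And(3) consider "\<psi> = And \<phi>1 \<phi>2" | "\<psi> = Neg (And \<phi>1 \<phi>2)"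
    | "\<psi> \<in> cl \<phi>1" | "\<psi> \<in> cl \<phi>2" by auto
  then show ?case
  proof cases
    case 1
    with And(4) have "\<chi> = \<phi>1 \<or> \<chi> = \<phi>2" by (auto elim: fl.cases)
    then show ?thesis using cl_self[of \<phi>1] cl_self[of \<phi>2] by auto
  next
    case 2
    with And(4) have "\<chi> = Neg \<phi>1 \<or> \<chi> = Neg \<phi>2" by (auto elim: fl.cases)
    then show ?thesis using cl_self[of \<phi>1] cl_self[of \<phi>2] by auto
  next
    case 3
    then show ?thesis using And(1)[of \<psi>] And(4) by simp
  next
    case 4
    then show ?thesis using And(2)[of \<psi>] And(4) by simp
  qed
next
  case (Box \<alpha> \<phi>)
  \<comment> \<open>The empty list yields \<open>\<phi>\<close> or its negation, both already in
    \<open>cl \<phi>\<close>; every other list has a head program to which an \<open>fl\<close> step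
    applies.\<close>
  consider (pos) \<delta> where "\<psi> = boxes \<delta> \<phi>" "\<delta> \<in> residuals \<alpha>" "\<delta> \<noteq> []"
    | (neg) \<delta> where "\<psi> = Neg (boxes \<delta> \<phi>)" "\<delta> \<in> residuals \<alpha>" "\<delta> \<noteq> []"
    | (rest) "\<psi> \<in> cl \<phi> \<union> cl_tests \<alpha>"
  proof -
    from Box(3) consider "\<psi> \<in> cl \<phi> \<union> cl_tests \<alpha>" | \<delta> where "\<psi> = boxes \<delta> \<phi>" "\<delta> \<in> residuals \<alpha>"
      | \<delta> where "\<psi> = Neg (boxes \<delta> \<phi>)" "\<delta> \<in> residuals \<alpha>" by auto
    then show thesis
    proof cases
      case 1
      then show thesis by (rule rest)
    next
      case (2 \<delta>)
      show thesis
      proof (cases "\<delta> = []")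
        case True
        then have "\<psi> \<in> cl \<phi> \<union> cl_tests \<alpha>" using 2(1) cl_self[of \<phi>] by simp
        then show thesis by (rule rest)
      next
        case False
        show thesis by (rule pos[OF 2 False])
      qed
    next
      case (3 \<delta>)
      show thesis
      proof (cases "\<delta> = []")
        case True
        then have "\<psi> \<in> cl \<phi> \<union> cl_tests \<alpha>" using 3(1) cl_self[of \<phi>] by simp
        then show thesis by (rule rest)
      next
        case False
        show thesis by (rule neg[OF 3 False])
      qed
    qed
  qed
  then show ?case
  proof cases
    case pos
    then obtain \<gamma> \<delta>' where \<delta>: "\<delta> = \<gamma> # \<delta>'" by (cases \<delta>) auto
    with pos Box(4) have "fl (Box \<gamma> (boxes \<delta>' \<phi>)) \<chi>" by simp
    then consider \<tau> where "\<chi> = Neg \<tau>" "\<tau> \<in> tests \<gamma>"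
      | X \<epsilon> where "\<chi> = boxes (\<epsilon> @ \<delta>') \<phi>" "(X, \<epsilon>) \<in> Hset \<gamma>"
      | a where "\<chi> = boxes \<delta>' \<phi>" "\<gamma> = Atom a"
      by cases auto
    then show ?thesis
    proof cases
      case 1
      then have "\<tau> \<in> tests \<alpha>" using residuals_tests[OF pos(2), of \<gamma>] \<delta> by auto
      then show ?thesis using cl_tests_tests 1 by auto
    next
      case 2
      then have "\<epsilon> @ \<delta>' \<in> residuals \<alpha>" using residuals_step pos(2) \<delta> by simp
      then show ?thesis by (simp only: 2(1) boxes_residuals_cl)
    next
      case 3
      then have "\<delta>' \<in> residuals \<alpha>" using residuals_atom pos(2) \<delta> by simp
      then show ?thesis by (simp only: 3(1) boxes_residuals_cl)
    qed
  next
    case neg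
    then obtain \<gamma> \<delta>' where \<delta>: "\<delta> = \<gamma> # \<delta>'" by (cases \<delta>) auto
    with neg Box(4) have "fl (Neg (Box \<gamma> (boxes \<delta>' \<phi>))) \<chi>" by simp
    then consider "\<chi> \<in> tests \<gamma>"
      | X \<epsilon> where "\<chi> = Neg (boxes (\<epsilon> @ \<delta>') \<phi>)" "(X, \<epsilon>) \<in> Hset \<gamma>"
      | a where "\<chi> = Neg (boxes \<delta>' \<phi>)" "\<gamma> = Atom a"
      by cases auto
    then show ?thesis
    proof cases
      case 1
      then have "\<chi> \<in> tests \<alpha>" using residuals_tests[OF neg(2), of \<gamma>] \<delta> by auto
      then show ?thesis using cl_tests_tests by auto
    next
      case 2
      then have "\<epsilon> @ \<delta>' \<in> residuals \<alpha>" using residuals_step neg(2) \<delta> by simp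
      then show ?thesis by (simp only: 2(1) boxes_residuals_cl)
    next
      case 3
      then have "\<delta>' \<in> residuals \<alpha>" using residuals_atom neg(2) \<delta> by simp
      then show ?thesis by (simp only: 3(1) boxes_residuals_cl)
    qed
  next
    case rest
    then show ?thesis using Box(1)[of \<psi>] Box(2)[of \<psi>] Box(4) by auto
  qed
next
  case (Choice \<alpha> \<beta>)
  then show ?case by (metis Un_iff cl_tests.simps(3))
next
  case (Seq \<alpha> \<beta>)
  then show ?case by (metis Un_iff cl_tests.simps(4))
qed simp_all

text \<open>The marks on a formula form an initial segment of its leading boxes, so there are
  finitely many ways to mark it. A finite closure thus bounds the sequents with marks as
  well.\<close>

lemma finite_unload_vimage:
  fixes C :: "('p, 'a) fml set"
  assumes "finite C"
  shows "finite {\<chi>. unload \<chi> \<in> C}"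
proof -
  have xi: "finite {\<xi>. boxes (xi_progs \<xi>) (xi_core \<xi>) = \<phi>}" for \<phi> :: "('p, 'a) fml"
  proof (induct \<phi> rule: measure_induct_rule[of size])
    case (less \<phi>)
    let ?F = "\<lambda>\<phi>. {\<xi>. boxes (xi_progs \<xi>) (xi_core \<xi>) = \<phi>}"
    have "?F \<phi> \<subseteq> insert (Unl \<phi>) (case \<phi> of Box \<alpha> \<psi> \<Rightarrow> LdBox \<alpha> ` ?F \<psi> | _ \<Rightarrow> {})" (is "_ \<subseteq> ?R")
    proof
      fix \<xi> assume "\<xi> \<in> ?F \<phi>"
      then show "\<xi> \<in> ?R" by (cases \<xi>) auto
    qed
    moreover have "finite ?R" using less by (auto split: fml.split)
    ultimately show ?case by (rule finite_subset)
  qed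
  have "finite {\<chi>. unload \<chi> = \<phi>}" for \<phi> :: "('p, 'a) fml"
  proof -
    have "{\<chi>. unload \<chi> = \<phi>} \<subseteq> insert (Fm \<phi>) (case \<phi> of
        Neg (Box \<alpha> \<psi>) \<Rightarrow> NegLd \<alpha> ` {\<xi>. boxes (xi_progs \<xi>) (xi_core \<xi>) = \<psi>} | _ \<Rightarrow> {})"
      (is "_ \<subseteq> ?R")
    proof
      fix \<chi> assume "\<chi> \<in> {\<chi>. unload \<chi> = \<phi>}"
      then show "\<chi> \<in> ?R" by (cases \<chi>) auto
    qed
    moreover have "finite ?R" using xi by (auto split: fml.split)
    ultimately show ?thesis by (rule finite_subset)
  qed
  then have "finite (\<Union>\<phi>\<in>C. {\<chi>. unload \<chi> = \<phi>})" using \<open>finite C\<close> by simp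
  moreover have "{\<chi>. unload \<chi> \<in> C} = (\<Union>\<phi>\<in>C. {\<chi>. unload \<chi> = \<phi>})" by auto
  ultimately show ?thesis by simp
qed

section \<open>Rules\<close>

lemma other_neq [simp]: "other i \<noteq> i" "i \<noteq> other i"
  by (cases i; simp)+

lemma component_mk_sequent [simp]:
  "component j (mk_sequent i \<Delta> \<Gamma>) = (if j = i then \<Delta> else \<Gamma>)"
  by (cases i; cases j; simp)

lemma mk_sequent_component: "mk_sequent i (component i S) (component (other i) S) = S"
  by (cases i) simp_all

abbreviation members :: "('p, 'a) sequent \<Rightarrow> ('p, 'a) efml set" where
  "members S \<equiv> fst S \<union> snd S"

lemma members_mk_sequent [simp]: "members (mk_sequent i \<Delta> \<Gamma>) = \<Delta> \<union> \<Gamma>"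
  by (cases i) auto

lemma members_eq: "members S = component i S \<union> component (other i) S"
  by (cases i) auto

lemma members_component: "\<chi> \<in> members S \<Longrightarrow> \<exists>i. \<chi> \<in> component i S"
  by (metis Un_iff component.simps)

lemma loaded_Un [simp]: "loaded (\<Gamma> \<union> \<Delta>) \<longleftrightarrow> loaded \<Gamma> \<or> loaded \<Delta>"
  by (auto simp: loaded_iff)

lemma loaded_insert [simp]: "loaded (insert \<chi> \<Delta>) \<longleftrightarrow> is_ld \<chi> \<or> loaded \<Delta>"
  by (auto simp: loaded_iff)

lemma loaded_Fm [simp]: "\<not> loaded (Fm ` X)" and loaded_empty [simp]: "\<not> loaded {}"
  and loaded_modal_proj [simp]: "\<not> loaded (modal_proj a \<Delta>)"
  by (auto simp: loaded_iff modal_proj_def)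

text \<open>The two quantified sides make this a condition on the whole sequent: at most one loaded
  formula, and not one per component.\<close>

definition single_load :: "('p, 'a) sequent \<Rightarrow> bool" where
  "single_load S \<longleftrightarrow> (\<forall>i j \<chi> \<chi>'. \<chi> \<in> component i S \<and> is_ld \<chi> \<and> \<chi>' \<in> component j S \<and> is_ld \<chi>' \<longrightarrow>
     i = j \<and> \<chi> = \<chi>')"

lemma single_loadD:
  assumes "single_load (mk_sequent i (insert \<chi> \<Delta>) \<Gamma>)" "\<chi> \<notin> \<Delta>" "is_ld \<chi>"
  shows "free \<Delta> \<and> free \<Gamma>"
proof -
  have "i = j \<and> \<chi> = \<chi>'" if "\<chi>' \<in> component j (mk_sequent i (insert \<chi> \<Delta>) \<Gamma>)" "is_ld \<chi>'" for j \<chi>'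
    using assms that unfolding single_load_def by (metis component_mk_sequent insertI1)
  from this[of _ i] this[of _ "other i"] show ?thesis
    using assms(2) by (auto simp: loaded_iff)
qed

text \<open>An unfolding marks only the formula that continues the principal one, and (L+), the only
  rule that creates a load from an unmarked formula, demands a free context.\<close>

lemma replacement_load:
  assumes "replacement r \<chi> \<Delta> \<Gamma> \<Sigma>s" "\<Sigma> \<in> set \<Sigma>s"
  shows "(\<forall>x\<in>\<Sigma>. \<forall>y\<in>\<Sigma>. is_ld x \<longrightarrow> is_ld y \<longrightarrow> x = y) \<and>
    (loaded \<Sigma> \<longrightarrow> is_ld \<chi> \<or> free \<Delta> \<and> free \<Gamma>)"
  using assms(1)
proof cases
  case (ld_dia \<alpha> \<xi>)
  then obtain X \<delta> where "\<Sigma> = Fm ` X \<union> {neg_xi (ld_boxes \<delta> \<xi>)}"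
    using assms(2) by (auto simp: unfold_ld_dia_def)
  then show ?thesis using ld_dia by auto
qed (use assms(2) in \<open>auto simp: loaded_iff\<close>)

lemma rule_inst_single_load:
  assumes "rule_inst ra S Ss" "single_load S" "S' \<in> set Ss"
  shows "single_load S'"
  using assms
proof (cases rule: rule_inst.cases)
  case (local \<chi> \<Delta> r \<Gamma> \<Sigma>s i)
  then obtain \<Sigma> where \<Sigma>: "\<Sigma> \<in> set \<Sigma>s" "S' = mk_sequent i (\<Delta> \<union> \<Sigma>) \<Gamma>" using assms(3) by auto
  have sl: "single_load (mk_sequent i (insert \<chi> \<Delta>) \<Gamma>)" using local assms(2) by simp
  show ?thesis
  proof (cases "loaded \<Sigma>")
    case True
    then have "free \<Delta> \<and> free \<Gamma>"
      using replacement_load[OF local(5) \<Sigma>(1)] single_loadD[OF sl local(4)] by blast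
    then show ?thesis
      unfolding \<Sigma>(2) single_load_def loaded_iff component_mk_sequent
      using replacement_load[OF local(5) \<Sigma>(1)] by (auto split: if_splits)
  next
    case False
    then show ?thesis using sl
      unfolding \<Sigma>(2) single_load_def loaded_iff component_mk_sequent
      by (metis (full_types) Un_iff insert_iff)
  qed
next
  case (modal a \<xi> \<Delta> \<Gamma> i)
  then have "S' = mk_sequent i (insert (neg_xi \<xi>) (modal_proj a \<Delta>)) (modal_proj a \<Gamma>)"
    using assms(3) by simp
  then show ?thesis
    by (auto simp: single_load_def modal_proj_def split: if_splits)
qed

lemma replacement_fl:
  assumes "replacement r \<chi> \<Delta> \<Gamma> \<Sigma>s" "\<Sigma> \<in> set \<Sigma>s" "\<chi>' \<in> \<Sigma>"
  shows "unload \<chi>' = unload \<chi> \<or> fl (unload \<chi>) (unload \<chi>')"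
  using assms
proof cases
  case (box \<alpha> \<Sigma>' \<phi>)
  then obtain \<psi> \<Sigma>0 where "\<chi>' = Fm \<psi>" "\<psi> \<in> \<Sigma>0" "\<Sigma>0 \<in> unfold_box \<alpha> \<phi>" using assms by auto
  then show ?thesis using box(2) Hset_tests
    by (auto simp: unfold_box_def Pset_eq_Hset intro: fl.intros)
next
  case (dia \<alpha> \<Sigma>' \<phi>)
  then obtain \<psi> \<Sigma>0 where "\<chi>' = Fm \<psi>" "\<psi> \<in> \<Sigma>0" "\<Sigma>0 \<in> unfold_dia \<alpha> \<phi>" using assms by auto
  then show ?thesis using dia(2) Hset_tests
    by (fastforce simp: unfold_dia_def intro: fl.intros)
next
  case (ld_dia \<alpha> \<xi>)
  then obtain X \<delta> where X: "(X, \<delta>) \<in> Hset \<alpha>" "\<Sigma> = Fm ` X \<union> {neg_xi (ld_boxes \<delta> \<xi>)}"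
    using assms(2) by (auto simp: unfold_ld_dia_def)
  then consider \<tau> where "\<chi>' = Fm \<tau>" "\<tau> \<in> tests \<alpha>" | "\<chi>' = neg_xi (ld_boxes \<delta> \<xi>)"
    using Hset_tests assms(3) by blast
  then show ?thesis
  proof cases
    case 1
    then show ?thesis using ld_dia(2) by (auto intro: fl.intros)
  next
    case 2
    then show ?thesis using ld_dia(2) fl.intros(9)[OF X(1)] by auto
  qed
qed (auto intro: fl.intros)

lemma rule_inst_fl:
  assumes "rule_inst ra S Ss" "S' \<in> set Ss" "\<chi>' \<in> members S'"
  shows "\<exists>\<chi>\<in>members S. unload \<chi>' = unload \<chi> \<or> fl (unload \<chi>) (unload \<chi>')"
  using assms
proof (cases rule: rule_inst.cases)
  case (local \<chi> \<Delta> r \<Gamma> \<Sigma>s i)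
  then obtain \<Sigma> where \<Sigma>: "\<Sigma> \<in> set \<Sigma>s" "S' = mk_sequent i (\<Delta> \<union> \<Sigma>) \<Gamma>" using assms(2) by auto
  then consider "\<chi>' \<in> \<Delta> \<union> \<Gamma>" | "\<chi>' \<in> \<Sigma>" using assms(3) by auto
  then show ?thesis
  proof cases
    case 1
    then show ?thesis using local(2) by auto
  next
    case 2
    then show ?thesis using replacement_fl[OF local(5) \<Sigma>(1)] local(2) by auto
  qed
next
  case (modal a \<xi> \<Delta> \<Gamma> i)
  then have S': "S' = mk_sequent i (insert (neg_xi \<xi>) (modal_proj a \<Delta>)) (modal_proj a \<Gamma>)"
    using assms(2) by simp
  then consider "\<chi>' = neg_xi \<xi>" | \<phi> where "\<chi>' = Fm \<phi>" "Fm (Box (Atom a) \<phi>) \<in> \<Delta> \<union> \<Gamma>"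
    using assms(3) by (auto simp: modal_proj_def)
  then show ?thesis
  proof cases
    case 1
    then have "fl (unload (NegLd (Atom a) \<xi>)) (unload \<chi>')" by (auto intro: fl.intros)
    then show ?thesis using modal(2) by auto
  next
    case 2
    then have "fl (unload (Fm (Box (Atom a) \<phi>))) (unload \<chi>')" by (auto intro: fl.intros)
    moreover have "Fm (Box (Atom a) \<phi>) \<in> members S" using 2 modal(2) by auto
    ultimately show ?thesis by blast
  qed
qed

section \<open>A measure that decreases under local unfolding\<close>

definition lsize :: "('p, 'a) efml \<Rightarrow> nat" where
  "lsize \<chi> = (if basic_fml \<chi> then 0 else size (unload \<chi>))"

definition weight :: "('p, 'a) sequent \<Rightarrow> nat multiset" where
  "weight S = image_mset lsize (mset_set (fst S)) + image_mset lsize (mset_set (snd S))"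

lemma basic_boxes: "(X, \<delta>) \<in> Hset \<alpha> \<Longrightarrow> \<delta> \<noteq> [] \<Longrightarrow>
    basic_fml (Fm (boxes \<delta> \<phi>)) \<and> basic_fml (Fm (Neg (boxes \<delta> \<phi>))) \<and> basic_fml (neg_xi (ld_boxes \<delta> \<xi>))"
  by (drule (1) Hset_head) (auto intro: basic_fml.intros)

lemma lsize_le: "lsize \<chi> \<le> size (unload \<chi>)"
  by (simp add: lsize_def)

text \<open>Tests are smaller than the program. An empty residual leaves the shorter formula behind
  the box; a nonempty one may give a longer formula, as with stars, but it starts with an atomic
  program, so it is basic and weighs 0. (L-) is excluded because it changes nothing but
  marks.\<close>

lemma replacement_lsize:
  assumes "replacement r \<chi> \<Delta> \<Gamma> \<Sigma>s" "\<Sigma> \<in> set \<Sigma>s" "\<chi>' \<in> \<Sigma>" "\<not> basic_fml \<chi>" "r \<noteq> RLMinus"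
  shows "lsize \<chi>' < lsize \<chi>"
proof -
  have "lsize \<chi>' < size (unload \<chi>)"
    using assms(1)
  proof cases
    case (box \<alpha> \<Sigma>' \<phi>)
    then obtain \<psi> \<Sigma>0 where \<psi>: "\<chi>' = Fm \<psi>" "\<psi> \<in> \<Sigma>0" "\<Sigma>0 \<in> unfold_box \<alpha> \<phi>" using assms by auto
    then consider \<tau> where "\<psi> = Neg \<tau>" "\<tau> \<in> tests \<alpha>" | X \<delta> where "\<psi> = boxes \<delta> \<phi>" "(X, \<delta>) \<in> Hset \<alpha>"
      by (auto simp: unfold_box_def Pset_eq_Hset)
    then show ?thesis
    proof cases
      case 1
      then show ?thesis using size_tests[OF 1(2)] lsize_le[of \<chi>'] \<psi>(1) box(2) by simp
    next
      case 2
      then show ?thesis using lsize_le[of \<chi>'] \<psi>(1) box(2) basic_boxes[of X \<delta> \<alpha> \<phi>]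
        by (cases "\<delta> = []") (auto simp: lsize_def)
    qed
  next
    case (dia \<alpha> \<Sigma>' \<phi>)
    then obtain \<psi> \<Sigma>0 where \<psi>: "\<chi>' = Fm \<psi>" "\<psi> \<in> \<Sigma>0" "\<Sigma>0 \<in> unfold_dia \<alpha> \<phi>" using assms by auto
    then obtain X \<delta> where X: "(X, \<delta>) \<in> Hset \<alpha>" "\<psi> \<in> X \<or> \<psi> = Neg (boxes \<delta> \<phi>)"
      by (auto simp: unfold_dia_def)
    then consider "\<psi> \<in> tests \<alpha>" | "\<psi> = Neg (boxes \<delta> \<phi>)" using Hset_tests by blast
    then show ?thesis
    proof cases
      case 1
      then show ?thesis using size_tests[OF 1] lsize_le[of \<chi>'] \<psi>(1) dia(2) by simp
    next
      case 2
      then show ?thesis using lsize_le[of \<chi>'] \<psi>(1) dia(2) basic_boxes[OF X(1), of \<phi>]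
        by (cases "\<delta> = []") (auto simp: lsize_def)
    qed
  next
    case (ld_dia \<alpha> \<xi>)
    then obtain X \<delta> where X: "(X, \<delta>) \<in> Hset \<alpha>" "\<Sigma> = Fm ` X \<union> {neg_xi (ld_boxes \<delta> \<xi>)}"
      using assms(2) by (auto simp: unfold_ld_dia_def)
    then consider \<tau> where "\<chi>' = Fm \<tau>" "\<tau> \<in> tests \<alpha>" | "\<chi>' = neg_xi (ld_boxes \<delta> \<xi>)"
      using Hset_tests assms(3) by blast
    then show ?thesis
    proof cases
      case 1
      then show ?thesis using size_tests[OF 1(2)] lsize_le[of \<chi>'] ld_dia(2) by simp
    next
      case 2
      then show ?thesis using lsize_le[of \<chi>'] ld_dia(2) basic_boxes[OF X(1), of _ \<xi>]
        by (cases "\<delta> = []") (auto simp: lsize_def)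
    qed
  next
    case (lplus \<phi> a \<alpha>s)
    then show ?thesis using assms(4) by (auto intro: basic_fml.intros)
  qed (use assms lsize_le[of \<chi>'] in auto)
  then show ?thesis using assms(4) by (simp add: lsize_def)
qed

lemma weight_mk_sequent:
  "weight (mk_sequent i \<Delta> \<Gamma>) = image_mset lsize (mset_set \<Delta>) + image_mset lsize (mset_set \<Gamma>)"
  by (cases i) (auto simp: weight_def)

lemma rule_inst_weight:
  assumes "rule_inst (r, i, \<chi>) S Ss" "S' \<in> set Ss" "\<not> basic_fml \<chi>" "r \<noteq> RLMinus"
    "finite (members S)" "finite (members S')"
  shows "(weight S', weight S) \<in> mult less_than"
  using assms(1)
proof (cases rule: rule_inst.cases)
  case (local \<Delta> \<Gamma> \<Sigma>s)
  then obtain \<Sigma> where \<Sigma>: "\<Sigma> \<in> set \<Sigma>s" "S' = mk_sequent i (\<Delta> \<union> \<Sigma>) \<Gamma>" using assms(2) by auto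
  have fin: "finite \<Delta>" "finite \<Sigma>" using assms(6) \<Sigma>(2) by simp_all
  \<comment> \<open>Replacement formulas already present in the context are absorbed by the union,
    so only \<open>\<Sigma> - \<Delta>\<close> adds weight.\<close>
  have "mset_set (\<Delta> \<union> \<Sigma>) = mset_set \<Delta> + mset_set (\<Sigma> - \<Delta>)"
    using fin by (metis Diff_disjoint Un_Diff_cancel finite_Diff mset_set_Union)
  then have "weight S' = (image_mset lsize (mset_set \<Delta>) + image_mset lsize (mset_set \<Gamma>)) +
      image_mset lsize (mset_set (\<Sigma> - \<Delta>))"
    by (simp add: \<Sigma>(2) weight_mk_sequent)
  moreover have "weight S = (image_mset lsize (mset_set \<Delta>) + image_mset lsize (mset_set \<Gamma>)) + {#lsize \<chi>#}"
    using local fin by (simp add: weight_mk_sequent)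
  moreover have "\<forall>k\<in>#image_mset lsize (mset_set (\<Sigma> - \<Delta>)). \<exists>j\<in>#{#lsize \<chi>#}. (k, j) \<in> less_than"
    using replacement_lsize[OF local(4) \<Sigma>(1) _ assms(3,4)] fin by auto
  ultimately show ?thesis using one_step_implies_mult[of "{#lsize \<chi>#}"] by simp
next
  case (modal a \<xi> \<Delta> \<Gamma>)
  then show ?thesis using assms(3) by (auto intro: basic_fml.intros)
qed

section \<open>Soundness\<close>

definition sat :: "('w, 'p, 'a) kripke \<Rightarrow> 'w \<Rightarrow> ('p, 'a) sequent \<Rightarrow> bool" where
  "sat M v S \<longleftrightarrow> (\<forall>\<chi>\<in>members S. holds M (unload \<chi>) v)"

text \<open>\<open>n\<close> is the length of some refuting run, not of a shortest one: one run is
  fixed and consumed from node to node.\<close>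

definition due :: "('w, 'p, 'a) kripke \<Rightarrow> 'w \<Rightarrow> ('p, 'a) sequent \<Rightarrow> nat \<Rightarrow> bool" where
  "due M v S n \<longleftrightarrow> (\<exists>\<alpha> \<xi> u. NegLd \<alpha> \<xi> \<in> members S \<and> run M (\<alpha> # xi_progs \<xi>) n v u \<and>
     \<not> holds M (xi_core \<xi>) u)"

lemma not_holds_boxes:
  assumes "kripke_model M" "v \<in> worlds M"
  shows "holds M (Neg (boxes \<delta> \<phi>)) v \<longleftrightarrow> (\<exists>n u. run M \<delta> n v u \<and> \<not> holds M \<phi> u)"
  using holds_boxes[OF assms] by simp

lemma sat_due:
  assumes "kripke_model M" "v \<in> worlds M" "sat M v S" "loaded (members S)"
  shows "\<exists>n. due M v S n"
proof -
  obtain \<alpha> \<xi> where ld: "NegLd \<alpha> \<xi> \<in> members S" using assms(4) unfolding loaded_def by blast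
  then have "holds M (unload (NegLd \<alpha> \<xi>)) v" using assms(3) unfolding sat_def by blast
  then have "holds M (Neg (boxes (\<alpha> # xi_progs \<xi>) (xi_core \<xi>))) v" by simp
  then show ?thesis using not_holds_boxes[OF assms(1,2)] ld unfolding due_def by blast
qed

text \<open>The rule for loaded diamonds is left out because there the child must be chosen along
  the run being followed, not along an arbitrary witness. (L+) and (L-) do not alter the unmarked
  formula.\<close>

lemma replacement_holds:
  assumes M: "kripke_model M" "v \<in> worlds M"
    and "replacement r \<chi> \<Delta> \<Gamma> \<Sigma>s" "holds M (unload \<chi>) v" "r \<noteq> RLdDia"
  shows "\<exists>\<Sigma>\<in>set \<Sigma>s. \<forall>\<chi>'\<in>\<Sigma>. holds M (unload \<chi>') v"
  using assms(3)
proof cases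
  case (box \<alpha> \<Sigma>' \<phi>)
  \<comment> \<open>With the tests true at \<open>v\<close> as guess, all negated tests of the child
    are true, and every residual in \<open>Pset l\<close> can actually be executed from
    \<open>v\<close>.\<close>
  define l where "l = {\<tau> \<in> tests \<alpha>. holds M \<tau> v}"
  define \<Sigma> where "\<Sigma> = {Neg \<tau> | \<tau>. \<tau> \<in> tests \<alpha> - l} \<union> {boxes as \<phi> | as. as \<in> Pset l \<alpha>}"
  have "l \<subseteq> tests \<alpha>" unfolding l_def by blast
  then have "\<Sigma> \<in> unfold_box \<alpha> \<phi>" unfolding unfold_box_def \<Sigma>_def by blast
  moreover have "holds M \<psi> v" if "\<psi> \<in> \<Sigma>" for \<psi>
  proof -
    from that consider \<tau> where "\<psi> = Neg \<tau>" "\<not> holds M \<tau> v"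
      | X \<delta> where "\<psi> = boxes \<delta> \<phi>" "X \<subseteq> l" "(X, \<delta>) \<in> Hset \<alpha>"
      unfolding \<Sigma>_def l_def Pset_eq_Hset by blast
    then show ?thesis
    proof cases
      case 1
      then show ?thesis by simp
    next
      case 2
      have "holds M (boxes [\<alpha>] \<phi>) v" using assms(4) box(2) by simp
      then have all: "\<forall>n u. run M [\<alpha>] n v u \<longrightarrow> holds M \<phi> u" using holds_boxes[OF M] by blast
      have "\<forall>\<tau>\<in>X. holds M \<tau> v" using 2(2) unfolding l_def by blast
      then have "holds M \<phi> u" if "run M \<delta> n v u" for n u
        using all run_fold[OF 2(3), of M v "[]" n u] that by auto
      then show ?thesis using holds_boxes[OF M] 2(1) by blast
    qed
  qed
  ultimately show ?thesis using box(3,6) by (intro bexI[of _ "Fm ` \<Sigma>"]) auto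
next
  case (dia \<alpha> \<Sigma>' \<phi>)
  have "holds M (Neg (boxes [\<alpha>] \<phi>)) v" using assms(4) dia(2) by simp
  then obtain n u where "run M [\<alpha>] n v u" "\<not> holds M \<phi> u" using not_holds_boxes[OF M] by blast
  moreover from this(1) obtain X \<gamma> m where X: "(X, \<gamma>) \<in> Hset \<alpha>" "\<forall>\<tau>\<in>X. holds M \<tau> v" "run M \<gamma> m v u"
    using run_unfold[of M \<alpha> "[]" n v u] by auto
  ultimately have "holds M (Neg (boxes \<gamma> \<phi>)) v" using not_holds_boxes[OF M] by blast
  moreover have "X \<union> {Neg (boxes \<gamma> \<phi>)} \<in> set \<Sigma>'" using X(1) dia(6) unfolding unfold_dia_def by blast
  then have "Fm ` (X \<union> {Neg (boxes \<gamma> \<phi>)}) \<in> set \<Sigma>s" unfolding dia(3) set_map by (rule imageI)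
  ultimately show ?thesis using X(2) by (intro bexI[of _ "Fm ` (X \<union> {Neg (boxes \<gamma> \<phi>)})"]) auto
qed (use assms(4,5) in auto)

lemma replacement_basic: "replacement r \<chi> \<Delta> \<Gamma> \<Sigma>s \<Longrightarrow> basic_fml \<chi> \<Longrightarrow> r = RLPlus \<or> r = RLMinus"
  by (induct rule: replacement.induct) (auto simp: atomic_def elim: basic_fml.cases)

lemma replacement_is_ld: "replacement r \<chi> \<Delta> \<Gamma> \<Sigma>s \<Longrightarrow> is_ld \<chi> \<Longrightarrow> r = RLdDia \<or> r = RLMinus"
  by (induct rule: replacement.induct) auto

lemma neg_xi_cases:
  assumes "xi_progs \<xi> \<noteq> []"
  obtains \<beta> \<zeta> where "neg_xi \<xi> = NegLd \<beta> \<zeta>" "xi_progs \<xi> = \<beta> # xi_progs \<zeta>" "xi_core \<xi> = xi_core \<zeta>"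
  using assms by (cases \<xi>) auto

abbreviation progress :: "((nat \<times> nat multiset) \<times> nat \<times> nat multiset) set" where
  "progress \<equiv> less_than <*lex*> mult less_than"

lemma wf_progress: "wf progress"
  by (simp add: wf_lex_prod wf_mult)

lemma trans_progress: "trans progress"
  by (simp add: trans_lex_prod mult_def)

text \<open>Between two loaded sequents only three things can happen. The loaded formula is
  unfolded, or the modal rule executes its first program: the run gets shorter. Or some other
  formula is principal: the run stays and the weight drops, since that formula is not basic. (L+)
  starts from a free sequent and (L-) ends in one.\<close>

lemma rule_inst_sound:
  assumes M: "kripke_model M" "v \<in> worlds M"
    and rule: "rule_inst ra S Ss"
    and fin: "finite (members S)" "\<forall>S'\<in>set Ss. finite (members S')"
    and S: "single_load S" "sat M v S" "loaded (members S) \<longrightarrow> due M v S n"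
  shows "\<exists>S'\<in>set Ss. \<exists>v'\<in>worlds M. sat M v' S' \<and> (loaded (members S) \<and> loaded (members S') \<longrightarrow>
    (\<exists>m. due M v' S' m \<and> ((m, weight S'), (n, weight S)) \<in> progress))"
  using rule
proof (cases rule: rule_inst.cases)
  case (local \<chi> \<Delta> r \<Gamma> \<Sigma>s i)
  have mem: "members S = insert \<chi> (\<Delta> \<union> \<Gamma>)" using local(2) by auto
  have sl: "is_ld \<chi> \<Longrightarrow> free \<Delta> \<and> free \<Gamma>" using single_loadD local(2,4) S(1) by metis
  have child: ?thesis if \<Sigma>: "\<Sigma> \<in> set \<Sigma>s" "\<forall>\<chi>'\<in>\<Sigma>. holds M (unload \<chi>') v"
    and "loaded (members S) \<Longrightarrow> loaded (\<Delta> \<union> \<Sigma> \<union> \<Gamma>) \<Longrightarrow>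
      \<exists>m. due M v (mk_sequent i (\<Delta> \<union> \<Sigma>) \<Gamma>) m \<and> ((m, weight (mk_sequent i (\<Delta> \<union> \<Sigma>) \<Gamma>)), (n, weight S)) \<in> progress"
    for \<Sigma>
  proof -
    let ?S' = "mk_sequent i (\<Delta> \<union> \<Sigma>) \<Gamma>"
    have "?S' \<in> set Ss" using local(3) \<Sigma>(1) by auto
    moreover have "sat M v ?S'" using S(2) \<Sigma>(2) mem by (auto simp: sat_def)
    ultimately show ?thesis using that(3) M(2) by (intro bexI[of _ ?S'] bexI[of _ v]) auto
  qed
  show ?thesis
  proof (cases "r = RLdDia")
    case True
    with local(5) obtain \<alpha> \<xi> where \<chi>: "\<chi> = NegLd \<alpha> \<xi>" "\<not> atomic \<alpha>" "set \<Sigma>s = unfold_ld_dia \<alpha> \<xi>"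
      by (auto elim: replacement.cases)
    then have free: "free \<Delta>" "free \<Gamma>" using sl by auto
    \<comment> \<open>The context is free, so the formula that \<open>due\<close> speaks of is the
      principal one.\<close>
    have "due M v S n" using S(3) mem \<chi>(1) by simp
    then obtain u where u: "run M (\<alpha> # xi_progs \<xi>) n v u" "\<not> holds M (xi_core \<xi>) u"
      using free mem \<chi>(1) unfolding due_def loaded_def by auto
    from run_unfold[OF u(1)] \<chi>(2) obtain X \<gamma> m where X: "(X, \<gamma>) \<in> Hset \<alpha>" "\<forall>\<tau>\<in>X. holds M \<tau> v"
      "run M (\<gamma> @ xi_progs \<xi>) m v u" "m < n" by blast
    let ?x = "ld_boxes \<gamma> \<xi>"
    let ?\<Sigma> = "Fm ` X \<union> {neg_xi ?x}"
    have "?\<Sigma> \<in> set \<Sigma>s" using X(1) \<chi>(3) unfolding unfold_ld_dia_def by blast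
    moreover have "holds M (Neg (boxes (xi_progs ?x) (xi_core ?x))) v"
      unfolding not_holds_boxes[OF M] using X(3) u(2) by auto
    then have "holds M (unload (neg_xi ?x)) v" by (simp only: unload_neg_xi)
    then have "\<forall>\<chi>'\<in>?\<Sigma>. holds M (unload \<chi>') v" using X(2) by auto
    moreover have "due M v (mk_sequent i (\<Delta> \<union> ?\<Sigma>) \<Gamma>) m" if "loaded (\<Delta> \<union> ?\<Sigma> \<union> \<Gamma>)"
    proof -
      have "xi_progs ?x \<noteq> []" using that free by (simp del: xi_progs_ld_boxes)
      then obtain \<beta> \<zeta> where "neg_xi ?x = NegLd \<beta> \<zeta>" "xi_progs ?x = \<beta> # xi_progs \<zeta>" "xi_core ?x = xi_core \<zeta>"
        by (rule neg_xi_cases)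
      then show ?thesis unfolding due_def using X(3) u(2) by auto
    qed
    ultimately show ?thesis using child[of ?\<Sigma>] X(4) by auto
  next
    case False
    have "holds M (unload \<chi>) v" using S(2) mem by (simp add: sat_def)
    from replacement_holds[OF M local(5) this False] obtain \<Sigma>
      where \<Sigma>: "\<Sigma> \<in> set \<Sigma>s" "\<forall>\<chi>'\<in>\<Sigma>. holds M (unload \<chi>') v" by blast
    let ?S' = "mk_sequent i (\<Delta> \<union> \<Sigma>) \<Gamma>"
    have "due M v ?S' n \<and> ((n, weight ?S'), (n, weight S)) \<in> progress"
      if ld: "loaded (members S)" "loaded (\<Delta> \<union> \<Sigma> \<union> \<Gamma>)"
    proof -
      have "\<not> is_ld \<chi>"
      proof
        assume "is_ld \<chi>"
        then have "r = RLMinus" "free \<Delta>" "free \<Gamma>" using replacement_is_ld[OF local(5)] False sl by auto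
        moreover from local(5) this(1) \<Sigma>(1) have "free \<Sigma>" by cases auto
        ultimately show False using ld(2) by simp
      qed
      then have "loaded (\<Delta> \<union> \<Gamma>)" using ld(1) mem by simp
      then have "r \<noteq> RLPlus" using local(5) by (auto elim: replacement.cases)
      moreover have "r \<noteq> RLMinus" using local(5) \<open>\<not> is_ld \<chi>\<close> by (auto elim: replacement.cases)
      ultimately have "\<not> basic_fml \<chi>" using replacement_basic[OF local(5)] by blast
      moreover have "?S' \<in> set Ss" using local(3) \<Sigma>(1) by auto
      ultimately have "(weight ?S', weight S) \<in> mult less_than"
        using rule_inst_weight[of r i \<chi> S Ss ?S'] rule fin local(1) \<open>r \<noteq> RLMinus\<close> by blast
      moreover have "due M v ?S' n"
        using S(3) ld(1) \<open>\<not> is_ld \<chi>\<close> mem unfolding due_def by auto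
      ultimately show ?thesis by simp
    qed
    then show ?thesis using child[OF \<Sigma>] by blast
  qed
next
  case (modal a \<xi> \<Delta> \<Gamma> i)
  have mem: "members S = insert (NegLd (Atom a) \<xi>) (\<Delta> \<union> \<Gamma>)" using modal(2) by auto
  have "free \<Delta> \<and> free \<Gamma>" using single_loadD modal(2,4) S(1) by (metis is_ld.simps(2))
  then obtain u where u: "run M (Atom a # xi_progs \<xi>) n v u" "\<not> holds M (xi_core \<xi>) u"
    using S(3) mem unfolding due_def loaded_def by auto
  then obtain v' m where v': "(v, v') \<in> acc M a" "run M (xi_progs \<xi>) m v' u" "n = Suc m"
    by (auto elim: run_AtomE)
  then have w: "v' \<in> worlds M" using M(1) unfolding kripke_model_def by blast
  let ?S' = "mk_sequent i (insert (neg_xi \<xi>) (modal_proj a \<Delta>)) (modal_proj a \<Gamma>)"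
  have "holds M (unload (neg_xi \<xi>)) v'"
    unfolding unload_neg_xi not_holds_boxes[OF M(1) w] using v'(2) u(2) by blast
  moreover have "holds M \<phi> v'" if "Fm (Box (Atom a) \<phi>) \<in> \<Delta> \<union> \<Gamma>" for \<phi>
  proof -
    have "holds M (unload (Fm (Box (Atom a) \<phi>))) v" using S(2) mem that unfolding sat_def by blast
    then show ?thesis using v'(1) by simp
  qed
  ultimately have "sat M v' ?S'" by (auto simp: sat_def modal_proj_def)
  moreover have "due M v' ?S' m" if "loaded (members ?S')"
  proof -
    have "xi_progs \<xi> \<noteq> []" using that by simp
    then obtain \<beta> \<zeta> where "neg_xi \<xi> = NegLd \<beta> \<zeta>" "xi_progs \<xi> = \<beta> # xi_progs \<zeta>" "xi_core \<xi> = xi_core \<zeta>"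
      by (rule neg_xi_cases)
    then show ?thesis unfolding due_def using v'(2) u(2) by auto
  qed
  ultimately show ?thesis using modal(3) w v'(3) by auto
qed

section \<open>The finite universe of sequents and its invariance\<close>

definition sequents_over :: "('p, 'a) fml set \<Rightarrow> ('p, 'a) sequent set" where
  "sequents_over C = {S. single_load S \<and> unload ` members S \<subseteq> C}"

definition fl_closed :: "('p, 'a) fml set \<Rightarrow> bool" where
  "fl_closed C \<longleftrightarrow> (\<forall>\<phi>\<in>C. \<forall>\<psi>. fl \<phi> \<psi> \<longrightarrow> \<psi> \<in> C)"

lemma finite_sequents_over:
  assumes "finite C"
  shows "finite (sequents_over C)"
proof -
  let ?E = "{\<chi>. unload \<chi> \<in> C}"
  have "sequents_over C \<subseteq> Pow ?E \<times> Pow ?E" by (auto simp: sequents_over_def)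
  then show ?thesis using finite_unload_vimage[OF assms] by (meson finite_Pow_iff finite_SigmaI finite_subset)
qed

lemma sequents_over_finite:
  assumes "finite C" "S \<in> sequents_over C"
  shows "finite (members S)"
proof -
  have "members S \<subseteq> {\<chi>. unload \<chi> \<in> C}" using assms(2) by (auto simp: sequents_over_def)
  then show ?thesis using finite_unload_vimage[OF assms(1)] by (rule finite_subset)
qed

lemma sequents_over_rule_inst:
  assumes "fl_closed C" "S \<in> sequents_over C" "rule_inst ra S Ss" "S' \<in> set Ss"
  shows "S' \<in> sequents_over C"
proof -
  have "unload \<chi>' \<in> C" if \<chi>': "\<chi>' \<in> members S'" for \<chi>'
  proof -
    obtain \<chi> where \<chi>: "\<chi> \<in> members S" "unload \<chi>' = unload \<chi> \<or> fl (unload \<chi>) (unload \<chi>')"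
      using rule_inst_fl[OF assms(3,4) \<chi>'] by blast
    then have "unload \<chi> \<in> C" using assms(2) unfolding sequents_over_def by blast
    then show ?thesis using \<chi>(2) assms(1) unfolding fl_closed_def by metis
  qed
  moreover have "single_load S'"
    using rule_inst_single_load[OF assms(3) _ assms(4)] assms(2) unfolding sequents_over_def by blast
  ultimately show ?thesis unfolding sequents_over_def by blast
qed

lemma fl_closure_exists:
  assumes "finite \<Gamma>"
  obtains C where "finite C" "fl_closed C" "\<Gamma> \<subseteq> C"
proof (rule that[of "\<Union>\<phi>\<in>\<Gamma>. cl \<phi>"])
  show "finite (\<Union>\<phi>\<in>\<Gamma>. cl \<phi>)" using assms finite_cl by blast
  show "fl_closed (\<Union>\<phi>\<in>\<Gamma>. cl \<phi>)" unfolding fl_closed_def using cl_closed by blast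
  show "\<Gamma> \<subseteq> (\<Union>\<phi>\<in>\<Gamma>. cl \<phi>)" using cl_self by blast
qed

lemma sequents_over_root:
  assumes "\<Gamma>1 \<union> \<Gamma>2 \<subseteq> C"
  shows "(Fm ` \<Gamma>1, Fm ` \<Gamma>2) \<in> sequents_over C"
proof -
  have "\<not> is_ld \<chi>" if "\<chi> \<in> component i (Fm ` \<Gamma>1, Fm ` \<Gamma>2)" for i \<chi>
    using that by (cases i) auto
  then show ?thesis using assms unfolding sequents_over_def single_load_def by auto
qed

lemma split_tableau_child:
  assumes "split_tableau T" "s @ [k] \<in> nodes T"
  obtains Ss where "s \<in> nodes T" "interior T s" "rule_inst (applied T s) (label T s) Ss"
    "\<And>k. s @ [k] \<in> nodes T \<longleftrightarrow> k < length Ss" "\<And>k. k < length Ss \<Longrightarrow> label T (s @ [k]) = Ss ! k"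
proof -
  have "s \<in> nodes T" "interior T s" using assms unfolding split_tableau_def interior_def by blast+
  moreover from this(2) obtain Ss where "rule_inst (applied T s) (label T s) Ss \<and>
      (\<forall>k. s @ [k] \<in> nodes T \<longleftrightarrow> k < length Ss) \<and> (\<forall>k<length Ss. label T (s @ [k]) = Ss ! k)"
    using assms(1) unfolding split_tableau_def by metis
  ultimately show thesis using that by blast
qed

lemma split_tableau_labels:
  assumes "split_tableau T" "fl_closed C" "label T [] \<in> sequents_over C"
  shows "s \<in> nodes T \<Longrightarrow> label T s \<in> sequents_over C"
proof (induct s rule: rev_induct)
  case Nil
  then show ?case using assms(3) by simp
next
  case (snoc k s)
  from split_tableau_child[OF assms(1) snoc(2)] obtain Ss where "s \<in> nodes T"
    and r: "rule_inst (applied T s) (label T s) Ss" and "k < length Ss" "label T (s @ [k]) = Ss ! k"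
    using snoc(2) by metis
  then have "label T (s @ [k]) \<in> set Ss" by simp
  then show ?case using sequents_over_rule_inst[OF assms(2) snoc(1)[OF \<open>s \<in> nodes T\<close>] r] by blast
qed

text \<open>On an infinite branch with finitely many labels, either infinitely many nodes are free
  and two of them share a label, giving a free repeat, or the branch is loaded from some point on
  and the pigeonhole principle gives a loaded-path repeat. Both would have to be leaves.\<close>

lemma wf_split_pdl_tableau:
  assumes T: "split_pdl_tableau T" and fin: "finite (label T ` nodes T)"
  shows "wf {(s @ [k], s) | s k. s @ [k] \<in> nodes T}"
proof (rule ccontr)
  assume "\<not> ?thesis"
  then obtain f where "\<And>i. (f (Suc i), f i) \<in> {(s @ [k], s) | s k. s @ [k] \<in> nodes T}"
    unfolding wf_iff_no_infinite_down_chain by blast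
  then have f: "\<exists>k. f (Suc i) = f i @ [k] \<and> f (Suc i) \<in> nodes T" for i by fastforce
  have st: "split_tableau T" using T unfolding split_pdl_tableau_def by blast
  have nodes: "f i \<in> nodes T" for i
    using f[of i] split_tableau_child[OF st] by metis
  have not_leaf: "\<not> leaf T (f i)" for i using f[of i] unfolding leaf_def by metis
  have len: "length (f i) = length (f 0) + i" for i
  proof (induct i)
    case (Suc i)
    then show ?case using f[of i] by auto
  qed simp
  have pre: "prefix (f i) (f j)" if "i \<le> j" for i j
    using that
  proof (induct j rule: dec_induct)
    case (step j)
    then show ?case using f[of j] by (metis prefix_snoc)
  qed simp
  have spre: "strict_prefix (f i) (f j)" if "i < j" for i j
    using pre[of i j] len[of i] len[of j] that by (auto simp: strict_prefix_def)
  have between: "\<exists>k. i \<le> k \<and> k \<le> j \<and> t = f k" if "prefix (f i) t" "prefix t (f j)" for i j t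
  proof -
    have l: "length (f i) \<le> length t" "length t \<le> length (f j)" using that prefix_length_le by blast+
    define k where "k = length t - length (f 0)"
    have k: "i \<le> k" "k \<le> j" "length (f k) = length t" using l len[of i] len[of j] len[of k] unfolding k_def by auto
    have "f k = t" using pre[OF k(2)] that(2) k(3) by (metis prefix_length_prefix order_refl prefix_order.antisym)
    then show ?thesis using k by blast
  qed
  have pigeon: "\<exists>i\<in>I. \<exists>j\<in>I. i < j \<and> label T (f i) = label T (f j)" if "infinite I" for I
  proof -
    have "(\<lambda>i. label T (f i)) ` I \<subseteq> label T ` nodes T" using nodes by blast
    then have "\<not> inj_on (\<lambda>i. label T (f i)) I" using that fin finite_imageD finite_subset by blast
    then show ?thesis unfolding inj_on_def by (metis linorder_neqE_nat)
  qed
  show False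
  proof (cases "infinite {i. \<not> loaded_node T (f i)}")
    case True
    from pigeon[OF this] obtain i j where "\<not> loaded_node T (f j)" "i < j" "label T (f i) = label T (f j)"
      by blast
    then have "free_repeat T (f j)" using spre nodes unfolding free_repeat_def repeat_def by blast
    then show False using T nodes not_leaf unfolding split_pdl_tableau_def by blast
  next
    case False
    then obtain N where N: "\<And>i. N \<le> i \<Longrightarrow> loaded_node T (f i)"
      by (metis (mono_tags, lifting) finite_nat_set_iff_bounded mem_Collect_eq not_less)
    from pigeon[of "{N..}"] obtain i j where ij: "N \<le> i" "i < j" "label T (f i) = label T (f j)"
      by (auto simp: infinite_Ici)
    \<comment> \<open>The companion has to be the nearest earlier occurrence; the greatest index is
      at least \<open>i\<close>, hence still in the loaded tail.\<close>
    define c where "c = (GREATEST c. c < j \<and> label T (f c) = label T (f j))"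
    let ?P = "\<lambda>c. c < j \<and> label T (f c) = label T (f j)"
    have c: "c < j" "label T (f c) = label T (f j)"
      using GreatestI_nat[of ?P i j] ij unfolding c_def by auto
    have great: "d \<le> c" if "?P d" for d
      using Greatest_le_nat[of ?P d j] that unfolding c_def by auto
    have "N \<le> c" using great[of i] ij by simp
    have "companion T (f j) (f c)"
      unfolding companion_def
    proof (intro conjI allI impI)
      fix t assume t: "strict_prefix (f c) t \<and> strict_prefix t (f j)"
      then obtain k where k: "c \<le> k" "k \<le> j" "t = f k" using between unfolding strict_prefix_def by blast
      then have "c < k" "k < j" using t by (auto simp: strict_prefix_def order.order_iff_strict)
      then show "label T t \<noteq> label T (f j)" using great[of k] k(3) by auto
    qed (use c spre in auto)
    moreover have "loaded_node T t" if "prefix (f c) t" "prefix t (f j)" for t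
      using between[OF that] N \<open>N \<le> c\<close> le_trans by blast
    moreover have "repeat T (f j)" unfolding repeat_def using nodes spre c by blast
    ultimately have "loaded_path_repeat T (f j)" unfolding loaded_path_repeat_def by blast
    then show False using T nodes not_leaf unfolding split_pdl_tableau_def by blast
  qed
qed

lemma closed_label_not_sat: "closed_label S \<Longrightarrow> \<not> sat M v S"
  unfolding closed_label_def sat_def by (metis holds.simps(1,3) unload.simps(1))

text \<open>\<open>l\<close> is a leaf below \<open>s\<close> whose label recurs at \<open>c\<close>
  above \<open>s\<close>. The reflexive closure \<open>progress\<^sup>=\<close> admits the case in
  which \<open>s\<close> is itself that leaf.\<close>

definition escape ::
  "('p, 'a) tableau \<Rightarrow> ('w, 'p, 'a) kripke \<Rightarrow> nat list \<Rightarrow> nat \<Rightarrow> nat list \<Rightarrow> nat list \<Rightarrow> 'w \<Rightarrow> nat \<Rightarrow> bool"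
where
  "escape T M s n c l w m \<longleftrightarrow> strict_prefix c s \<and> prefix s l \<and> label T c = label T l \<and>
     (\<forall>t. prefix c t \<and> prefix t l \<longrightarrow> loaded_node T t) \<and> w \<in> worlds M \<and> sat M w (label T l) \<and>
     due M w (label T l) m \<and> ((m, weight (label T l)), (n, weight (label T s))) \<in> progress\<^sup>="

text \<open>
  A satisfied node passes its satisfaction down to a leaf whose companion lies strictly above the
  node. If the companion of the leaf found is the node itself, then the whole loop is loaded, so
  \<open>progress\<close> has been made, and the search is resumed at the node.
\<close>

lemma satisfied_node_escapes:
  assumes T: "split_pdl_tableau T" "closed_tableau T"
    and C: "finite C" "\<And>s. s \<in> nodes T \<Longrightarrow> label T s \<in> sequents_over C"
    and M: "kripke_model M"
    and s: "s \<in> nodes T" "v \<in> worlds M" "sat M v (label T s)"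
      "loaded_node T s \<longrightarrow> due M v (label T s) n"
  shows "\<exists>c l w m. escape T M s n c l w m"
proof -
  have st: "split_tableau T" using T(1) unfolding split_pdl_tableau_def by blast
  have "finite (label T ` nodes T)"
    by (rule finite_subset[OF _ finite_sequents_over[OF C(1)]]) (use C(2) in auto)
  from wf_split_pdl_tableau[OF T(1) this] s show ?thesis
  proof (induct s arbitrary: v n rule: wf_induct_rule)
    case (less s)
    show ?case
      using less(3-5)
    proof (induct "(n, weight (label T s))" arbitrary: v n rule: wf_induct_rule[OF wf_progress])
      case (1 n v)
      show ?case
      proof (cases "leaf T s")
        case True
        then have "loaded_path_repeat T s \<or> closed_label (label T s)"
          using T(2) unfolding closed_tableau_def by simp
        then have "loaded_path_repeat T s" using closed_label_not_sat[of "label T s" M v] 1(3) by iprover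
        then obtain c where c: "companion T s c" "\<forall>t. prefix c t \<and> prefix t s \<longrightarrow> loaded_node T t"
          unfolding loaded_path_repeat_def by blast
        then have cs: "strict_prefix c s" "label T c = label T s" unfolding companion_def by simp_all
        then have "loaded_node T s" using c(2) by (simp add: strict_prefix_def)
        then have "escape T M s n c s v n" using c(2) cs 1(2-4) by (simp add: escape_def)
        then show ?thesis by iprover
      next
        case False
        then obtain k0 where "s @ [k0] \<in> nodes T" using less(2) unfolding leaf_def by blast
        from split_tableau_child[OF st this] obtain Ss where r: "rule_inst (applied T s) (label T s) Ss"
          and Ss: "\<And>k. s @ [k] \<in> nodes T \<longleftrightarrow> k < length Ss" "\<And>k. k < length Ss \<Longrightarrow> label T (s @ [k]) = Ss ! k"
          by metis
        have lab: "single_load (label T s)" "finite (members (label T s))"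
          using C(2)[OF less(2)] sequents_over_finite[OF C(1)] by (simp_all add: sequents_over_def)
        have "\<forall>S'\<in>set Ss. finite (members S')"
          using C(2) Ss sequents_over_finite[OF C(1)] by (metis in_set_conv_nth)
        from rule_inst_sound[OF M 1(2) r lab(2) this lab(1) 1(3) 1(4)[unfolded loaded_node_def]]
        obtain S' v' where S': "S' \<in> set Ss" "v' \<in> worlds M" "sat M v' S'"
            and pr: "loaded (members (label T s)) \<and> loaded (members S') \<longrightarrow>
              (\<exists>m. due M v' S' m \<and> ((m, weight S'), (n, weight (label T s))) \<in> progress)"
          by (elim bexE conjE) (rule that)
        from S'(1) obtain k where k: "k < length Ss" "S' = Ss ! k" by (metis in_set_conv_nth)
        let ?s = "s @ [k]"
        have s': "?s \<in> nodes T" "label T ?s = S'" using Ss k by auto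
        have "\<exists>m. (loaded_node T ?s \<longrightarrow> due M v' S' m) \<and> (loaded_node T s \<and> loaded_node T ?s \<longrightarrow>
            ((m, weight S'), (n, weight (label T s))) \<in> progress)"
        proof (cases "loaded_node T s \<and> loaded_node T ?s")
          case True
          then obtain m where "due M v' S' m" "((m, weight S'), (n, weight (label T s))) \<in> progress"
            using pr s'(2) unfolding loaded_node_def by auto
          then show ?thesis by iprover
        next
          case False
          then show ?thesis using sat_due[OF M S'(2,3)] s'(2) unfolding loaded_node_def by auto
        qed
        then obtain m where m: "loaded_node T ?s \<longrightarrow> due M v' S' m"
          "loaded_node T s \<and> loaded_node T ?s \<longrightarrow> ((m, weight S'), (n, weight (label T s))) \<in> progress"
          by iprover
        have "(?s, s) \<in> {(s @ [k], s) | s k. s @ [k] \<in> nodes T}" using s'(1) by blast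
        then have "\<exists>c l w m'. escape T M ?s m c l w m'"
          by (rule less(1)) (use s' S' m in simp_all)
        then obtain c l w m' where "escape T M ?s m c l w m'" by iprover
        then have l: "strict_prefix c ?s" "prefix ?s l" "label T c = label T l"
            "\<forall>t. prefix c t \<and> prefix t l \<longrightarrow> loaded_node T t" "w \<in> worlds M" "sat M w (label T l)"
            "due M w (label T l) m'" "((m', weight (label T l)), (m, weight S')) \<in> progress\<^sup>="
          unfolding escape_def s'(2) by iprover+
        have cs: "prefix c s" using l(1) by (auto simp: strict_prefix_def)
        have sl: "prefix s l" using l(2) by (rule append_prefixD)
        have "prefix c ?s" using cs by simp
        \<comment> \<open>Both nodes lie on the path from \<open>c\<close> to \<open>l\<close>. Only
          this makes the step from \<open>s\<close> to its child count as progress.\<close>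
        then have "loaded_node T s" "loaded_node T ?s" using l(2,4) cs sl by simp_all
        with m(2) have "((m, weight S'), (n, weight (label T s))) \<in> progress" by simp
        with l(8) have dec: "((m', weight (label T l)), (n, weight (label T s))) \<in> progress"
          by (metis UnE pair_in_Id_conv prod.inject transD[OF trans_progress])
        show ?thesis
        proof (cases "c = s")
          case False
          then have "escape T M s n c l w m'"
            unfolding escape_def using cs sl l(3-7) dec by (simp add: strict_prefix_def)
          then show ?thesis by iprover
        next
          case True
          then have eq: "label T l = label T s" using l(3) by simp
          have dec': "((m', weight (label T s)), (n, weight (label T s))) \<in> progress" using dec eq by simp
          have "sat M w (label T s)" "loaded_node T s \<longrightarrow> due M w (label T s) m'"
            using l(6,7) eq by simp_all
          from 1(1)[OF dec' l(5) this] obtain c' l' w' m'' where e: "escape T M s m' c' l' w' m''" by iprover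
          then have "((m'', weight (label T l')), (m', weight (label T s))) \<in> progress\<^sup>="
            unfolding escape_def by iprover
          then have "((m'', weight (label T l')), (n, weight (label T s))) \<in> progress"
            using dec unfolding eq by (metis UnE pair_in_Id_conv transD[OF trans_progress])
          then have "escape T M s n c' l' w' m''" using e unfolding escape_def by simp
          then show ?thesis by iprover
        qed
      qed
    qed
  qed
qed

theorem soundness:
  assumes T: "split_pdl_tableau T" "closed_tableau T" "tableau_for T \<Gamma>1 \<Gamma>2"
    and fin: "finite \<Gamma>1" "finite \<Gamma>2"
  shows "\<not> satisfiable TYPE('w) (\<Gamma>1 \<union> \<Gamma>2)"
proof
  assume "satisfiable TYPE('w) (\<Gamma>1 \<union> \<Gamma>2)"
  then obtain M and w :: 'w where M: "kripke_model M" "w \<in> worlds M" "\<forall>\<phi>\<in>\<Gamma>1 \<union> \<Gamma>2. holds M \<phi> w"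
    unfolding satisfiable_def by blast
  obtain C where C: "finite C" "fl_closed C" "\<Gamma>1 \<union> \<Gamma>2 \<subseteq> C"
    using fl_closure_exists[of "\<Gamma>1 \<union> \<Gamma>2"] fin by blast
  have st: "split_tableau T" using T(1) unfolding split_pdl_tableau_def by blast
  have root: "label T [] = (Fm ` \<Gamma>1, Fm ` \<Gamma>2)" using T(3) unfolding tableau_for_def .
  have "[] \<in> nodes T" using st unfolding split_tableau_def by blast
  moreover have "sat M w (label T [])" using M(3) root by (auto simp: sat_def)
  moreover have "\<not> loaded_node T []" using root by (simp add: loaded_node_def)
  moreover have "label T [] \<in> sequents_over C" using sequents_over_root[OF C(3)] root by simp
  \<comment> \<open>No proper prefix of the root exists to serve as \<open>c\<close>.\<close>
  ultimately have "\<exists>c l w' m. escape T M [] 0 c l w' m"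
    using satisfied_node_escapes[OF T(1,2) C(1) split_tableau_labels[OF st C(2)] M(1) _ M(2)] by simp
  then show False by (auto simp: escape_def)
qed

section \<open>The tableau game\<close>

definition selected :: "('p, 'a) efml set \<Rightarrow> ('p, 'a) efml" where
  "selected \<Delta> = (SOME \<chi>. \<chi> \<in> \<Delta> \<and> \<not> basic_fml \<chi>)"

text \<open>An unloaded component goes first as long as it is not basic, which is (U1). If nothing
  is loaded, the first component that is not basic is taken.\<close>

definition active_side :: "('p, 'a) sequent \<Rightarrow> side" where
  "active_side S =
     (if loaded (component One S) \<and> basic (component Two S) \<or>
         free (component One S) \<and> \<not> basic (component One S) then One else Two)"

text \<open>The default clause is meant for double negations; whatever else falls under it is basic
  and is not picked in a non-basic sequent.\<close>

fun unfold_rule :: "('p, 'a) efml \<Rightarrow> rname" where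
  "unfold_rule (Fm (And \<phi> \<psi>)) = RAnd"
| "unfold_rule (Fm (Neg (And \<phi> \<psi>))) = RNegAnd"
| "unfold_rule (Fm (Box \<alpha> \<phi>)) = RBox"
| "unfold_rule (Fm (Neg (Box \<alpha> \<phi>))) = RDia"
| "unfold_rule (NegLd \<alpha> \<xi>) = RLdDia"
| "unfold_rule _ = RNeg"

definition forced :: "('p, 'a) sequent \<Rightarrow> ('p, 'a) rule_app" where
  "forced S = (let i = active_side S; \<chi> = selected (component i S) in (unfold_rule \<chi>, i, \<chi>))"

text \<open>
  On non-basic sequents the prover has a single move, which depends on the loaded component only
  whenever the unloaded one is basic; so every tableau that follows the game is uniform.
\<close>

definition move :: "('p, 'a) rule_app \<Rightarrow> ('p, 'a) sequent \<Rightarrow> ('p, 'a) sequent list \<Rightarrow> bool" where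
  "move ra S Ss \<longleftrightarrow> rule_inst ra S Ss \<and> (\<not> basic (members S) \<longrightarrow> ra = forced S)"

lemma basic_Un [simp]: "basic (\<Gamma> \<union> \<Delta>) \<longleftrightarrow> basic \<Gamma> \<and> basic \<Delta>"
  by (auto simp: basic_def)

lemma basic_insert [simp]: "basic (insert \<chi> \<Delta>) \<longleftrightarrow> basic_fml \<chi> \<and> basic \<Delta>"
  by (auto simp: basic_def)

lemma selected: "\<not> basic \<Delta> \<Longrightarrow> selected \<Delta> \<in> \<Delta> \<and> \<not> basic_fml (selected \<Delta>)"
  unfolding basic_def selected_def by (rule someI_ex) blast

lemma active_side: "\<not> basic (members S) \<Longrightarrow> \<not> basic (component (active_side S) S)"
  by (auto simp: active_side_def)

lemma active_side_unloaded:
  assumes "loaded (component i S)" "free (component (other i) S)" "\<not> basic (component (other i) S)"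
  shows "active_side S = other i"
  using assms by (cases i) (auto simp: active_side_def)

lemma active_side_loaded:
  assumes "loaded (component i S)" "free (component (other i) S)" "basic (component (other i) S)"
  shows "active_side S = i"
  using assms by (cases i) (auto simp: active_side_def)

lemma local_unfold_rule: "local_rule (unfold_rule \<chi>)"
  unfolding local_rule_def by (cases \<chi> rule: unfold_rule.cases) auto

lemma unfold_rule_not_LMinus: "unfold_rule \<chi> \<noteq> RLMinus"
  by (cases \<chi> rule: unfold_rule.cases) auto

lemma unfold_rule_replacement:
  assumes "\<not> basic_fml \<chi>"
  shows "\<exists>\<Sigma>s. replacement (unfold_rule \<chi>) \<chi> \<Delta> \<Gamma> \<Sigma>s"
proof (cases \<chi>)
  case (NegLd \<alpha> \<xi>)
  then have "\<not> atomic \<alpha>" using assms by (auto simp: atomic_def intro: basic_fml.intros)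
  moreover obtain \<Sigma>s where "set \<Sigma>s = unfold_ld_dia \<alpha> \<xi>" "distinct \<Sigma>s"
    using finite_distinct_list[OF finite_unfold_ld_dia] by metis
  ultimately show ?thesis using NegLd replacement.ld_dia by fastforce
next
  case (Fm \<phi>)
  consider \<psi> where "\<phi> = Neg (Neg \<psi>)" | \<psi> \<psi>' where "\<phi> = And \<psi> \<psi>'" | \<psi> \<psi>' where "\<phi> = Neg (And \<psi> \<psi>')"
    | \<alpha> \<psi> where "\<phi> = Box \<alpha> \<psi>" "\<not> atomic \<alpha>" | \<alpha> \<psi> where "\<phi> = Neg (Box \<alpha> \<psi>)" "\<not> atomic \<alpha>"
  proof (cases \<phi>)
    case (Neg \<psi>)
    then show thesis using assms Fm that by (cases \<psi>) (auto simp: atomic_def intro: basic_fml.intros)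
  qed (use assms Fm that in \<open>auto simp: atomic_def intro: basic_fml.intros\<close>)
  then show ?thesis
  proof cases
    case (4 \<alpha> \<psi>)
    obtain \<Sigma>s where "set \<Sigma>s = unfold_box \<alpha> \<psi>" "distinct \<Sigma>s"
      using finite_distinct_list[OF finite_unfold_box] by metis
    then have "replacement RBox \<chi> \<Delta> \<Gamma> (map ((`) Fm) \<Sigma>s)" using Fm 4 replacement.box by simp
    then show ?thesis using 4 Fm by auto
  next
    case (5 \<alpha> \<psi>)
    obtain \<Sigma>s where "set \<Sigma>s = unfold_dia \<alpha> \<psi>" "distinct \<Sigma>s"
      using finite_distinct_list[OF finite_unfold_dia] by metis
    then have "replacement RDia \<chi> \<Delta> \<Gamma> (map ((`) Fm) \<Sigma>s)" using Fm 5 replacement.dia by simp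
    then show ?thesis using 5 Fm by auto
  qed (use Fm in \<open>auto intro: replacement.intros\<close>)
qed

lemma forced_move:
  assumes "\<not> basic (members S)"
  shows "\<exists>Ss. move (forced S) S Ss"
proof -
  define i where "i = active_side S"
  define \<chi> where "\<chi> = selected (component i S)"
  have \<chi>: "\<chi> \<in> component i S" "\<not> basic_fml \<chi>"
    using selected[OF active_side[OF assms]] unfolding \<chi>_def i_def by simp_all
  define \<Delta> where "\<Delta> = component i S - {\<chi>}"
  obtain \<Sigma>s where "replacement (unfold_rule \<chi>) \<chi> \<Delta> (component (other i) S) \<Sigma>s"
    using unfold_rule_replacement[OF \<chi>(2)] by fast
  moreover have "\<chi> \<notin> \<Delta>" "S = mk_sequent i (insert \<chi> \<Delta>) (component (other i) S)"
    using \<chi>(1) mk_sequent_component[of i S] unfolding \<Delta>_def by (simp_all add: insert_absorb)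
  ultimately have "\<exists>Ss. rule_inst (unfold_rule \<chi>, i, \<chi>) S Ss" using rule_inst.local by metis
  then show ?thesis unfolding move_def forced_def Let_def \<chi>_def i_def by blast
qed

lemma forcedE:
  assumes "move ra S Ss" "\<not> basic (members S)" "S' \<in> set Ss"
  obtains i \<chi> \<Delta> \<Gamma> \<Sigma>s \<Sigma> where "ra = (unfold_rule \<chi>, i, \<chi>)" "S = mk_sequent i (insert \<chi> \<Delta>) \<Gamma>" "\<chi> \<notin> \<Delta>" "\<not> basic_fml \<chi>"
    "replacement (unfold_rule \<chi>) \<chi> \<Delta> \<Gamma> \<Sigma>s" "\<Sigma> \<in> set \<Sigma>s" "S' = mk_sequent i (\<Delta> \<union> \<Sigma>) \<Gamma>"
proof -
  define i where "i = active_side S"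
  define \<chi> where "\<chi> = selected (component i S)"
  have nb: "\<not> basic_fml \<chi>"
    using selected[OF active_side[OF assms(2)]] unfolding \<chi>_def i_def by simp
  have ra: "ra = (unfold_rule \<chi>, i, \<chi>)"
    using assms(1,2) unfolding move_def forced_def Let_def \<chi>_def i_def by simp
  have "rule_inst (unfold_rule \<chi>, i, \<chi>) S Ss" using assms(1) ra unfolding move_def by simp
  then show thesis
  proof (cases rule: rule_inst.cases)
    case (local \<Delta> \<Gamma> \<Sigma>s)
    then obtain \<Sigma> where "\<Sigma> \<in> set \<Sigma>s" "S' = mk_sequent i (\<Delta> \<union> \<Sigma>) \<Gamma>" using assms(3) by auto
    then show thesis using that[OF ra local(1,3) nb local(4)] by simp
  next
    case modal
    then show thesis using nb by (auto intro: basic_fml.intros)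
  qed
qed

text \<open>An instance without children would turn its node into a leaf that need be neither closed
  nor a repeat. The game needs this to identify leaves with the points where play stops.\<close>

lemma replacement_nonempty: "replacement r \<chi> \<Delta> \<Gamma> \<Sigma>s \<Longrightarrow> \<Sigma>s \<noteq> []"
proof (induct rule: replacement.induct)
  case (box \<alpha> \<Sigma>s \<phi> \<Delta> \<Gamma>)
  have "unfold_box \<alpha> \<phi> \<noteq> {}" unfolding unfold_box_def by blast
  then show ?case using box(3) by (cases \<Sigma>s) simp_all
next
  case (dia \<alpha> \<Sigma>s \<phi> \<Delta> \<Gamma>)
  obtain X \<delta> where "(X, \<delta>) \<in> Hset \<alpha>" using Hset_nonempty[of \<alpha>] by auto
  then have "X \<union> {Neg (boxes \<delta> \<phi>)} \<in> unfold_dia \<alpha> \<phi>" unfolding unfold_dia_def by blast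
  then show ?case using dia(3) by (cases \<Sigma>s) simp_all
next
  case (ld_dia \<alpha> \<Sigma>s \<xi> \<Delta> \<Gamma>)
  obtain X \<delta> where "(X, \<delta>) \<in> Hset \<alpha>" using Hset_nonempty[of \<alpha>] by auto
  then have "Fm ` X \<union> {neg_xi (ld_boxes \<delta> \<xi>)} \<in> unfold_ld_dia \<alpha> \<xi>" unfolding unfold_ld_dia_def by blast
  then show ?case using ld_dia(3) by (cases \<Sigma>s) simp_all
qed simp_all

lemma rule_inst_nonempty: "rule_inst ra S Ss \<Longrightarrow> Ss \<noteq> []"
  by (induct rule: rule_inst.induct) (auto dest: replacement_nonempty)

text \<open>The context of (L+) is free, so the formula just marked is the only one to which (L-)
  can apply, and unmarking it gives the parent back.\<close>

lemma LPlus_LMinus: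
  assumes "rule_inst (RLPlus, i, \<chi>) S Ss" "S' \<in> set Ss" "rule_inst (RLMinus, i, \<chi>') S' Ss'"
  shows "S \<in> set Ss'" "free (members S)"
proof -
  from assms(1) obtain \<Delta> \<Gamma> \<Sigma>s where S: "S = mk_sequent i (insert \<chi> \<Delta>) \<Gamma>"
    and Ss: "Ss = map (\<lambda>\<Sigma>. mk_sequent i (\<Delta> \<union> \<Sigma>) \<Gamma>) \<Sigma>s" and r: "replacement RLPlus \<chi> \<Delta> \<Gamma> \<Sigma>s"
    by cases auto
  from r obtain a \<alpha>s \<phi> where fr: "free \<Delta>" "free \<Gamma>" and \<chi>: "\<chi> = Fm (Neg (Box (Atom a) (boxes \<alpha>s \<phi>)))"
    and \<Sigma>s: "\<Sigma>s = [{NegLd (Atom a) (ld_boxes \<alpha>s (Unl \<phi>))}]"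
    by cases auto
  define \<psi> where "\<psi> = NegLd (Atom a) (ld_boxes \<alpha>s (Unl \<phi>))"
  have S': "S' = mk_sequent i (insert \<psi> \<Delta>) \<Gamma>" using assms(2) Ss \<Sigma>s unfolding \<psi>_def by simp
  from assms(3) obtain \<Delta>' \<Gamma>' \<Sigma>s' where T: "S' = mk_sequent i (insert \<chi>' \<Delta>') \<Gamma>'" "\<chi>' \<notin> \<Delta>'"
    and Ss': "Ss' = map (\<lambda>\<Sigma>. mk_sequent i (\<Delta>' \<union> \<Sigma>) \<Gamma>') \<Sigma>s'" and r': "replacement RLMinus \<chi>' \<Delta>' \<Gamma>' \<Sigma>s'"
    by cases auto
  from r' obtain \<beta> \<beta>s \<phi>' where \<chi>': "\<chi>' = NegLd \<beta> (ld_boxes \<beta>s (Unl \<phi>'))"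
    and \<Sigma>s': "\<Sigma>s' = [{Fm (unload \<chi>')}]"
    by cases auto
  have comp: "insert \<psi> \<Delta> = insert \<chi>' \<Delta>'" "\<Gamma> = \<Gamma>'" using S' T(1) by (cases i; simp)+
  have "\<psi> \<notin> \<Delta>" "\<chi>' \<notin> \<Delta>" using fr(1) unfolding loaded_def \<psi>_def \<chi>' by blast+
  moreover have "\<chi>' \<in> insert \<psi> \<Delta>" unfolding comp(1) by simp
  ultimately have "\<chi>' = \<psi>" by simp
  then have "\<Delta>' = \<Delta>" using comp(1) T(2) \<open>\<psi> \<notin> \<Delta>\<close> by (simp add: insert_ident)
  have "Fm (unload \<psi>) = \<chi>" unfolding \<psi>_def \<chi> by simp
  then show "S \<in> set Ss'" using S Ss' \<Sigma>s' comp(2) \<open>\<chi>' = \<psi>\<close> \<open>\<Delta>' = \<Delta>\<close> by simp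
  show "free (members S)" using S fr \<chi> by simp
qed

text \<open>With \<open>X\<close> the sequents already conceded to the prover, the least fixed point
  says: whatever the prover plays, after finitely many loaded sequents the play reaches a free one
  outside \<open>X\<close> or a sequent at which the prover has no move, and no label met before is
  closed.\<close>

inductive builder :: "('p, 'a) sequent set \<Rightarrow> ('p, 'a) sequent \<Rightarrow> bool" for X where
  "\<not> closed_label S \<Longrightarrow>
   (\<And>ra Ss. move ra S Ss \<Longrightarrow>
      \<exists>S'\<in>set Ss. loaded (members S') \<and> builder X S' \<or> free (members S') \<and> S' \<notin> X) \<Longrightarrow>
   builder X S"

text \<open>Complementing a least fixed point, at stage \<open>Suc n\<close> the prover can force
  the play to close, to stay loaded forever, or to enter a free sequent of stage \<open>n\<close>.
  Iterating this gives the nested fixed point of a co-Buechi game.\<close>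

primrec prover :: "('p, 'a) sequent set \<Rightarrow> nat \<Rightarrow> ('p, 'a) sequent set" where
  "prover U 0 = {}"
| "prover U (Suc n) = {S \<in> U. \<not> builder (prover U n) S}"

lemma builder_antimono: "builder Y S \<Longrightarrow> X \<subseteq> Y \<Longrightarrow> builder X S"
proof (induct rule: builder.induct)
  case (1 S)
  show ?case
  proof (rule builder.intros[OF 1(1)])
    fix ra Ss assume "move ra S Ss"
    from 1(2)[OF this] 1(3)
    show "\<exists>S'\<in>set Ss. loaded (members S') \<and> builder X S' \<or> free (members S') \<and> S' \<notin> X" by blast
  qed
qed

lemma prover_Suc: "prover U n \<subseteq> prover U (Suc n)"
proof (induct n)
  case (Suc n)
  then show ?case using builder_antimono by fastforce
qed simp

lemma prover_subset: "prover U n \<subseteq> U"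
  by (cases n) auto

lemma prover_stable:
  assumes "finite U"
  shows "\<exists>n. prover U (Suc n) = prover U n"
proof (rule ccontr)
  assume "\<not> ?thesis"
  then have strict: "prover U n \<subset> prover U (Suc n)" for n
    unfolding psubset_eq using prover_Suc[of U n] by metis
  have "n \<le> card (prover U n)" for n
  proof (induct n)
    case (Suc n)
    have "card (prover U n) < card (prover U (Suc n))"
      by (rule psubset_card_mono[OF finite_subset[OF prover_subset assms] strict])
    then show ?case using Suc by linarith
  qed simp
  from this[of "Suc (card U)"] show False
    using card_mono[OF assms prover_subset, of "Suc (card U)"] by linarith
qed

definition prover_rank :: "('p, 'a) sequent set \<Rightarrow> ('p, 'a) sequent \<Rightarrow> nat" where
  "prover_rank U S = (LEAST n. S \<in> prover U n)"

lemma prover_rank_le: "S \<in> prover U n \<Longrightarrow> prover_rank U S \<le> n"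
  unfolding prover_rank_def by (rule Least_le)

text \<open>At the least stage \<open>Suc m\<close> containing \<open>S\<close>, failure of
  \<open>builder (prover U m)\<close> provides one move whose loaded children fail it too and so
  stay in this stage, while its free children lie in stage \<open>m\<close>. The move depends on
  \<open>S\<close> alone.\<close>

lemma prover_move:
  assumes U: "\<And>ra S Ss S'. S \<in> U \<Longrightarrow> rule_inst ra S Ss \<Longrightarrow> S' \<in> set Ss \<Longrightarrow> S' \<in> U"
    and S: "S \<in> prover U n" "\<not> closed_label S"
  shows "\<exists>ra Ss. move ra S Ss \<and> (\<forall>S'\<in>set Ss. (\<exists>n. S' \<in> prover U n) \<and>
    prover_rank U S' \<le> prover_rank U S \<and> (free (members S') \<longrightarrow> prover_rank U S' < prover_rank U S))"
proof -
  have in_rank: "S \<in> prover U (prover_rank U S)"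
    unfolding prover_rank_def using S(1) by (rule LeastI)
  then obtain m where m: "prover_rank U S = Suc m" by (cases "prover_rank U S") auto
  then have "S \<in> U" and nb: "\<not> builder (prover U m) S" using in_rank by auto
  from nb S(2) obtain ra Ss where mv: "move ra S Ss" and
    all: "\<And>S'. S' \<in> set Ss \<Longrightarrow>
      (loaded (members S') \<longrightarrow> \<not> builder (prover U m) S') \<and> (free (members S') \<longrightarrow> S' \<in> prover U m)"
    using builder.intros[of S "prover U m"] by blast
  have "(\<exists>n. S' \<in> prover U n) \<and> prover_rank U S' \<le> prover_rank U S \<and>
      (free (members S') \<longrightarrow> prover_rank U S' < prover_rank U S)" if S': "S' \<in> set Ss" for S'
  proof (cases "loaded (members S')")
    case True
    have "S' \<in> U" using U[OF \<open>S \<in> U\<close> _ S'] mv unfolding move_def by blast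
    then have "S' \<in> prover U (Suc m)" using all[OF S'] True by auto
    then show ?thesis using prover_rank_le m True by fastforce
  next
    case False
    then have "S' \<in> prover U m" using all[OF S'] by simp
    then show ?thesis using prover_rank_le m by fastforce
  qed
  then show ?thesis using mv by blast
qed

section \<open>Unravelling a winning strategy of the prover\<close>

text \<open>It suffices to stop at closed labels and loaded-path repeats: entering a free sequent
  lowers the rank and no step raises it, so a free label never occurs twice on a branch.\<close>

lemma strategy_tableau:
  fixes W :: "('p, 'a) sequent set" and rank :: "('p, 'a) sequent \<Rightarrow> nat"
  assumes root: "S0 \<in> W"
    and fin: "\<And>S. S \<in> W \<Longrightarrow> finite (members S)"
    and mv: "\<And>S. S \<in> W \<Longrightarrow> \<not> closed_label S \<Longrightarrow> move (app S) S (kids S)"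
    and kids: "\<And>S S'. S \<in> W \<Longrightarrow> \<not> closed_label S \<Longrightarrow> S' \<in> set (kids S) \<Longrightarrow>
      S' \<in> W \<and> rank S' \<le> rank S \<and> (free (members S') \<longrightarrow> rank S' < rank S)"
  shows "\<exists>T. split_pdl_tableau T \<and> closed_tableau T \<and> uniform T \<and> label T [] = S0"
proof -
  define lab where "lab = foldl (\<lambda>S k. kids S ! k) S0"
  have lab_simps: "lab [] = S0" "lab (s @ [k]) = kids (lab s) ! k" for s k
    unfolding lab_def by simp_all
  \<comment> \<open>This restates \<open>loaded_path_repeat\<close> by labels of addresses alone,
    since the node set is about to be defined from it.\<close>
  define lpr where "lpr s \<longleftrightarrow> (\<exists>c. strict_prefix c s \<and> lab c = lab s \<and>
     (\<forall>t. strict_prefix c t \<and> strict_prefix t s \<longrightarrow> lab t \<noteq> lab s) \<and>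
     (\<forall>t. prefix c t \<and> prefix t s \<longrightarrow> loaded (members (lab t))))" for s
  \<comment> \<open>\<open>lab\<close> is defined on all addresses, with arbitrary values beyond the
    number of children; \<open>N\<close> keeps those whose proper prefixes all continue the
    play.\<close>
  define N where "N = {s. \<forall>t k. prefix (t @ [k]) s \<longrightarrow>
     \<not> closed_label (lab t) \<and> \<not> lpr t \<and> k < length (kids (lab t))}"
  have N_Nil: "[] \<in> N" unfolding N_def by simp
  have N_snoc: "s @ [k] \<in> N \<longleftrightarrow> s \<in> N \<and> \<not> closed_label (lab s) \<and> \<not> lpr s \<and> k < length (kids (lab s))" for s k
    unfolding N_def by (auto simp: prefix_snoc)
  define T where "T = \<lparr>nodes = N, label = lab, applied = \<lambda>s. app (lab s)\<rparr>"
  have T: "nodes T = N" "label T = lab" "applied T s = app (lab s)" for s unfolding T_def by simp_all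
  have labW: "s \<in> N \<Longrightarrow> lab s \<in> W" for s
  proof (induct s rule: rev_induct)
    case Nil
    then show ?case using root lab_simps by simp
  next
    case (snoc k s)
    then have "lab s \<in> W" "\<not> closed_label (lab s)" "kids (lab s) ! k \<in> set (kids (lab s))"
      using N_snoc by auto
    then show ?case using kids lab_simps(2) by metis
  qed
  have inter: "s \<in> N \<and> \<not> closed_label (lab s) \<and> \<not> lpr s" if "interior T s" for s
    using that N_snoc unfolding interior_def T by blast
  have imove: "move (app (lab s)) (lab s) (kids (lab s))" if "interior T s" for s
    using inter[OF that] mv labW by blast
  have rank: "rank (lab s) \<le> rank (lab t) \<and> (t \<noteq> s \<and> free (members (lab s)) \<longrightarrow> rank (lab s) < rank (lab t))"
    if "s \<in> N" "prefix t s" for s t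
    using that
  proof (induct s rule: rev_induct)
    case (snoc k s)
    show ?case
    proof (cases "t = s @ [k]")
      case False
      then have pre: "prefix t s" using snoc(3) by (simp add: prefix_snoc)
      have s: "s \<in> N" "\<not> closed_label (lab s)" "k < length (kids (lab s))" using snoc(2) N_snoc by auto
      have "rank (lab s) \<le> rank (lab t)" using snoc(1)[OF s(1) pre] by simp
      moreover have "rank (lab (s @ [k])) \<le> rank (lab s) \<and>
          (free (members (lab (s @ [k]))) \<longrightarrow> rank (lab (s @ [k])) < rank (lab s))"
        using kids[OF labW[OF s(1)] s(2), of "lab (s @ [k])"] s(3) lab_simps(2) by simp
      ultimately show ?thesis by linarith
    qed simp
  qed simp
  have no_free_repeat: "\<not> free_repeat T s" for s
  proof
    assume "free_repeat T s"
    then obtain t where "s \<in> N" "strict_prefix t s" "lab t = lab s" "free (members (lab s))"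
      unfolding free_repeat_def repeat_def loaded_node_def T by auto
    then show False using rank[of s t] by (simp add: strict_prefix_def)
  qed
  have lpr: "loaded_path_repeat T s \<longleftrightarrow> s \<in> N \<and> lpr s" for s
    unfolding loaded_path_repeat_def repeat_def companion_def loaded_node_def T lpr_def by auto
  have "split_tableau T"
    unfolding split_tableau_def
  proof (intro conjI ballI allI impI)
    show "[] \<in> nodes T" using N_Nil T by simp
    show "s \<in> nodes T" if "s @ [k] \<in> nodes T" for s k using that N_snoc T by simp
    show "split_sequent (label T s)" if "s \<in> nodes T" for s
      using fin[OF labW] that unfolding T split_sequent_def by simp
    show "\<exists>Ss. rule_inst (applied T s) (label T s) Ss \<and> (\<forall>k. (s @ [k] \<in> nodes T) = (k < length Ss)) \<and>
        (\<forall>k<length Ss. label T (s @ [k]) = Ss ! k)" if "interior T s" for s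
      using imove[OF that] inter[OF that] N_snoc lab_simps(2) unfolding move_def T by blast
    show "applied T (s @ [k]) \<noteq> (RLMinus, i, \<chi>')"
      if "interior T (s @ [k]) \<and> applied T s = (RLPlus, i, \<chi>)" for s k i \<chi> \<chi>'
    proof
      assume min: "applied T (s @ [k]) = (RLMinus, i, \<chi>')"
      have N': "s @ [k] \<in> N" using that inter by blast
      then have s: "s \<in> N" "\<not> closed_label (lab s)" "k < length (kids (lab s))" using N_snoc by auto
      have lm: "rule_inst (RLMinus, i, \<chi>') (lab (s @ [k])) (kids (lab (s @ [k])))"
        using imove[of "s @ [k]"] that min unfolding T move_def by simp
      have lp: "rule_inst (RLPlus, i, \<chi>) (lab s) (kids (lab s))"
        using mv[OF labW[OF s(1)] s(2)] that unfolding T move_def by simp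
      have in_kids: "lab (s @ [k]) \<in> set (kids (lab s))" using s(3) lab_simps(2) by simp
      \<comment> \<open>If (L-) followed, it would re-enter the free sequent at \<open>s\<close>,
        whose rank would then be below that of its own child.\<close>
      note undo = LPlus_LMinus[OF lp in_kids lm]
      have "rank (lab s) < rank (lab (s @ [k]))"
        using kids[OF labW[OF N'] _ undo(1)] inter[of "s @ [k]"] that undo(2) by simp
      moreover have "rank (lab (s @ [k])) \<le> rank (lab s)"
        using kids[OF labW[OF s(1)] s(2) in_kids] by simp
      ultimately show False by simp
    qed
  qed
  moreover have "leaf T s" if "loaded_path_repeat T s" for s
    using that lpr N_snoc unfolding leaf_def T by simp
  ultimately have "split_pdl_tableau T" unfolding split_pdl_tableau_def using no_free_repeat by simp
  moreover have "closed_tableau T"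
    unfolding closed_tableau_def
  proof (intro allI impI)
    fix s assume lf: "leaf T s"
    then have s: "s \<in> N" "s @ [0] \<notin> N" unfolding leaf_def T by simp_all
    show "loaded_path_repeat T s \<or> closed_label (label T s)"
    proof (rule ccontr)
      assume a: "\<not> ?thesis"
      then have nc: "\<not> closed_label (lab s)" unfolding T by simp
      then have "kids (lab s) \<noteq> []"
        using mv[OF labW[OF s(1)] nc] rule_inst_nonempty unfolding move_def by blast
      then show False using a s N_snoc lpr nc by simp
    qed
  qed
  moreover have "uniform1 T"
    unfolding uniform1_def
  proof (intro allI impI, elim conjE)
    fix s i assume "interior T s" and l: "loaded (component i (label T s))"
      "free (component (other i) (label T s))" "\<not> basic (component (other i) (label T s))"
    from imove[OF this(1)] have "app (lab s) = forced (lab s)"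
      using l(3) members_eq[of "lab s" i] unfolding move_def T by auto
    moreover have "active_side (lab s) = other i" using active_side_unloaded l unfolding T by blast
    ultimately show "\<exists>r \<chi>. local_rule r \<and> applied T s = (r, other i, \<chi>)"
      unfolding T forced_def Let_def using local_unfold_rule by auto
  qed
  moreover have "uniform2 T"
    unfolding uniform2_def
  proof (intro allI impI, elim conjE)
    fix s t i assume st: "interior T s" "interior T t"
      and l: "component i (label T s) = component i (label T t)"
        "loaded (component i (label T s))" "\<not> basic (component i (label T s))"
        "free (component (other i) (label T s))" "basic (component (other i) (label T s))"
        "free (component (other i) (label T t))" "basic (component (other i) (label T t))"
    have "app (lab s) = forced (lab s)" "app (lab t) = forced (lab t)"
      using imove[OF st(1)] imove[OF st(2)] l(1,3) members_eq[of "lab s" i] members_eq[of "lab t" i]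
      unfolding move_def T by auto
    moreover have "active_side (lab s) = i" "active_side (lab t) = i"
      using active_side_loaded[of i "lab s"] active_side_loaded[of i "lab t"] l unfolding T by simp_all
    ultimately show "\<exists>r \<chi>. applied T s = (r, i, \<chi>) \<and> applied T t = (r, i, \<chi>)"
      using l(1) unfolding T forced_def Let_def by simp
  qed
  moreover have "label T [] = S0" using T lab_simps by simp
  ultimately show ?thesis unfolding uniform_def by blast
qed

lemma prover_tableau:
  assumes C: "finite C" "fl_closed C" and S: "S \<in> prover (sequents_over C) n"
  shows "\<exists>T. split_pdl_tableau T \<and> closed_tableau T \<and> uniform T \<and> label T [] = S"
proof -
  let ?U = "sequents_over C"
  let ?W = "\<Union>n. prover ?U n"
  let ?P = "\<lambda>S p. move (fst p) S (snd p) \<and> (\<forall>S'\<in>set (snd p). S' \<in> ?W \<and>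
    prover_rank ?U S' \<le> prover_rank ?U S \<and> (free (members S') \<longrightarrow> prover_rank ?U S' < prover_rank ?U S))"
  have "\<exists>p. ?P S p" if W: "S \<in> ?W" "\<not> closed_label S" for S
  proof -
    obtain n where "S \<in> prover ?U n" using W(1) by blast
    then have "\<exists>ra Ss. move ra S Ss \<and> (\<forall>S'\<in>set Ss. (\<exists>n. S' \<in> prover ?U n) \<and>
      prover_rank ?U S' \<le> prover_rank ?U S \<and> (free (members S') \<longrightarrow> prover_rank ?U S' < prover_rank ?U S))"
      using W(2) by (rule prover_move[rotated]) (rule sequents_over_rule_inst[OF C(2)])
    then obtain ra Ss where "move ra S Ss \<and> (\<forall>S'\<in>set Ss. (\<exists>n. S' \<in> prover ?U n) \<and>
      prover_rank ?U S' \<le> prover_rank ?U S \<and> (free (members S') \<longrightarrow> prover_rank ?U S' < prover_rank ?U S))"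
      by iprover
    then show ?thesis by (intro exI[of _ "(ra, Ss)"]) auto
  qed
  then obtain strat where strat: "\<And>S. S \<in> ?W \<Longrightarrow> \<not> closed_label S \<Longrightarrow> ?P S (strat S)" by metis
  show ?thesis
  proof (rule strategy_tableau[where W = ?W and rank = "prover_rank ?U"
        and app = "\<lambda>S. fst (strat S)" and kids = "\<lambda>S. snd (strat S)"])
    show "S \<in> ?W" using S by blast
    show "finite (members S)" if "S \<in> ?W" for S
      using that prover_subset sequents_over_finite[OF C(1)] by blast
  qed (use strat in blast)+
qed

section \<open>The model of the builder\<close>

lemma unload_eqD:
  "unload \<chi> = Prop p \<Longrightarrow> \<chi> = Fm (Prop p)"
  "unload \<chi> = Bot \<Longrightarrow> \<chi> = Fm Bot"
  "unload \<chi> = Neg (Prop p) \<Longrightarrow> \<chi> = Fm (Neg (Prop p))"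
  "unload \<chi> = Box \<alpha> \<phi> \<Longrightarrow> \<chi> = Fm (Box \<alpha> \<phi>)"
  "unload \<chi> = And \<phi> \<psi> \<Longrightarrow> \<chi> = Fm (And \<phi> \<psi>)"
  "unload \<chi> = Neg (Neg \<phi>) \<Longrightarrow> \<chi> = Fm (Neg (Neg \<phi>))"
  "unload \<chi> = Neg (And \<phi> \<psi>) \<Longrightarrow> \<chi> = Fm (Neg (And \<phi> \<psi>))"
  by (cases \<chi>; simp)+

inductive_simps basic_fml_simps [simp]:
  "basic_fml (Fm (Neg (Neg \<phi>)))" "basic_fml (Fm (And \<phi> \<psi>))" "basic_fml (Fm (Neg (And \<phi> \<psi>)))"
  "basic_fml (Fm (Box \<alpha> \<phi>))" "basic_fml (Fm (Neg (Box \<alpha> \<phi>)))" "basic_fml (NegLd \<alpha> \<xi>)"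
  "basic_fml (Fm Bot)" "basic_fml (Fm (Prop p))" "basic_fml (Fm (Neg (Prop p)))"

text \<open>Provides the maximal block of leading boxes that (L+) has to mark.\<close>

lemma box_decomposition: "\<exists>\<beta>s \<psi>. \<phi> = boxes \<beta>s \<psi> \<and> (\<forall>\<beta> \<psi>'. \<psi> \<noteq> Box \<beta> \<psi>')"
proof (induct \<phi> rule: measure_induct_rule[of size])
  case (less \<phi>)
  show ?case
  proof (cases "\<exists>\<beta> \<psi>. \<phi> = Box \<beta> \<psi>")
    case True
    then obtain \<beta> \<psi> where \<phi>: "\<phi> = Box \<beta> \<psi>" by iprover
    then obtain \<beta>s \<psi>' where "\<psi> = boxes \<beta>s \<psi>'" "\<forall>\<beta> \<psi>. \<psi>' \<noteq> Box \<beta> \<psi>"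
      using less[of \<psi>] by auto
    then show ?thesis using \<phi> by (intro exI[of _ "\<beta> # \<beta>s"] exI[of _ \<psi>']) simp
  next
    case False
    then show ?thesis by (intro exI[of _ "[]"] exI[of _ \<phi>]) simp
  qed
qed

lemma component_split:
  assumes "\<chi> \<in> members S"
  obtains i \<Delta> \<Gamma> where "S = mk_sequent i (insert \<chi> \<Delta>) \<Gamma>" "\<chi> \<notin> \<Delta>"
proof -
  obtain i where i: "\<chi> \<in> component i S" using members_component[OF assms] by blast
  show thesis
  proof (rule that)
    show "S = mk_sequent i (insert \<chi> (component i S - {\<chi>})) (component (other i) S)"
      using i mk_sequent_component[of i S] by (simp add: insert_absorb)
  qed simp
qed

text \<open>The equation holds at a stage where the iteration \<open>prover\<close> is stable. It
  turns the mere absence of a free child from \<open>X\<close> into \<open>builder X\<close>, so the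
  builder can go on round after round.\<close>

locale unrefuted =
  fixes C :: "('p, 'a) fml set" and X :: "('p, 'a) sequent set"
  assumes finite_C: "finite C" and closed_C: "fl_closed C"
    and X: "X = {S \<in> sequents_over C. \<not> builder X S}"
begin

definition B :: "('p, 'a) sequent set" where
  "B = sequents_over C - X"

lemma B_iff: "S \<in> B \<longleftrightarrow> S \<in> sequents_over C \<and> builder X S"
  unfolding B_def using X by auto

lemma B_finite: "S \<in> B \<Longrightarrow> finite (members S)"
  using sequents_over_finite[OF finite_C] unfolding B_iff by simp

lemma B_single: "S \<in> B \<Longrightarrow> single_load S"
  unfolding B_iff sequents_over_def by simp

lemma B_not_closed: "S \<in> B \<Longrightarrow> \<not> closed_label S"
  unfolding B_iff by (auto elim: builder.cases)

lemma B_child: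
  assumes S: "S \<in> sequents_over C" "move ra S Ss" "S' \<in> set Ss"
    and "loaded (members S') \<and> builder X S' \<or> free (members S') \<and> S' \<notin> X"
  shows "S' \<in> B"
proof -
  have "S' \<in> sequents_over C"
    using sequents_over_rule_inst[OF closed_C S(1) _ S(3)] S(2) unfolding move_def by iprover
  then show ?thesis using assms(4) unfolding B_iff B_def[symmetric] using X by auto
qed

lemma B_move:
  assumes "S \<in> B" "move ra S Ss"
  obtains S' where "S' \<in> set Ss" "S' \<in> B"
proof -
  have S: "S \<in> sequents_over C" "builder X S" using assms(1) unfolding B_iff by simp_all
  from S(2) assms(2) have "\<exists>S'\<in>set Ss. loaded (members S') \<and> builder X S' \<or> free (members S') \<and> S' \<notin> X"
    by cases simp
  then show thesis using that B_child[OF S(1) assms(2)] by blast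
qed

inductive step :: "('p, 'a) sequent \<Rightarrow> ('p, 'a) sequent \<Rightarrow> bool" where
  "S \<in> B \<Longrightarrow> \<not> basic (members S) \<Longrightarrow> move ra S Ss \<Longrightarrow> S' \<in> set Ss \<Longrightarrow> S' \<in> B \<Longrightarrow> step S S'"

definition W :: "('p, 'a) sequent set" where
  "W = {S \<in> B. basic (members S)}"

text \<open>
  A world is a basic sequent; it stands for all sequents from which the builder reaches it by
  local moves. Basic formulas survive local moves, so these sequents agree on what they say about
  propositions and successors.
\<close>

definition forms :: "('p, 'a) sequent \<Rightarrow> ('p, 'a) fml set" where
  "forms e = {unload \<chi> | \<chi> S. step\<^sup>*\<^sup>* S e \<and> \<chi> \<in> members S}"

lemma stepE:
  assumes "step S S'"
  obtains i \<chi> \<Delta> \<Gamma> \<Sigma>s \<Sigma> where "S = mk_sequent i (insert \<chi> \<Delta>) \<Gamma>" "\<not> basic_fml \<chi>"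
    "replacement (unfold_rule \<chi>) \<chi> \<Delta> \<Gamma> \<Sigma>s" "\<Sigma> \<in> set \<Sigma>s" "S' = mk_sequent i (\<Delta> \<union> \<Sigma>) \<Gamma>"
  using assms
proof cases
  case (1 ra Ss)
  show thesis
  proof (rule forcedE[OF 1(3,2,4)])
    fix i \<chi> \<Delta> \<Gamma> \<Sigma>s \<Sigma>
    assume "S = mk_sequent i (insert \<chi> \<Delta>) \<Gamma>" "\<not> basic_fml \<chi>"
      "replacement (unfold_rule \<chi>) \<chi> \<Delta> \<Gamma> \<Sigma>s" "\<Sigma> \<in> set \<Sigma>s" "S' = mk_sequent i (\<Delta> \<union> \<Sigma>) \<Gamma>"
    then show thesis by (rule that)
  qed
qed

lemma step_weight: "step S S' \<Longrightarrow> (weight S', weight S) \<in> mult less_than"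
proof (induct rule: step.induct)
  case (1 S ra Ss S')
  show ?case
  proof (rule forcedE[OF 1(3,2,4)])
    fix i \<chi>
    assume ra: "ra = (unfold_rule \<chi>, i, \<chi>)" "\<not> basic_fml \<chi>"
    have "rule_inst (unfold_rule \<chi>, i, \<chi>) S Ss" using 1(3) unfolding move_def ra(1) by iprover
    from rule_inst_weight[OF this 1(4) ra(2) unfold_rule_not_LMinus B_finite[OF 1(1)] B_finite[OF 1(5)]]
    show ?thesis .
  qed
qed

lemma reach_world: "S \<in> B \<Longrightarrow> \<exists>e\<in>W. step\<^sup>*\<^sup>* S e"
proof (induct "weight S" arbitrary: S rule: wf_induct_rule[OF wf_mult[OF wf_less_than]])
  case (1 S)
  show ?case
  proof (cases "basic (members S)")
    case True
    then show ?thesis using 1(2) by (intro bexI[of _ S]) (simp_all add: W_def)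
  next
    case False
    obtain Ss where mv: "move (forced S) S Ss" using forced_move[OF False] by blast
    obtain S' where S': "S' \<in> set Ss" "S' \<in> B" using B_move[OF 1(2) mv] by blast
    have st: "step S S'" using step.intros[OF 1(2) False mv S'] .
    obtain e where "e \<in> W" "step\<^sup>*\<^sup>* S' e" using 1(1)[OF step_weight[OF st] S'(2)] by blast
    then show ?thesis using converse_rtranclp_into_rtranclp[of step, OF st] by blast
  qed
qed

lemma W_I: "S \<in> B \<Longrightarrow> basic (members S) \<Longrightarrow> S \<in> W"
  unfolding W_def by (rule CollectI, rule conjI)

lemma W_B: "e \<in> W \<Longrightarrow> e \<in> B" and W_basic: "e \<in> W \<Longrightarrow> basic (members e)"
  unfolding W_def by simp_all

lemma W_step: "e \<in> W \<Longrightarrow> step\<^sup>*\<^sup>* e e' \<Longrightarrow> e' = e"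
  by (erule converse_rtranclpE) (auto simp: W_def elim: step.cases)

lemma formsI: "step\<^sup>*\<^sup>* S e \<Longrightarrow> \<chi> \<in> members S \<Longrightarrow> unload \<chi> \<in> forms e"
  unfolding forms_def by blast

lemma forms_self: "\<chi> \<in> members e \<Longrightarrow> unload \<chi> \<in> forms e"
  by (rule formsI) simp_all

lemma step_basic:
  assumes "step S S'" "\<chi> \<in> members S" "basic_fml \<chi>"
  shows "\<chi> \<in> members S'"
  using assms(1)
proof (rule stepE)
  fix i \<chi>' \<Delta> \<Gamma> \<Sigma> assume "S = mk_sequent i (insert \<chi>' \<Delta>) \<Gamma>" "\<not> basic_fml \<chi>'" "S' = mk_sequent i (\<Delta> \<union> \<Sigma>) \<Gamma>"
  then show ?thesis using assms(2,3) by auto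
qed

lemma reach_basic: "step\<^sup>*\<^sup>* S e \<Longrightarrow> \<chi> \<in> members S \<Longrightarrow> basic_fml \<chi> \<Longrightarrow> \<chi> \<in> members e"
  by (induct rule: converse_rtranclp_induct) (auto dest: step_basic)

text \<open>The world is basic and local moves leave all but the principal formula in place, so a
  non-basic formula must be principal somewhere on the way. Its replacement then belongs to a
  sequent that reaches the same world.\<close>

lemma forms_unfold:
  assumes "step\<^sup>*\<^sup>* S e" "e \<in> W" "\<chi> \<in> members S" "\<not> basic_fml \<chi>"
  shows "\<exists>\<Delta> \<Gamma> \<Sigma>s. \<exists>\<Sigma>\<in>set \<Sigma>s. replacement (unfold_rule \<chi>) \<chi> \<Delta> \<Gamma> \<Sigma>s \<and> unload ` \<Sigma> \<subseteq> forms e"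
  using assms(1,3)
proof (induct rule: converse_rtranclp_induct)
  case base
  then show ?case using W_basic[OF assms(2)] assms(4) unfolding basic_def by blast
next
  case (step S S')
  from step(1) show ?case
  proof (rule stepE)
    fix i \<chi>' \<Delta> \<Gamma> \<Sigma>s \<Sigma> assume S: "S = mk_sequent i (insert \<chi>' \<Delta>) \<Gamma>" "S' = mk_sequent i (\<Delta> \<union> \<Sigma>) \<Gamma>"
      and r: "replacement (unfold_rule \<chi>') \<chi>' \<Delta> \<Gamma> \<Sigma>s" "\<Sigma> \<in> set \<Sigma>s"
    show ?case
    proof (cases "\<chi> = \<chi>'")
      case True
      have "unload ` \<Sigma> \<subseteq> forms e"
      proof
        fix \<psi> assume "\<psi> \<in> unload ` \<Sigma>"
        then obtain \<chi>'' where "\<psi> = unload \<chi>''" "\<chi>'' \<in> \<Sigma>" by blast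
        then show "\<psi> \<in> forms e" using formsI[OF step(2)] S(2) by simp
      qed
      then show ?thesis using r True by blast
    next
      case False
      then have "\<chi> \<in> members S'" using step(4) S by auto
      then show ?thesis by (rule step(3))
    qed
  qed
qed

lemma formsE:
  assumes "\<phi> \<in> forms e"
  obtains \<chi> S where "\<phi> = unload \<chi>" "step\<^sup>*\<^sup>* S e" "\<chi> \<in> members S"
  using assms unfolding forms_def by blast

lemma forms_Bot: "e \<in> W \<Longrightarrow> Bot \<notin> forms e"
proof
  assume e: "e \<in> W" "Bot \<in> forms e"
  from e(2) obtain \<chi> S where "Bot = unload \<chi>" "step\<^sup>*\<^sup>* S e" "\<chi> \<in> members S" by (rule formsE)
  then have "Fm Bot \<in> members e" using reach_basic[of S e "Fm Bot"] unload_eqD(2)[of \<chi>] by simp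
  then show False using B_not_closed[OF W_B[OF e(1)]] by (simp add: closed_label_def)
qed

lemma forms_Prop: "Prop p \<in> forms e \<Longrightarrow> Fm (Prop p) \<in> members e"
  by (erule formsE) (metis basic_fml.intros(3) reach_basic unload_eqD(1))

lemma forms_Neg_Prop: "Neg (Prop p) \<in> forms e \<Longrightarrow> Fm (Neg (Prop p)) \<in> members e"
  by (erule formsE) (metis basic_fml.intros(4) reach_basic unload_eqD(3))

lemma forms_Box_Atom: "Box (Atom a) \<phi> \<in> forms e \<Longrightarrow> Fm (Box (Atom a) \<phi>) \<in> members e"
  by (erule formsE) (metis basic_fml.intros(5) reach_basic unload_eqD(4))

lemma forms_Neg_Box_Atom:
  assumes "Neg (Box (Atom a) \<phi>) \<in> forms e"
  shows "\<exists>\<chi>\<in>members e. unload \<chi> = Neg (Box (Atom a) \<phi>)"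
proof -
  from assms obtain \<chi> S where *: "Neg (Box (Atom a) \<phi>) = unload \<chi>" "step\<^sup>*\<^sup>* S e" "\<chi> \<in> members S" by (rule formsE)
  then have "basic_fml \<chi>" by (cases \<chi>) (auto intro: basic_fml.intros)
  then show ?thesis using * reach_basic by metis
qed

lemma forms_Neg_Neg:
  assumes "e \<in> W" "Neg (Neg \<phi>) \<in> forms e"
  shows "\<phi> \<in> forms e"
proof -
  from assms(2) obtain \<chi> S where *: "Neg (Neg \<phi>) = unload \<chi>" "step\<^sup>*\<^sup>* S e" "\<chi> \<in> members S" by (rule formsE)
  then have \<chi>: "\<chi> = Fm (Neg (Neg \<phi>))" using unload_eqD(6) by metis
  obtain \<Delta> \<Gamma> \<Sigma>s \<Sigma> where "\<Sigma> \<in> set \<Sigma>s" "replacement RNeg \<chi> \<Delta> \<Gamma> \<Sigma>s" "unload ` \<Sigma> \<subseteq> forms e"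
    using forms_unfold[OF *(2) assms(1) *(3)] \<chi> by auto
  from this(2,1,3) show ?thesis using \<chi> by cases auto
qed

lemma forms_And:
  assumes "e \<in> W" "And \<phi> \<psi> \<in> forms e"
  shows "\<phi> \<in> forms e \<and> \<psi> \<in> forms e"
proof -
  from assms(2) obtain \<chi> S where *: "And \<phi> \<psi> = unload \<chi>" "step\<^sup>*\<^sup>* S e" "\<chi> \<in> members S" by (rule formsE)
  then have \<chi>: "\<chi> = Fm (And \<phi> \<psi>)" using unload_eqD(5) by metis
  obtain \<Delta> \<Gamma> \<Sigma>s \<Sigma> where "\<Sigma> \<in> set \<Sigma>s" "replacement RAnd \<chi> \<Delta> \<Gamma> \<Sigma>s" "unload ` \<Sigma> \<subseteq> forms e"
    using forms_unfold[OF *(2) assms(1) *(3)] \<chi> by auto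
  from this(2,1,3) show ?thesis using \<chi> by cases auto
qed

lemma forms_Neg_And:
  assumes "e \<in> W" "Neg (And \<phi> \<psi>) \<in> forms e"
  shows "Neg \<phi> \<in> forms e \<or> Neg \<psi> \<in> forms e"
proof -
  from assms(2) obtain \<chi> S where *: "Neg (And \<phi> \<psi>) = unload \<chi>" "step\<^sup>*\<^sup>* S e" "\<chi> \<in> members S" by (rule formsE)
  then have \<chi>: "\<chi> = Fm (Neg (And \<phi> \<psi>))" using unload_eqD(7) by metis
  obtain \<Delta> \<Gamma> \<Sigma>s \<Sigma> where "\<Sigma> \<in> set \<Sigma>s" "replacement RNegAnd \<chi> \<Delta> \<Gamma> \<Sigma>s" "unload ` \<Sigma> \<subseteq> forms e"
    using forms_unfold[OF *(2) assms(1) *(3)] \<chi> by auto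
  from this(2,1,3) show ?thesis using \<chi> by cases auto
qed

text \<open>\<open>l\<close> names the child through which the world was reached. Only the negations
  of the tests outside \<open>l\<close> are asserted; nothing is said about the tests in
  \<open>l\<close>.\<close>

lemma forms_Box:
  assumes "e \<in> W" "Box \<alpha> \<phi> \<in> forms e" "\<not> atomic \<alpha>"
  obtains l where "\<And>\<tau>. \<tau> \<in> tests \<alpha> - l \<Longrightarrow> Neg \<tau> \<in> forms e"
    "\<And>Y \<delta>. Y \<subseteq> l \<Longrightarrow> (Y, \<delta>) \<in> Hset \<alpha> \<Longrightarrow> boxes \<delta> \<phi> \<in> forms e"
proof -
  from assms(2) obtain \<chi> S where *: "Box \<alpha> \<phi> = unload \<chi>" "step\<^sup>*\<^sup>* S e" "\<chi> \<in> members S" by (rule formsE)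
  then have \<chi>: "\<chi> = Fm (Box \<alpha> \<phi>)" using unload_eqD(4) by metis
  then have "\<not> basic_fml \<chi>" using assms(3) by (auto simp: atomic_def)
  then obtain \<Delta> \<Gamma> \<Sigma>s \<Sigma> where "\<Sigma> \<in> set \<Sigma>s" "replacement RBox \<chi> \<Delta> \<Gamma> \<Sigma>s" "unload ` \<Sigma> \<subseteq> forms e"
    using forms_unfold[OF *(2) assms(1) *(3)] \<chi> by auto
  from this(2,1,3) obtain \<Sigma>0 where "\<Sigma>0 \<in> unfold_box \<alpha> \<phi>" "\<Sigma>0 \<subseteq> forms e"
    using \<chi> by cases (auto simp: image_image)
  then obtain l where "{Neg \<tau> | \<tau>. \<tau> \<in> tests \<alpha> - l} \<union> {boxes as \<phi> | as. as \<in> Pset l \<alpha>} \<subseteq> forms e"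
    unfolding unfold_box_def by auto
  then show thesis using that[of l] unfolding Pset_eq_Hset by blast
qed

text \<open>The formula may come from an unmarked or a loaded diamond; after erasing marks both
  unfoldings are the same set.\<close>

lemma forms_Neg_Box:
  assumes "e \<in> W" "Neg (Box \<alpha> \<phi>) \<in> forms e" "\<not> atomic \<alpha>"
  obtains Y \<delta> where "(Y, \<delta>) \<in> Hset \<alpha>" "Y \<subseteq> forms e" "Neg (boxes \<delta> \<phi>) \<in> forms e"
proof -
  from assms(2) obtain \<chi> S where *: "Neg (Box \<alpha> \<phi>) = unload \<chi>" "step\<^sup>*\<^sup>* S e" "\<chi> \<in> members S" by (rule formsE)
  then have nb: "\<not> basic_fml \<chi>" using assms(3) by (cases \<chi>) (auto simp: atomic_def)
  obtain \<Delta> \<Gamma> \<Sigma>s \<Sigma> where r: "\<Sigma> \<in> set \<Sigma>s" "replacement (unfold_rule \<chi>) \<chi> \<Delta> \<Gamma> \<Sigma>s" "unload ` \<Sigma> \<subseteq> forms e"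
    using forms_unfold[OF *(2) assms(1) *(3) nb] by blast
  show thesis
  proof (cases \<chi>)
    case (Fm \<psi>)
    then have \<psi>: "\<chi> = Fm (Neg (Box \<alpha> \<phi>))" "unfold_rule \<chi> = RDia" using *(1) by auto
    from r(2,1,3) obtain \<Sigma>0 where "\<Sigma>0 \<in> unfold_dia \<alpha> \<phi>" "\<Sigma>0 \<subseteq> forms e"
      unfolding \<psi> by cases (auto simp: image_image)
    then show thesis using that unfolding unfold_dia_def by auto
  next
    case (NegLd \<beta> \<xi>)
    then have \<beta>: "\<beta> = \<alpha>" "\<phi> = boxes (xi_progs \<xi>) (xi_core \<xi>)" "unfold_rule \<chi> = RLdDia" using *(1) by auto
    from r(2,1) have "\<Sigma> \<in> unfold_ld_dia \<alpha> \<xi>"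
      unfolding \<beta>(3) NegLd \<beta>(1) by cases auto
    then obtain Y \<delta> where Y: "(Y, \<delta>) \<in> Hset \<alpha>" "\<Sigma> = Fm ` Y \<union> {neg_xi (ld_boxes \<delta> \<xi>)}"
      unfolding unfold_ld_dia_def by blast
    moreover have "unload ` \<Sigma> = Y \<union> {Neg (boxes \<delta> \<phi>)}"
      unfolding Y(2) \<beta>(2) by (simp add: image_Un image_image)
    ultimately show thesis using that r(3) by simp
  qed
qed

text \<open>Accessibility is as large as the atomic boxes permit, so these are respected by
  construction and diamonds are where the work lies.\<close>

definition M :: "(('p, 'a) sequent, 'p, 'a) kripke" where
  "M = \<lparr>worlds = W,
    acc = \<lambda>a. {(e, e'). e \<in> W \<and> e' \<in> W \<and> (\<forall>\<phi>. Box (Atom a) \<phi> \<in> forms e \<longrightarrow> \<phi> \<in> forms e')},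
    val = \<lambda>p. {e \<in> W. Prop p \<in> forms e}\<rparr>"

lemma M_simps [simp]:
  "worlds M = W" "(e, e') \<in> acc M a \<longleftrightarrow> e \<in> W \<and> e' \<in> W \<and> (\<forall>\<phi>. Box (Atom a) \<phi> \<in> forms e \<longrightarrow> \<phi> \<in> forms e')"
  "e \<in> val M p \<longleftrightarrow> e \<in> W \<and> Prop p \<in> forms e"
  unfolding M_def by simp_all

lemma kripke_M: "kripke_model M"
  unfolding kripke_model_def by auto

lemma run_W: "run M \<delta> n e v \<Longrightarrow> e \<in> W \<Longrightarrow> v \<in> W"
  by (induct rule: run.induct) simp_all

text \<open>Two implications instead of an equivalence: a world need not contain a formula or its
  negation.\<close>

definition sound :: "('p, 'a) fml \<Rightarrow> bool" where
  "sound \<phi> \<longleftrightarrow> (\<forall>e\<in>W. (\<phi> \<in> forms e \<longrightarrow> holds M \<phi> e) \<and> (Neg \<phi> \<in> forms e \<longrightarrow> \<not> holds M \<phi> e))"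

text \<open>The part of the truth induction that concerns tests, made a hypothesis so that the
  lemmas on runs can precede the truth lemma.\<close>

definition sound_progs :: "('p, 'a) prog list \<Rightarrow> bool" where
  "sound_progs \<delta> \<longleftrightarrow> (\<forall>\<gamma>\<in>set \<delta>. \<forall>\<tau>\<in>tests \<gamma>. sound \<tau>)"

lemma sound_progs_Hset:
  assumes "(Y, \<gamma>) \<in> Hset \<alpha>" "sound_progs (\<alpha> # \<delta>)"
  shows "sound_progs (\<gamma> @ \<delta>)" "\<And>\<tau>. \<tau> \<in> Y \<Longrightarrow> sound \<tau>"
proof -
  show "sound_progs (\<gamma> @ \<delta>)"
    using assms Hset_tests_residual[OF assms(1)] unfolding sound_progs_def by (auto; blast)
  show "\<And>\<tau>. \<tau> \<in> Y \<Longrightarrow> sound \<tau>"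
    using assms(2) Hset_tests[OF assms(1)] unfolding sound_progs_def by auto
qed

text \<open>Induction on the length of the run, since unfolding a star brings the star back, but
  with a shorter run.\<close>

lemma boxes_run:
  "run M \<delta> n e v \<Longrightarrow> e \<in> W \<Longrightarrow> sound_progs \<delta> \<Longrightarrow> boxes \<delta> \<phi> \<in> forms e \<Longrightarrow> \<phi> \<in> forms v"
proof (induct n arbitrary: \<delta> e rule: less_induct)
  case (less n)
  show ?case
  proof (cases \<delta>)
    case Nil
    then show ?thesis using less(2,5) by auto
  next
    case (Cons \<alpha> \<gamma>)
    show ?thesis
    proof (cases "atomic \<alpha>")
      case True
      then obtain a where \<alpha>: "\<alpha> = Atom a" unfolding atomic_def by blast
      with less(2) Cons obtain e' m where e': "(e, e') \<in> acc M a" "run M \<gamma> m e' v" "n = Suc m"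
        by (auto elim: run_AtomE simp del: M_simps)
      have "boxes \<gamma> \<phi> \<in> forms e'" using e'(1) less(5) Cons \<alpha> by simp
      moreover have "e' \<in> W" using e'(1) by simp
      moreover have "sound_progs \<gamma>" using less(4) Cons by (simp add: sound_progs_def)
      ultimately show ?thesis using less(1)[of m \<gamma> e'] e'(2,3) by simp
    next
      case False
      have "Box \<alpha> (boxes \<gamma> \<phi>) \<in> forms e" using less(5) Cons by simp
      with less(3) False obtain l where l: "\<And>\<tau>. \<tau> \<in> tests \<alpha> - l \<Longrightarrow> Neg \<tau> \<in> forms e"
        "\<And>Y \<delta>. Y \<subseteq> l \<Longrightarrow> (Y, \<delta>) \<in> Hset \<alpha> \<Longrightarrow> boxes \<delta> (boxes \<gamma> \<phi>) \<in> forms e"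
        using forms_Box by metis
      from run_unfold[of M \<alpha> \<gamma> n e v] less(2) Cons False obtain Y \<epsilon> m where
        Y: "(Y, \<epsilon>) \<in> Hset \<alpha>" "\<forall>\<tau>\<in>Y. holds M \<tau> e" "run M (\<epsilon> @ \<gamma>) m e v" "m < n" by auto
      have sp: "sound_progs (\<alpha> # \<gamma>)" using less(4) Cons by simp
      \<comment> \<open>A test of the run outside \<open>l\<close> would have its negation in
        \<open>forms e\<close> and so be false at \<open>e\<close>, although the run executes it
        there.\<close>
      have "Y \<subseteq> l"
      proof
        fix \<tau> assume \<tau>: "\<tau> \<in> Y"
        then have "\<not> Neg \<tau> \<in> forms e"
          using Y(2) sound_progs_Hset(2)[OF Y(1) sp \<tau>] less(3) unfolding sound_def by metis
        then show "\<tau> \<in> l" using l(1)[of \<tau>] Hset_tests[OF Y(1)] \<tau> by auto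
      qed
      then have "boxes (\<epsilon> @ \<gamma>) \<phi> \<in> forms e" using l(2)[OF _ Y(1)] by simp
      then show ?thesis
        using less(1)[OF Y(4,3) less(3) sound_progs_Hset(1)[OF Y(1) sp]] by simp
    qed
  qed
qed

definition fulfils :: "('p, 'a) sequent \<Rightarrow> ('p, 'a) prog list \<Rightarrow> ('p, 'a) fml \<Rightarrow> bool" where
  "fulfils S \<pi> \<phi> \<longleftrightarrow> (\<exists>e v n. e \<in> W \<and> step\<^sup>*\<^sup>* S e \<and> run M \<pi> n e v \<and> Neg \<phi> \<in> forms v)"

lemma fulfilsI: "e \<in> W \<Longrightarrow> step\<^sup>*\<^sup>* S e \<Longrightarrow> run M \<pi> n e v \<Longrightarrow> Neg \<phi> \<in> forms v \<Longrightarrow> fulfils S \<pi> \<phi>"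
  unfolding fulfils_def by iprover

lemma fulfilsE:
  assumes "fulfils S \<pi> \<phi>"
  obtains e v n where "e \<in> W" "step\<^sup>*\<^sup>* S e" "run M \<pi> n e v" "Neg \<phi> \<in> forms v"
  using assms unfolding fulfils_def by iprover

lemma fulfils_Nil:
  assumes "S \<in> B" "\<chi> \<in> members S" "unload \<chi> = Neg \<phi>"
  shows "fulfils S [] \<phi>"
proof -
  obtain e where e: "e \<in> W" "step\<^sup>*\<^sup>* S e" using reach_world[OF assms(1)] by blast
  have "Neg \<phi> \<in> forms e" using formsI[OF e(2) assms(2)] assms(3) by simp
  then show ?thesis by (rule fulfilsI[OF e run.nil])
qed

text \<open>\<open>\<pi>\<close> varies while \<open>\<sigma>\<close> stays fixed: an unfolding
  replaces the head of \<open>\<pi>\<close> by a residual, a modal step removes it, and the claim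
  keeps its form.\<close>

definition loads_fulfilled :: "('p, 'a) sequent \<Rightarrow> bool" where
  "loads_fulfilled S \<longleftrightarrow> (\<forall>\<alpha> \<xi> \<pi> \<sigma>. NegLd \<alpha> \<xi> \<in> members S \<longrightarrow> \<alpha> # xi_progs \<xi> = \<pi> @ \<sigma> \<longrightarrow>
     sound_progs \<pi> \<longrightarrow> fulfils S \<pi> (boxes \<sigma> (xi_core \<xi>)))"

lemma loads_fulfilledD:
  "loads_fulfilled S \<Longrightarrow> NegLd \<alpha> \<xi> \<in> members S \<Longrightarrow> \<alpha> # xi_progs \<xi> = \<pi> @ \<sigma> \<Longrightarrow> sound_progs \<pi> \<Longrightarrow>
     fulfils S \<pi> (boxes \<sigma> (xi_core \<xi>))"
  unfolding loads_fulfilled_def by iprover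

text \<open>
  The induction over \<open>builder\<close> bounds the number of loaded sequents that the builder passes
  through, hence eventually the loaded formula is unloaded by fulfilling it.
\<close>

lemma builder_loads_fulfilled:
  "builder X S \<Longrightarrow> S \<in> sequents_over C \<Longrightarrow> loads_fulfilled S"
proof (induct rule: builder.induct)
  case (1 S)
  have S: "S \<in> B" using 1(3) builder.intros[of S X] 1(1,2) unfolding B_iff by blast
  have child: "\<exists>S'\<in>set Ss. S' \<in> B \<and> (loaded (members S') \<longrightarrow> loads_fulfilled S')" if mv: "move ra S Ss" for ra Ss
  proof -
    from 1(2)[OF mv] obtain S' where S': "S' \<in> set Ss"
      and ch: "loaded (members S') \<and> builder X S' \<and> (S' \<in> sequents_over C \<longrightarrow> loads_fulfilled S')
        \<or> free (members S') \<and> S' \<notin> X" by (rule bexE)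
    have "S' \<in> B" by (rule B_child[OF 1(3) mv S']) (use ch in iprover)
    moreover from this have "loaded (members S') \<longrightarrow> loads_fulfilled S'" using ch unfolding B_iff by iprover
    ultimately show ?thesis using S' by (intro bexI conjI)
  qed
  show ?case
    unfolding loads_fulfilled_def
  proof (intro allI impI)
    fix \<alpha> \<xi> \<pi> \<sigma> assume ld: "NegLd \<alpha> \<xi> \<in> members S" and split: "\<alpha> # xi_progs \<xi> = \<pi> @ \<sigma>" and sp: "sound_progs \<pi>"
    show "fulfils S \<pi> (boxes \<sigma> (xi_core \<xi>))"
    proof (cases "\<pi> = []")
      case True
      then have "unload (NegLd \<alpha> \<xi>) = Neg (boxes \<sigma> (xi_core \<xi>))" using split by auto
      then show ?thesis using fulfils_Nil[OF S ld] True by simp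
    next
      case False
      then obtain \<pi>' where \<pi>: "\<pi> = \<alpha> # \<pi>'" "xi_progs \<xi> = \<pi>' @ \<sigma>" using split by (cases \<pi>) auto
      show ?thesis
      proof (cases "basic (members S)")
        case True
        then have "basic_fml (NegLd \<alpha> \<xi>)" using ld unfolding basic_def by (rule bspec)
        then obtain a where a: "\<alpha> = Atom a" by auto
        obtain i \<Delta> \<Gamma> where D: "S = mk_sequent i (insert (NegLd \<alpha> \<xi>) \<Delta>) \<Gamma>" "NegLd \<alpha> \<xi> \<notin> \<Delta>"
          using component_split[OF ld] .
        define S' where "S' = mk_sequent i (insert (neg_xi \<xi>) (modal_proj a \<Delta>)) (modal_proj a \<Gamma>)"
        have mem': "members S' = insert (neg_xi \<xi>) (modal_proj a \<Delta> \<union> modal_proj a \<Gamma>)"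
          unfolding S'_def members_mk_sequent by simp
        have bas: "basic \<Delta>" "basic \<Gamma>" using True unfolding D(1) members_mk_sequent by simp_all
        have "rule_inst (RM, i, NegLd \<alpha> \<xi>) S [S']"
          unfolding D(1) S'_def a using D(2) bas unfolding a by (rule rule_inst.modal)
        then have mv: "move (RM, i, NegLd \<alpha> \<xi>) S [S']" unfolding move_def using True by iprover
        from child[OF mv] have B': "S' \<in> B" "loaded (members S') \<longrightarrow> loads_fulfilled S'" by simp_all
        have SW: "S \<in> W" using S True unfolding W_def by simp
        \<comment> \<open>A world reached from the modal child contains whatever stands under the
          atomic \<open>a\<close>-boxes of \<open>S\<close>, hence is an \<open>a\<close>-successor
          of \<open>S\<close>.\<close>
        have edge: "(S, e) \<in> acc M a" if e: "e \<in> W" "step\<^sup>*\<^sup>* S' e" for e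
        proof -
          have "\<phi> \<in> forms e" if \<phi>: "Box (Atom a) \<phi> \<in> forms S" for \<phi>
          proof -
            have "Fm (Box (Atom a) \<phi>) \<in> \<Delta> \<union> \<Gamma>"
              using forms_Box_Atom[OF \<phi>] unfolding D(1) members_mk_sequent by simp
            then have "Fm \<phi> \<in> members S'" unfolding mem' by (auto simp: modal_proj_def)
            then show ?thesis using formsI[OF e(2), of "Fm \<phi>"] by simp
          qed
          then show ?thesis using SW e(1) by simp
        qed
        have "fulfils S' \<pi>' (boxes \<sigma> (xi_core \<xi>))"
        proof (cases "xi_progs \<xi> = []")
          \<comment> \<open>The marks are used up: the child is free and has no induction
            hypothesis, but the negated core is itself a member of it.\<close>
          case True
          then have "\<pi>' = []" "unload (neg_xi \<xi>) = Neg (boxes \<sigma> (xi_core \<xi>))" using \<pi>(2) by simp_all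
          then show ?thesis using fulfils_Nil[OF B'(1), of "neg_xi \<xi>"] mem' by simp
        next
          case False
          then obtain \<beta> \<zeta> where z: "neg_xi \<xi> = NegLd \<beta> \<zeta>" "xi_progs \<xi> = \<beta> # xi_progs \<zeta>" "xi_core \<xi> = xi_core \<zeta>"
            by (rule neg_xi_cases)
          have "loads_fulfilled S'" using B'(2) False unfolding mem' by simp
          moreover have "NegLd \<beta> \<zeta> \<in> members S'" unfolding mem' z(1) by simp
          moreover have "\<beta> # xi_progs \<zeta> = \<pi>' @ \<sigma>" using \<pi>(2) z(2) by simp
          moreover have "sound_progs \<pi>'" using sp \<pi>(1) by (simp add: sound_progs_def)
          ultimately show ?thesis unfolding z(3) by (rule loads_fulfilledD)
        qed
        then obtain e v n where e: "e \<in> W" "step\<^sup>*\<^sup>* S' e" "run M \<pi>' n e v"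
          "Neg (boxes \<sigma> (xi_core \<xi>)) \<in> forms v" by (rule fulfilsE)
        have "run M \<pi> (Suc n) S v" unfolding \<pi>(1) a by (rule run.atom[OF edge[OF e(1,2)] e(3)])
        then show ?thesis using fulfilsI[OF SW _ _ e(4)] by simp
      next
        case False
        obtain Ss where mv: "move (forced S) S Ss" using forced_move[OF False] by iprover
        from child[OF mv] obtain S' where S': "S' \<in> set Ss" "S' \<in> B" "loaded (members S') \<longrightarrow> loads_fulfilled S'"
          by (elim bexE conjE)
        have st: "step S S'" by (rule step.intros[OF S False mv S'(1,2)])
        have lift: "fulfils S \<rho> \<phi>" if "fulfils S' \<rho> \<phi>" for \<rho> \<phi>
        proof -
          from that obtain e v n where e: "e \<in> W" "step\<^sup>*\<^sup>* S' e" "run M \<rho> n e v" "Neg \<phi> \<in> forms v"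
            by (rule fulfilsE)
          show ?thesis
            by (rule fulfilsI[OF e(1) converse_rtranclp_into_rtranclp[of step, OF st e(2)] e(3,4)])
        qed
        from st show ?thesis
        proof (rule stepE)
          fix i \<chi> \<Delta> \<Gamma> \<Sigma>s \<Sigma>
          assume D: "S = mk_sequent i (insert \<chi> \<Delta>) \<Gamma>" "S' = mk_sequent i (\<Delta> \<union> \<Sigma>) \<Gamma>"
            and r: "\<not> basic_fml \<chi>" "replacement (unfold_rule \<chi>) \<chi> \<Delta> \<Gamma> \<Sigma>s" "\<Sigma> \<in> set \<Sigma>s"
          have mem: "members S = insert \<chi> (\<Delta> \<union> \<Gamma>)" "members S' = \<Delta> \<union> \<Sigma> \<union> \<Gamma>"
            unfolding D members_mk_sequent by simp_all
          show ?thesis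
          proof (cases "\<chi> = NegLd \<alpha> \<xi>")
            case False
            then have ld': "NegLd \<alpha> \<xi> \<in> members S'" using ld unfolding mem by auto
            then have "loads_fulfilled S'" using S'(3) unfolding loaded_def by iprover
            from loads_fulfilledD[OF this ld' split sp] show ?thesis by (rule lift)
          next
            case True
            from r(2) have "set \<Sigma>s = unfold_ld_dia \<alpha> \<xi>" unfolding True unfold_rule.simps by cases auto
            then obtain Y \<delta> where Y: "(Y, \<delta>) \<in> Hset \<alpha>" "\<Sigma> = Fm ` Y \<union> {neg_xi (ld_boxes \<delta> \<xi>)}"
              using r(3) unfolding unfold_ld_dia_def by blast
            let ?x = "ld_boxes \<delta> \<xi>"
            have nx: "neg_xi ?x \<in> members S'" unfolding mem Y(2) by simp
            have sp': "sound_progs (\<alpha> # \<pi>')" using sp \<pi>(1) by simp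
            have "fulfils S' (\<delta> @ \<pi>') (boxes \<sigma> (xi_core \<xi>))"
            proof (cases "xi_progs ?x = []")
              case True
              then have "\<delta> @ \<pi>' = []" "unload (neg_xi ?x) = Neg (boxes \<sigma> (xi_core \<xi>))"
                using \<pi>(2) by simp_all
              then show ?thesis using fulfils_Nil[OF S'(2) nx] by simp
            next
              case False
              then obtain \<beta> \<zeta> where z: "neg_xi ?x = NegLd \<beta> \<zeta>"
                "xi_progs ?x = \<beta> # xi_progs \<zeta>" "xi_core ?x = xi_core \<zeta>"
                by (rule neg_xi_cases)
              have ld': "NegLd \<beta> \<zeta> \<in> members S'" using nx unfolding z(1) .
              then have "loads_fulfilled S'" using S'(3) unfolding loaded_def by iprover
              moreover have "\<beta> # xi_progs \<zeta> = (\<delta> @ \<pi>') @ \<sigma>" using z(2) \<pi>(2) by simp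
              ultimately have "fulfils S' (\<delta> @ \<pi>') (boxes \<sigma> (xi_core \<zeta>))"
                using sound_progs_Hset(1)[OF Y(1) sp'] by (rule loads_fulfilledD[OF _ ld'])
              then show ?thesis using z(3) by simp
            qed
            then obtain e v n where e: "e \<in> W" "step\<^sup>*\<^sup>* S' e" "run M (\<delta> @ \<pi>') n e v"
              "Neg (boxes \<sigma> (xi_core \<xi>)) \<in> forms v" by (rule fulfilsE)
            \<comment> \<open>The tests chosen by the unfolding are members of \<open>S'\<close>, so
              they are in \<open>forms e\<close>; their soundness allows the run to be folded back
              over \<open>\<alpha>\<close>.\<close>
            have "\<forall>\<tau>\<in>Y. holds M \<tau> e"
            proof
              fix \<tau> assume \<tau>: "\<tau> \<in> Y"
              then have "Fm \<tau> \<in> members S'" unfolding mem Y(2) by simp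
              then have "\<tau> \<in> forms e" using formsI[OF e(2), of "Fm \<tau>"] by simp
              then show "holds M \<tau> e" using sound_progs_Hset(2)[OF Y(1) sp' \<tau>] e(1) unfolding sound_def by simp
            qed
            from run_fold[OF Y(1) this e(3)] obtain m where "run M \<pi> m e v" unfolding \<pi>(1) by iprover
            from fulfilsI[OF e(1,2) this e(4)] show ?thesis by (rule lift)
          qed
        qed
      qed
    qed
  qed
qed

text \<open>At a basic sequent the prover may play (L-), which has a single child; since the builder
  survives every move, that child is a world too.\<close>

lemma free_world:
  assumes "e \<in> W"
  obtains e' where "e' \<in> W" "free (members e')" "unload ` members e' = unload ` members e"
proof (cases "loaded (members e)")
  case False
  then show thesis using that assms by blast
next
  case True
  then obtain \<alpha> \<xi> where ld: "NegLd \<alpha> \<xi> \<in> members e" unfolding loaded_def by blast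
  obtain i \<Delta> \<Gamma> where D: "e = mk_sequent i (insert (NegLd \<alpha> \<xi>) \<Delta>) \<Gamma>" "NegLd \<alpha> \<xi> \<notin> \<Delta>"
    using component_split[OF ld] .
  let ?\<chi> = "Fm (unload (NegLd \<alpha> \<xi>))"
  let ?e = "mk_sequent i (\<Delta> \<union> {?\<chi>}) \<Gamma>"
  have bas: "basic (members e)" using W_basic[OF assms] .
  have "replacement RLMinus (NegLd \<alpha> \<xi>) \<Delta> \<Gamma> [{?\<chi>}]"
    using replacement.lminus[of \<alpha> "xi_progs \<xi>" "xi_core \<xi>" \<Delta> \<Gamma>] by simp
  from rule_inst.local[OF D(2) this, of i] have mv: "move (RLMinus, i, NegLd \<alpha> \<xi>) e [?e]"
    unfolding move_def using D(1) bas by simp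
  obtain e' where "e' \<in> set [?e]" "e' \<in> B" using B_move[OF W_B[OF assms] mv] .
  then have B: "?e \<in> B" by simp
  have "free \<Delta> \<and> free \<Gamma>" using single_loadD[of i "NegLd \<alpha> \<xi>" \<Delta> \<Gamma>] D B_single[OF W_B[OF assms]] by simp
  then have "free (members ?e)" unfolding members_mk_sequent by simp
  have "basic (members ?e)" using bas unfolding D(1) members_mk_sequent by auto
  with B have "?e \<in> W" by (rule W_I)
  moreover note \<open>free (members ?e)\<close>
  moreover have "unload ` members ?e = unload ` members e"
    unfolding D(1) members_mk_sequent by simp
  ultimately show thesis by (rule that)
qed

text \<open>The diamond is loaded at another world \<open>?S\<close> that agrees with
  \<open>e\<close> up to marks. The run found there starts at \<open>?S\<close>; as its first edge
  depends on the atomic boxes only, it can be moved to \<open>e\<close>.\<close>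

lemma atom_diamond:
  assumes e: "e \<in> W" and "Neg (Box (Atom a) (boxes \<rho> \<phi>)) \<in> forms e" and sp: "sound_progs (Atom a # \<rho>)"
  shows "\<exists>v n. run M (Atom a # \<rho>) n e v \<and> Neg \<phi> \<in> forms v"
proof -
  obtain e' where e': "e' \<in> W" "free (members e')" "unload ` members e' = unload ` members e"
    using free_world[OF e] .
  \<comment> \<open>The boxes of \<open>\<phi>\<close> get marked as well; they form the part of the
    load that is not to be run.\<close>
  obtain \<beta>s \<psi> where \<phi>: "\<phi> = boxes \<beta>s \<psi>" "\<forall>\<beta> \<psi>'. \<psi> \<noteq> Box \<beta> \<psi>'" using box_decomposition[of \<phi>] by blast
  let ?\<chi> = "Fm (Neg (Box (Atom a) (boxes (\<rho> @ \<beta>s) \<psi>)))"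
  let ?\<xi> = "ld_boxes (\<rho> @ \<beta>s) (Unl \<psi>)"
  obtain \<chi> where "\<chi> \<in> members e" "unload \<chi> = Neg (Box (Atom a) (boxes \<rho> \<phi>))"
    using forms_Neg_Box_Atom[OF assms(2)] by blast
  then have "unload ?\<chi> \<in> unload ` members e'" unfolding e'(3) using \<phi>(1) by force
  then obtain \<chi>' where "\<chi>' \<in> members e'" "unload \<chi>' = unload ?\<chi>" by force
  moreover from this(1) e'(2) have "\<not> is_ld \<chi>'" unfolding loaded_iff by blast
  ultimately have "?\<chi> \<in> members e'" by (cases \<chi>') auto
  then obtain i \<Delta> \<Gamma> where D: "e' = mk_sequent i (insert ?\<chi> \<Delta>) \<Gamma>" "?\<chi> \<notin> \<Delta>"
    by (rule component_split)
  have bas: "basic \<Delta>" "basic \<Gamma>" "free \<Delta>" "free \<Gamma>"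
    using W_basic[OF e'(1)] e'(2) unfolding D(1) members_mk_sequent by simp_all
  let ?S = "mk_sequent i (\<Delta> \<union> {NegLd (Atom a) ?\<xi>}) \<Gamma>"
  from rule_inst.local[OF D(2) replacement.lplus[OF bas(3,1,4,2) \<phi>(2)], of i]
  have mv: "move (RLPlus, i, ?\<chi>) e' [?S]" unfolding move_def using D(1) W_basic[OF e'(1)] by simp
  obtain S where "S \<in> set [?S]" "S \<in> B" using B_move[OF W_B[OF e'(1)] mv] .
  then have B: "?S \<in> B" by simp
  have "basic (members ?S)" using bas unfolding members_mk_sequent by simp
  with B have SW: "?S \<in> W" by (rule W_I)
  have un: "unload ` members ?S = unload ` members e"
    unfolding e'(3)[symmetric] D(1) members_mk_sequent by simp
  have "loads_fulfilled ?S" using B builder_loads_fulfilled unfolding B_iff by iprover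
  moreover have "NegLd (Atom a) ?\<xi> \<in> members ?S" unfolding members_mk_sequent by simp
  moreover have "Atom a # xi_progs ?\<xi> = (Atom a # \<rho>) @ \<beta>s" by simp
  ultimately have "fulfils ?S (Atom a # \<rho>) (boxes \<beta>s (xi_core ?\<xi>))" using sp by (rule loads_fulfilledD)
  then obtain e1 v n where e1: "e1 \<in> W" "step\<^sup>*\<^sup>* ?S e1" "run M (Atom a # \<rho>) n e1 v"
    "Neg (boxes \<beta>s (xi_core ?\<xi>)) \<in> forms v" by (rule fulfilsE)
  have "e1 = ?S" using W_step[OF SW e1(2)] .
  then obtain u m where u: "(?S, u) \<in> acc M a" "run M \<rho> m u v" using e1(3) by (auto elim: run_AtomE simp del: M_simps)
  have "\<psi>' \<in> forms u" if "Box (Atom a) \<psi>' \<in> forms e" for \<psi>'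
  proof -
    have "unload (Fm (Box (Atom a) \<psi>')) \<in> unload ` members e" using forms_Box_Atom[OF that] by (rule imageI)
    then have "Box (Atom a) \<psi>' \<in> unload ` members ?S" unfolding un by simp
    moreover have "unload ` members ?S \<subseteq> forms ?S" using forms_self by (rule image_subsetI)
    ultimately have "Box (Atom a) \<psi>' \<in> forms ?S" by (rule rev_subsetD)
    then show ?thesis using u(1) by simp
  qed
  then have "(e, u) \<in> acc M a" using e u(1) by simp
  then have "run M (Atom a # \<rho>) (Suc m) e v" using u(2) by (rule run.atom)
  moreover have "Neg \<phi> \<in> forms v" using e1(4) \<phi>(1) by simp
  ultimately show ?thesis by blast
qed

text \<open>On the way to \<open>e\<close> a non-atomic diamond was unfolded to true tests and a
  residual that is empty or starts with an atomic program, which leaves only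
  \<open>atom_diamond\<close>.\<close>

lemma diamond:
  assumes e: "e \<in> W" "Neg (Box \<alpha> \<phi>) \<in> forms e" and sp: "sound_progs [\<alpha>]"
  shows "\<exists>v n. run M [\<alpha>] n e v \<and> Neg \<phi> \<in> forms v"
proof (cases "atomic \<alpha>")
  case True
  then obtain a where "\<alpha> = Atom a" unfolding atomic_def by blast
  then show ?thesis using atom_diamond[of e a "[]" \<phi>] assms by simp
next
  case False
  obtain Y \<delta> where Y: "(Y, \<delta>) \<in> Hset \<alpha>" "Y \<subseteq> forms e" "Neg (boxes \<delta> \<phi>) \<in> forms e"
    using forms_Neg_Box[OF e False] .
  have "\<exists>v n. run M \<delta> n e v \<and> Neg \<phi> \<in> forms v"
  proof (cases "\<delta> = []")
    case True
    then show ?thesis using Y(3) run.nil[of M e] by (intro exI[of _ e] exI[of _ 0]) simp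
  next
    case False
    then obtain a \<rho> where \<delta>: "\<delta> = Atom a # \<rho>" using Hset_head[OF Y(1)] by blast
    have "sound_progs (Atom a # \<rho>)" using sound_progs_Hset(1)[OF Y(1) sp] \<delta> by simp
    then show ?thesis using atom_diamond[OF e(1), of a \<rho> \<phi>] Y(3) \<delta> by simp
  qed
  then obtain v n where v: "run M \<delta> n e v" "Neg \<phi> \<in> forms v" by blast
  have "\<forall>\<tau>\<in>Y. holds M \<tau> e"
    using Y(2) sound_progs_Hset(2)[OF Y(1) sp] e(1) unfolding sound_def by blast
  then obtain m where "run M [\<alpha>] m e v" using run_fold[OF Y(1), of M e "[]" n v] v(1) by auto
  then show ?thesis using v(2) by blast
qed

text \<open>In the mutual induction a program contributes just the soundness of its tests, which is
  the hypothesis \<open>sound_progs [\<alpha>]\<close> needed for both signs of a box.\<close>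

lemma truth: "sound \<phi>" and truth_tests: "\<forall>\<tau>\<in>tests \<alpha>. sound \<tau>"
proof (induct \<phi> and \<alpha> rule: fml.induct prog.induct)
  case Bot
  show ?case using forms_Bot by (simp add: sound_def)
next
  case (Prop p)
  have "Prop p \<notin> forms e" if e: "e \<in> W" "Neg (Prop p) \<in> forms e" for e
    using forms_Prop[of p e] forms_Neg_Prop[OF e(2)] B_not_closed[OF W_B[OF e(1)]]
    unfolding closed_label_def by blast
  then show ?case by (simp add: sound_def)
next
  case (Neg \<phi>)
  then show ?case using forms_Neg_Neg by (simp add: sound_def)
next
  case (And \<phi> \<psi>)
  show ?case
    unfolding sound_def
  proof (intro ballI conjI impI)
    fix e assume e: "e \<in> W" "And \<phi> \<psi> \<in> forms e"
    from forms_And[OF this] show "holds M (And \<phi> \<psi>) e" using And e(1) by (simp add: sound_def)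
  next
    fix e assume e: "e \<in> W" "Neg (And \<phi> \<psi>) \<in> forms e"
    from forms_Neg_And[OF this] show "\<not> holds M (And \<phi> \<psi>) e" using And e(1) by (auto simp: sound_def)
  qed
next
  case (Box \<alpha> \<phi>)
  have sp: "sound_progs [\<alpha>]" using Box(1) by (simp add: sound_progs_def)
  show ?case
    unfolding sound_def
  proof (intro ballI conjI impI)
    fix e assume e: "e \<in> W" "Box \<alpha> \<phi> \<in> forms e"
    have "holds M \<phi> v" if "run M [\<alpha>] n e v" for n v
      using boxes_run[OF that e(1) sp, of \<phi>] e(2) run_W[OF that e(1)] Box(2) unfolding sound_def by simp
    then have "holds M (boxes [\<alpha>] \<phi>) e" using holds_boxes[OF kripke_M, of e "[\<alpha>]" \<phi>] e(1) by simp
    then show "holds M (Box \<alpha> \<phi>) e" by simp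
  next
    fix e assume e: "e \<in> W" "Neg (Box \<alpha> \<phi>) \<in> forms e"
    obtain v n where v: "run M [\<alpha>] n e v" "Neg \<phi> \<in> forms v" using diamond[OF e sp] by blast
    then have "\<not> holds M \<phi> v" using Box(2) run_W[OF v(1) e(1)] unfolding sound_def by blast
    moreover have "e \<in> worlds M" using e(1) by simp
    ultimately have "holds M (Neg (boxes [\<alpha>] \<phi>)) e" using not_holds_boxes[OF kripke_M] v(1) by metis
    then show "\<not> holds M (Box \<alpha> \<phi>) e" by simp
  qed
qed auto

lemma finite_W: "finite W"
proof -
  have "W \<subseteq> sequents_over C" unfolding W_def B_def by blast
  then show ?thesis using finite_sequents_over[OF finite_C] by (rule finite_subset)
qed

lemma unrefuted_satisfied:
  assumes "S \<in> sequents_over C" "S \<notin> X"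
  shows "\<exists>e\<in>W. \<forall>\<chi>\<in>members S. holds M (unload \<chi>) e"
proof -
  have "S \<in> B" using assms unfolding B_def by blast
  then obtain e where e: "e \<in> W" "step\<^sup>*\<^sup>* S e" using reach_world by blast
  have "holds M (unload \<chi>) e" if "\<chi> \<in> members S" for \<chi>
    using truth[of "unload \<chi>"] formsI[OF e(2) that] e(1) unfolding sound_def by blast
  then show ?thesis using e(1) by blast
qed

end

section \<open>Transfer of a model along an injection into another type of worlds\<close>

lemma rtrancl_image_inj:
  assumes "inj_on f A" "R \<subseteq> A \<times> A"
  shows "(map_prod f f ` R)\<^sup>* \<inter> (f ` A) \<times> (f ` A) = map_prod f f ` (R\<^sup>* \<inter> A \<times> A)"
proof (intro equalityI subsetI)
  fix p assume p: "p \<in> (map_prod f f ` R)\<^sup>* \<inter> (f ` A) \<times> (f ` A)"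
  then obtain x v where x: "p = (f x, v)" "x \<in> A" "(f x, v) \<in> (map_prod f f ` R)\<^sup>*" by auto
  from x(3) have "\<exists>y\<in>A. v = f y \<and> (x, y) \<in> R\<^sup>*"
  proof (induct rule: rtrancl_induct)
    case base
    then show ?case using x(2) by blast
  next
    case (step v w)
    then obtain y where y: "y \<in> A" "v = f y" "(x, y) \<in> R\<^sup>*" by blast
    from step(2) obtain y' z where z: "v = f y'" "w = f z" "(y', z) \<in> R" by auto
    then have "y' \<in> A" "z \<in> A" using assms(2) by blast+
    moreover from this have "y' = y" using inj_onD[OF assms(1)] y z(1) by metis
    ultimately show ?case using y z by (intro bexI[of _ z]) (auto intro: rtrancl_into_rtrancl)
  qed
  then obtain y where "y \<in> A" "v = f y" "(x, y) \<in> R\<^sup>*" by blast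
  then show "p \<in> map_prod f f ` (R\<^sup>* \<inter> A \<times> A)" using x(1,2) by (intro image_eqI[of _ _ "(x, y)"]) auto
next
  fix p assume "p \<in> map_prod f f ` (R\<^sup>* \<inter> A \<times> A)"
  then obtain x y where xy: "p = (f x, f y)" "(x, y) \<in> R\<^sup>*" "x \<in> A" "y \<in> A" by auto
  from xy(2) have "(f x, f y) \<in> (map_prod f f ` R)\<^sup>*"
  proof (induct rule: rtrancl_induct)
    case (step y z)
    have "(f y, f z) \<in> map_prod f f ` R" using step(2) by (intro image_eqI[of _ _ "(y, z)"]) simp_all
    then show ?case using step(3) by (rule rtrancl_into_rtrancl[rotated])
  qed simp
  then show "p \<in> (map_prod f f ` R)\<^sup>* \<inter> (f ` A) \<times> (f ` A)" using xy by simp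
qed

lemma relcomp_image_inj:
  assumes "inj_on f A" "R \<subseteq> A \<times> A" "Q \<subseteq> A \<times> A"
  shows "map_prod f f ` R O map_prod f f ` Q = map_prod f f ` (R O Q)"
proof (intro equalityI subsetI)
  fix p assume "p \<in> map_prod f f ` R O map_prod f f ` Q"
  then obtain x y y' z where p: "p = (f x, f z)" "(x, y) \<in> R" "(y', z) \<in> Q" "f y = f y'" by auto
  then have "y \<in> A" "y' \<in> A" using assms(2,3) by blast+
  then have "y = y'" using inj_onD[OF assms(1) p(4)] by blast
  then have "(x, z) \<in> R O Q" using p by blast
  then show "p \<in> map_prod f f ` (R O Q)" using p(1) by (intro image_eqI[of _ _ "(x, z)"]) simp_all
qed force

definition image_model :: "('v \<Rightarrow> 'w) \<Rightarrow> ('v, 'p, 'a) kripke \<Rightarrow> ('w, 'p, 'a) kripke" where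
  "image_model f N = \<lparr>worlds = f ` worlds N, acc = \<lambda>a. map_prod f f ` acc N a, val = \<lambda>p. f ` val N p\<rparr>"

lemma image_model_simps [simp]:
  "worlds (image_model f N) = f ` worlds N" "acc (image_model f N) a = map_prod f f ` acc N a"
  "val (image_model f N) p = f ` val N p"
  unfolding image_model_def by simp_all

lemma kripke_image_model: "kripke_model N \<Longrightarrow> kripke_model (image_model f N)"
  unfolding kripke_model_def by fastforce

text \<open>Programs denote relations between worlds, where \<open>f\<close> is injective, so images
  commute with composition; for the star, the restriction to worlds removes the reflexive pairs
  outside the image.\<close>

lemma
  fixes \<phi> :: "('p, 'a) fml" and \<alpha> :: "('p, 'a) prog"
  assumes N: "kripke_model N" and inj: "inj_on f (worlds N)"
  shows holds_image_model: "w \<in> worlds N \<Longrightarrow> holds (image_model f N) \<phi> (f w) \<longleftrightarrow> holds N \<phi> w"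
    and rel_image_model: "rel (image_model f N) \<alpha> = map_prod f f ` rel N \<alpha>"
proof (induct \<phi> and \<alpha> arbitrary: w rule: fml.induct prog.induct)
  case (Prop p)
  have "val N p \<subseteq> worlds N" using N unfolding kripke_model_def by blast
  then show ?case using inj_on_image_mem_iff[OF inj Prop] by simp
next
  case (Box \<alpha> \<phi>)
  have "(f w, u) \<in> map_prod f f ` rel N \<alpha> \<longleftrightarrow> (\<exists>v. u = f v \<and> (w, v) \<in> rel N \<alpha>)" for u
  proof
    assume "(f w, u) \<in> map_prod f f ` rel N \<alpha>"
    then obtain x v where x: "f w = f x" "u = f v" "(x, v) \<in> rel N \<alpha>" by auto
    then have "x \<in> worlds N" using rel_worlds[OF N] by blast
    then have "w = x" using inj_onD[OF inj x(1)] Box(3) by blast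
    then show "\<exists>v. u = f v \<and> (w, v) \<in> rel N \<alpha>" using x by blast
  next
    assume "\<exists>v. u = f v \<and> (w, v) \<in> rel N \<alpha>"
    then show "(f w, u) \<in> map_prod f f ` rel N \<alpha>" by force
  qed
  moreover have "holds (image_model f N) \<phi> (f v) \<longleftrightarrow> holds N \<phi> v" if "(w, v) \<in> rel N \<alpha>" for v
    using Box(2) rel_worlds[OF N that] by blast
  ultimately show ?case using Box(1) by auto
next
  case (Test \<tau>)
  then show ?case by (auto simp: image_iff)
next
  case (Choice \<alpha> \<beta>)
  then show ?case by (simp add: image_Un)
next
  case (Seq \<alpha> \<beta>)
  have "rel N \<gamma> \<subseteq> worlds N \<times> worlds N" for \<gamma> using rel_worlds[OF N] by auto
  then show ?case using Seq relcomp_image_inj[OF inj] by simp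
next
  case (Star \<alpha>)
  have "rel N \<gamma> \<subseteq> worlds N \<times> worlds N" for \<gamma> using rel_worlds[OF N] by auto
  then show ?case using Star rtrancl_image_inj[OF inj] by simp
qed simp_all

theorem completeness:
  assumes fin: "finite \<Gamma>1" "finite \<Gamma>2" and inf: "infinite (UNIV :: 'w set)"
    and unsat: "\<not> satisfiable TYPE('w) (\<Gamma>1 \<union> \<Gamma>2)"
  shows "\<exists>T. split_pdl_tableau T \<and> closed_tableau T \<and> uniform T \<and> tableau_for T \<Gamma>1 \<Gamma>2"
proof -
  obtain C where C: "finite C" "fl_closed C" "\<Gamma>1 \<union> \<Gamma>2 \<subseteq> C"
    using fl_closure_exists[of "\<Gamma>1 \<union> \<Gamma>2"] fin by blast
  let ?S = "(Fm ` \<Gamma>1, Fm ` \<Gamma>2)"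
  have S: "?S \<in> sequents_over C" using sequents_over_root[OF C(3)] .
  obtain n where n: "prover (sequents_over C) (Suc n) = prover (sequents_over C) n"
    using prover_stable[OF finite_sequents_over[OF C(1)]] by blast
  interpret unrefuted C "prover (sequents_over C) n"
    by unfold_locales (use C n in simp_all)
  have "?S \<in> prover (sequents_over C) n"
  proof (rule ccontr)
    assume "?S \<notin> prover (sequents_over C) n"
    then obtain e where e: "e \<in> W" "\<forall>\<chi>\<in>members ?S. holds M (unload \<chi>) e"
      using unrefuted_satisfied[OF S] by blast
    \<comment> \<open>The model of the builder is finite but its size is not bounded in advance,
      hence the need for an infinite type.\<close>
    obtain A :: "'w set" where "finite A" "card A = card W"
      using infinite_arbitrarily_large[OF inf] by blast
    then obtain f where "bij_betw f W A" using finite_same_card_bij[OF finite_W] by metis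
    then have inj: "inj_on f (worlds M)" by (simp add: bij_betw_def)
    have "holds (image_model f M) \<phi> (f e)" if "\<phi> \<in> \<Gamma>1 \<union> \<Gamma>2" for \<phi>
    proof -
      have "Fm \<phi> \<in> members ?S" using that by auto
      from bspec[OF e(2) this] show ?thesis using holds_image_model[OF kripke_M inj, of e \<phi>] e(1) by simp
    qed
    moreover have "f e \<in> worlds (image_model f M)" using e(1) by simp
    ultimately have "satisfiable TYPE('w) (\<Gamma>1 \<union> \<Gamma>2)"
      unfolding satisfiable_def using kripke_image_model[OF kripke_M] by blast
    then show False using unsat by blast
  qed
  from prover_tableau[OF C(1,2) this] show ?thesis unfolding tableau_for_def .
qed

text \<open>Completeness delivers a uniform tableau at once, and forgetting uniformity returns to
  the hypothesis of soundness, so the three statements form a cycle.\<close>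

theorem theorem7p23:
  fixes \<Gamma>1 \<Gamma>2 :: "('p, 'a) fml set"
  assumes "finite \<Gamma>1" and "finite \<Gamma>2"
    and "infinite (UNIV :: 'w set)"
  shows "(\<not> satisfiable TYPE('w) (\<Gamma>1 \<union> \<Gamma>2) \<longleftrightarrow>
            (\<exists>T. split_pdl_tableau T \<and> closed_tableau T \<and> tableau_for T \<Gamma>1 \<Gamma>2)) \<and>
         ((\<exists>T. split_pdl_tableau T \<and> closed_tableau T \<and> tableau_for T \<Gamma>1 \<Gamma>2) \<longleftrightarrow>
            (\<exists>T. split_pdl_tableau T \<and> closed_tableau T \<and> uniform T \<and> tableau_for T \<Gamma>1 \<Gamma>2))"
  using soundness[OF _ _ _ assms(1,2), where 'w = 'w] completeness[OF assms] by blast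

end
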